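(* Let $d\ge2$, let $\kappa=(\kappa_1,\dots,\kappa_d)$ with all $\kappa_i\ge0$, and assume $\alpha_\kappa=|\kappa|+\frac{d-2}{2}\ge\frac12$. Let $1\le p\le\infty$. For $f\in L^p_{\mathsf{u}(\kappa)}(\mathbb{V}_0^{d+1})$ and $g\in L^1_{u(2\alpha_\kappa)}(\mathbb{R}_+)$, $$\|f*g\|_{p,\kappa}\le\|f\|_{p,\kappa}\,\|g\|_{1,u(2\alpha_\kappa)}.$$
   Context: Notation: $|\kappa|=\kappa_1+\dots+\kappa_d$, $h_\kappa(x)=\prod_{i=1}^d|x_i|^{\kappa_i}$, $\mathbb{R}_+=[0,\infty)$. The conic surface is $\mathbb{V}_0^{d+1}=\{(x,t)\in\mathbb{R}^d\times\mathbb{R}_+:\|x\|=t\}$ with measure $\sigma$ given by $\int_{\mathbb{V}_0^{d+1}}f\,d\sigma=\int_0^\infty t^{d-1}\int_{\mathbb{S}^{d-1}}f(t\xi,t)\,d\sigma_{\mathbb{S}}(\xi)\,dt$, where $d\sigma_{\mathbb S}$ is the surface measure of $\mathbb{S}^{d-1}$. Put $\mathsf{w}_\kappa(x,t)=h_\kappa^2(x)t^{-1}e^{-t}$, $\mathsf{u}_\kappa(x,t)=h_\kappa^2(x)t^{-1}$, and $\mathsf{b}_\kappa=1/\int_{\mathbb{V}_0^{d+1}}\mathsf{w}_\kappa\,d\sigma$. Norms on the surface: $\|f\|_{p,\kappa}=\big(\mathsf{b}_\kappa\int_{\mathbb{V}_0^{d+1}}|f(x,t)e^{-t/2}|^p\,\mathsf{u}_\kappa(x,t)\,d\sigma(x,t)\big)^{1/p}$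 for $1\le p<\infty$, and $\|f\|_{\infty,\kappa}=\operatorname{ess\,sup}\{|f(x,t)|e^{-t/2}\}$; $L^p_{\mathsf{u}(\kappa)}(\mathbb{V}_0^{d+1})$ is the space of $f$ with finite norm. Norms on $\mathbb{R}_+$: $\|g\|_{p,u(\alpha)}=\big(\frac{1}{\Gamma(\alpha+1)}\int_0^\infty|g(t)e^{-t/2}|^pt^\alpha\,dt\big)^{1/p}$, with corresponding space $L^p_{u(\alpha)}(\mathbb{R}_+)$. Generalized translation (for $\alpha_\kappa>0$): for $g:\mathbb{R}_+\to\mathbb{R}$ and $(x,t)\in\mathbb{V}_0^{d+1}$, $$\mathsf{T}_{(x,t)}g(y,s)=C_\kappa\int_{[-1,1]^d}\int_0^\pi g\big(t+s+2\rho\cos\theta\big)e^{-\rho\cos\theta}j_{\alpha_\kappa-1}(\rho\sin\theta)(\sin\theta)^{2\alpha_\kappa-1}\,d\theta\,\Phi_\kappa(u)\,du,$$ where $\rho=\rho(x,t,y,s;u)=\sqrt{\tfrac12(ts+x_1y_1u_1+\dots+x_dy_du_d)}$, $j_\alpha(z)=z^{-\alpha}J_\alpha(z)$ ($J_\alpha$ the Bessel function), $\Phi_\kappa(u)=\prod_{i=1}^d(1+u_i)(1-u_i^2)^{\kappa_i-1}$, $C_\kappa=\frac{2^{\alpha_\kappa-1}\Gamma(\alpha_\kappa+\frac12)}{\sqrt\pi}\prod_{i=1}^dc_{\kappa_i-\frac12}$, $c_\lambda=\frac{\Gamma(\lambda+1)}{\Gamma(\frac12)\Gamma(\lambda+\frac12)}$;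 if $\kappa_i=0$, then $c_{\kappa_i-\frac12}\int_{-1}^1f(u_i)(1+u_i)(1-u_i^2)^{\kappa_i-1}du_i$ is understood as its limit $f(1)$. Pseudo convolution: $f*g(x,t)=\mathsf{b}_\kappa\int_{\mathbb{V}_0^{d+1}}f(y,s)\,\mathsf{T}_{(x,t)}g(y,s)\,\mathsf{w}_\kappa(y,s)\,d\sigma(y,s)$. *)

theory Defs
  imports "HOL-Probability.Probability"
begin

text \<open>
  The space \<open>\<real>\<^sup>d\<close> is \<open>real ^ 'n\<close> with \<open>d = CARD('n)\<close>, and points of the cone are pairs
  \<open>(x, t) :: (real ^ 'n) \<times> real\<close>.

  Here \<open>0 powr a = 0\<close> for every \<open>a\<close>, also for \<open>a = 0\<close>, and \<open>1 / 0 = 0\<close>. Below, these values are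
  only used on null sets of the integrals in which they occur (a coordinate of \<open>x\<close> equal to \<open>0\<close>,
  the apex \<open>t = 0\<close>, the end points of \<open>[-1, 1]\<close> and of \<open>[0, \<pi>]\<close>).
\<close>

section \<open>The conic surface and its measure\<close>

definition conic_surface :: "((real ^ 'n::finite) \<times> real) set" where
  "conic_surface = {(x, t). 0 \<le> t \<and> norm x = t}"

text \<open>
  Surface measure of the unit sphere: the surface measure of \<open>A\<close> is \<open>d\<close> times the volume of the
  cone \<open>{r \<xi> | \<xi> \<in> A, 0 < r < 1}\<close>.
\<close>

definition sphere_measure :: "(real ^ 'n::finite) measure" where
  "sphere_measure =
     scale_measure (of_nat CARD('n))
       (distr (restrict_space lborel (ball 0 1 - {0})) (restrict_space borel (sphere 0 1))
          (\<lambda>x. x /\<^sub>R norm x))"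

definition conic_measure :: "((real ^ 'n::finite) \<times> real) measure" where
  "conic_measure =
     distr (density (restrict_space lborel {0..} \<Otimes>\<^sub>M sphere_measure)
              (\<lambda>(t, \<xi>). ennreal (t ^ (CARD('n) - 1))))
       (restrict_space borel conic_surface) (\<lambda>(t, \<xi>). (t *\<^sub>R \<xi>, t))"

lemma space_sphere_measure [simp]: "space sphere_measure = sphere 0 1"
  by (simp add: sphere_measure_def space_restrict_space space_scale_measure)

lemma sets_sphere_measure [measurable_cong]:
  "sets sphere_measure = sets (restrict_space borel (sphere 0 1))"
  by (simp add: sphere_measure_def)

lemma space_conic_measure [simp]: "space conic_measure = conic_surface"
  by (simp add: conic_measure_def space_restrict_space)

lemma sets_conic_measure [measurable_cong]:
  "sets conic_measure = sets (restrict_space borel conic_surface)"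
  by (simp add: conic_measure_def)

lemma measurable_sphere_projection:
  "(\<lambda>x. x /\<^sub>R norm x) \<in> restrict_space lborel (ball 0 1 - {0::real ^ 'n::finite})
     \<rightarrow>\<^sub>M restrict_space borel (sphere 0 1)"
  by (intro measurable_restrict_space2 measurable_restrict_space1)
    (auto simp: space_restrict_space)

lemma emeasure_sphere_measure:
  assumes "A \<in> sets (restrict_space borel (sphere 0 1))"
  shows "emeasure sphere_measure (A :: (real ^ 'n::finite) set) =
     of_nat CARD('n) * emeasure lborel {x \<in> ball 0 1 - {0}. x /\<^sub>R norm x \<in> A}"
proof -
  have eq: "(\<lambda>x. x /\<^sub>R norm x) -` A \<inter> (ball 0 1 - {0}) = {x \<in> ball 0 1 - {0}. x /\<^sub>R norm x \<in> A}"
    by auto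
  show ?thesis
    unfolding sphere_measure_def using assms
    by (simp add: emeasure_distr[OF measurable_sphere_projection] space_restrict_space eq
        del: Diff_iff) (subst emeasure_restrict_space, auto)
qed

lemma finite_measure_sphere_measure:
  "finite_measure (sphere_measure :: (real ^ 'n::finite) measure)"
proof
  let ?B = "{x \<in> ball 0 1 - {0::real^'n}. x /\<^sub>R norm x \<in> sphere 0 1}"
  have "sphere (0::real^'n) 1 \<in> sets (restrict_space borel (sphere 0 1))"
    by (simp add: sets_restrict_space_iff)
  note e = emeasure_sphere_measure[OF this]
  have "emeasure lborel ?B \<le> emeasure lborel (ball (0::real^'n) 1)"
    by (rule emeasure_mono) auto
  also have "\<dots> < \<infinity>"
    by (rule emeasure_lborel_ball_finite)
  finally have "of_nat CARD('n) * emeasure lborel ?B < (\<infinity>::ennreal)"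
    by (simp add: ennreal_mult_less_top of_nat_less_top)
  then show "emeasure sphere_measure (space (sphere_measure :: (real ^ 'n) measure)) \<noteq> \<infinity>"
    using e by simp
qed

lemma nn_integral_conic_measure:
  fixes F :: "(real ^ 'n::finite) \<times> real \<Rightarrow> ennreal"
  assumes F: "F \<in> borel_measurable conic_measure"
  shows "(\<integral>\<^sup>+z. F z \<partial>conic_measure) =
     (\<integral>\<^sup>+t\<in>{0..}. (ennreal (t ^ (CARD('n) - 1)) *
        (\<integral>\<^sup>+\<xi>. F (t *\<^sub>R \<xi>, t) \<partial>sphere_measure)) \<partial>lborel)"
proof -
  let ?L = "restrict_space lborel {0::real..}" and ?S = "sphere_measure :: (real ^ 'n) measure"
  let ?m = "\<lambda>(t, \<xi>). (t *\<^sub>R \<xi>, t) :: (real ^ 'n) \<times> real"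
  let ?w = "\<lambda>(t, \<xi>). ennreal (t ^ (CARD('n) - 1))"
  interpret S: finite_measure ?S by (rule finite_measure_sphere_measure)
  have t: "(\<lambda>z. fst z) \<in> borel_measurable (?L \<Otimes>\<^sub>M ?S)"
    by (rule measurable_compose[OF measurable_fst]) (simp add: measurable_restrict_space1)
  have x: "(\<lambda>z. snd z) \<in> borel_measurable (?L \<Otimes>\<^sub>M ?S)"
    by (rule measurable_compose[OF measurable_snd])
      (simp add: measurable_restrict_space1 cong: measurable_cong_sets sets_sphere_measure)
  have m: "?m \<in> ?L \<Otimes>\<^sub>M ?S \<rightarrow>\<^sub>M restrict_space borel conic_surface"
  proof (rule measurable_restrict_space2)
    show "?m \<in> space (?L \<Otimes>\<^sub>M ?S) \<rightarrow> conic_surface"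
      by (auto simp: space_pair_measure space_restrict_space conic_surface_def)
    show "?m \<in> borel_measurable (?L \<Otimes>\<^sub>M ?S)"
      using t x unfolding split_beta' by measurable
  qed
  have w: "?w \<in> borel_measurable (?L \<Otimes>\<^sub>M ?S)"
    using t unfolding split_beta' by measurable
  have F': "F \<in> borel_measurable (restrict_space borel conic_surface)"
    using F by (simp cong: measurable_cong_sets add: sets_conic_measure)
  note Fm = measurable_compose[OF m F']
  have "(\<integral>\<^sup>+z. F z \<partial>conic_measure) = (\<integral>\<^sup>+z. ?w z * F (?m z) \<partial>(?L \<Otimes>\<^sub>M ?S))"
    unfolding conic_measure_def using m w F' Fm
    by (simp add: nn_integral_distr nn_integral_density)
  also have "\<dots> = (\<integral>\<^sup>+t. \<integral>\<^sup>+\<xi>. ?w (t, \<xi>) * F (?m (t, \<xi>)) \<partial>?S \<partial>?L)"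
    using w Fm by (subst S.nn_integral_fst[symmetric]) auto
  also have "\<dots> = (\<integral>\<^sup>+t. ennreal (t ^ (CARD('n) - 1)) * (\<integral>\<^sup>+\<xi>. F (t *\<^sub>R \<xi>, t) \<partial>?S) \<partial>?L)"
  proof (rule nn_integral_cong)
    fix t :: real assume t: "t \<in> space ?L"
    have "(\<lambda>\<xi>. F (?m (t, \<xi>))) \<in> borel_measurable ?S"
      using measurable_compose[OF measurable_Pair1'[OF t] Fm] by simp
    then show "(\<integral>\<^sup>+\<xi>. ?w (t, \<xi>) * F (?m (t, \<xi>)) \<partial>?S) =
        ennreal (t ^ (CARD('n) - 1)) * (\<integral>\<^sup>+\<xi>. F (t *\<^sub>R \<xi>, t) \<partial>?S)"
      by (simp add: nn_integral_cmult)
  qed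
  finally show ?thesis
    by (simp add: nn_integral_restrict_space)
qed

section \<open>Weights and norms\<close>

definition alpha :: "real ^ 'n::finite \<Rightarrow> real" where
  "alpha \<kappa> = (\<Sum>i\<in>UNIV. \<kappa> $ i) + (real CARD('n) - 2) / 2"

definition h_weight :: "real ^ 'n::finite \<Rightarrow> real ^ 'n \<Rightarrow> real" where
  "h_weight \<kappa> x = (\<Prod>i\<in>UNIV. \<bar>x $ i\<bar> powr (\<kappa> $ i))"

definition u_weight :: "real ^ 'n::finite \<Rightarrow> (real ^ 'n) \<times> real \<Rightarrow> real" where
  "u_weight \<kappa> = (\<lambda>(x, t). (h_weight \<kappa> x)\<^sup>2 * (1 / t))"

definition w_weight :: "real ^ 'n::finite \<Rightarrow> (real ^ 'n) \<times> real \<Rightarrow> real" where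
  "w_weight \<kappa> = (\<lambda>(x, t). (h_weight \<kappa> x)\<^sup>2 * (1 / t) * exp (- t))"

definition b_const :: "real ^ 'n::finite \<Rightarrow> real" where
  "b_const \<kappa> = 1 / (LINT z|conic_measure. w_weight \<kappa> z)"

text \<open>Real powers with positive exponent on \<open>[0, \<infinity>]\<close>.\<close>

definition enn_powr :: "ennreal \<Rightarrow> real \<Rightarrow> ennreal" where
  "enn_powr x a = (if x = \<infinity> then \<infinity> else ennreal (enn2real x powr a))"

definition conic_norm ::
    "real ^ 'n::finite \<Rightarrow> ennreal \<Rightarrow> ((real ^ 'n) \<times> real \<Rightarrow> real) \<Rightarrow> ennreal" where
  "conic_norm \<kappa> p f =
     (if p = \<infinity> then esssup conic_measure (\<lambda>(x, t). ennreal (\<bar>f (x, t)\<bar> * exp (- t / 2)))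
      else enn_powr
        (ennreal (b_const \<kappa>) *
          (\<integral>\<^sup>+(x, t). ennreal (\<bar>f (x, t) * exp (- t / 2)\<bar> powr enn2real p * u_weight \<kappa> (x, t))
             \<partial>conic_measure))
        (1 / enn2real p))"

definition conic_Lp ::
    "real ^ 'n::finite \<Rightarrow> ennreal \<Rightarrow> ((real ^ 'n) \<times> real \<Rightarrow> real) set" where
  "conic_Lp \<kappa> p = {f \<in> borel_measurable conic_measure. conic_norm \<kappa> p f < \<infinity>}"

definition halfline_norm :: "real \<Rightarrow> real \<Rightarrow> (real \<Rightarrow> real) \<Rightarrow> ennreal" where
  "halfline_norm a p g =
     enn_powr
       (ennreal (1 / Gamma (a + 1)) *
         (\<integral>\<^sup>+t\<in>{0..}. ennreal (\<bar>g t * exp (- t / 2)\<bar> powr p * t powr a) \<partial>lborel))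
       (1 / p)"

definition halfline_Lp :: "real \<Rightarrow> real \<Rightarrow> (real \<Rightarrow> real) set" where
  "halfline_Lp a p = {g \<in> borel_measurable (restrict_space borel {0..}). halfline_norm a p g < \<infinity>}"

section \<open>Generalized translation and pseudo convolution\<close>

definition bessel_J :: "real \<Rightarrow> real \<Rightarrow> real" where
  "bessel_J \<nu> z =
     (\<Sum>k. (- 1) ^ k / fact k * rGamma (\<nu> + real k + 1) * (z / 2) powr (\<nu> + 2 * real k))"

text \<open>At \<open>z = 0\<close> the function \<open>z\<^sup>-\<^sup>\<nu> J\<^sub>\<nu>(z)\<close> takes its limit value.\<close>

definition bessel_j :: "real \<Rightarrow> real \<Rightarrow> real" where
  "bessel_j \<nu> z =
     (if z = 0 then rGamma (\<nu> + 1) / 2 powr \<nu> else z powr (- \<nu>) * bessel_J \<nu> z)"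

definition c_const :: "real \<Rightarrow> real" where
  "c_const l = Gamma (l + 1) / (Gamma (1 / 2) * Gamma (l + 1 / 2))"

text \<open>
  The measure \<open>c\<^sub>k\<^sub>-\<^sub>1\<^sub>/\<^sub>2 (1 + u) (1 - u\<^sup>2)\<^sup>k\<^sup>-\<^sup>1 du\<close> on \<open>[-1, 1]\<close>; for \<open>k = 0\<close> integration against it is
  the limit functional \<open>f \<mapsto> f 1\<close>. The constants are part of these measures, rather than
  of the constant in front of the translation, because \<open>c\<^sub>-\<^sub>1\<^sub>/\<^sub>2\<close> only has a meaning in that limit.
\<close>

definition Phi_measure1 :: "real \<Rightarrow> real measure" where
  "Phi_measure1 k =
     (if k = 0 then return (restrict_space borel {-1..1}) 1
      else density (restrict_space lborel {-1..1})
        (\<lambda>u. ennreal (c_const (k - 1 / 2) * ((1 + u) * (1 - u\<^sup>2) powr (k - 1)))))"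

definition Phi_measure :: "real ^ 'n::finite \<Rightarrow> ('n \<Rightarrow> real) measure" where
  "Phi_measure \<kappa> = (\<Pi>\<^sub>M i\<in>UNIV. Phi_measure1 (\<kappa> $ i))"

definition rho ::
    "(real ^ 'n::finite) \<times> real \<Rightarrow> (real ^ 'n) \<times> real \<Rightarrow> ('n \<Rightarrow> real) \<Rightarrow> real" where
  "rho = (\<lambda>(x, t) (y, s) u. sqrt ((t * s + (\<Sum>i\<in>UNIV. x $ i * y $ i * u i)) / 2))"

definition translation_integrand ::
    "real ^ 'n::finite \<Rightarrow> (real \<Rightarrow> real) \<Rightarrow> (real ^ 'n) \<times> real \<Rightarrow> (real ^ 'n) \<times> real \<Rightarrow>
      ('n \<Rightarrow> real) \<Rightarrow> real \<Rightarrow> real" where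
  "translation_integrand \<kappa> g z w u \<theta> =
     (let r = rho z w u in
        g (snd z + snd w + 2 * r * cos \<theta>) * exp (- r * cos \<theta>) *
        bessel_j (alpha \<kappa> - 1) (r * sin \<theta>) * sin \<theta> powr (2 * alpha \<kappa> - 1))"

definition translation ::
    "real ^ 'n::finite \<Rightarrow> (real \<Rightarrow> real) \<Rightarrow> (real ^ 'n) \<times> real \<Rightarrow> (real ^ 'n) \<times> real \<Rightarrow> real" where
  "translation \<kappa> g z w =
     2 powr (alpha \<kappa> - 1) * Gamma (alpha \<kappa> + 1 / 2) / sqrt pi *
     (LINT u|Phi_measure \<kappa>. (LINT \<theta>:{0..pi}|lborel. translation_integrand \<kappa> g z w u \<theta>))"

definition pseudo_conv ::
    "real ^ 'n::finite \<Rightarrow> ((real ^ 'n) \<times> real \<Rightarrow> real) \<Rightarrow> (real \<Rightarrow> real) \<Rightarrow>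
      (real ^ 'n) \<times> real \<Rightarrow> real" where
  "pseudo_conv \<kappa> f g z =
     b_const \<kappa> * (LINT w|conic_measure. f w * translation \<kappa> g z w * w_weight \<kappa> w)"

text \<open>
  As the Bochner integral of a non-integrable function is \<open>0\<close>, convergence is recorded separately:
  the integral defining \<open>(f * g)(z)\<close> converges absolutely, and so does, for almost every \<open>w\<close>, the
  one defining the translation of \<open>g\<close> by \<open>z\<close> at \<open>w\<close>.
\<close>

definition pseudo_conv_exists ::
    "real ^ 'n::finite \<Rightarrow> ((real ^ 'n) \<times> real \<Rightarrow> real) \<Rightarrow> (real \<Rightarrow> real) \<Rightarrow>
      (real ^ 'n) \<times> real \<Rightarrow> bool" where
  "pseudo_conv_exists \<kappa> f g z \<longleftrightarrow>
     (AE w in conic_measure.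
        integrable (Phi_measure \<kappa> \<Otimes>\<^sub>M restrict_space lborel {0..pi})
          (\<lambda>(u, \<theta>). translation_integrand \<kappa> g z w u \<theta>)) \<and>
     integrable conic_measure (\<lambda>w. f w * translation \<kappa> g z w * w_weight \<kappa> w)"

end

theory Submission
  imports Defs
begin

text \<open>
  Since \<open>|j\<^sub>\<nu>(z)| \<le> j\<^sub>\<nu>(0)\<close> for \<open>\<nu> \<ge> -1/2\<close>, and the exponential factors of the translation combine to
  \<open>exp (- (t + s + 2 \<rho> cos \<theta>) / 2)\<close>, the operator \<open>f \<mapsto> f * g\<close>, conjugated with \<open>exp (- t / 2)\<close>, is dominated by
  a positive symmetric kernel, which is a generalized translation of \<open>G(r) = |g(r)| exp (- r / 2)\<close>.
  By Schur's test it suffices that the integral of this kernel in one variable against the weight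
  \<open>b\<^sub>\<kappa> u\<^sub>\<kappa>\<close> does not depend on the other variable \<open>(x, t)\<close>; at the apex \<open>x = 0\<close>, \<open>t = 0\<close> the kernel is \<open>G(s)\<close>
  and the integral is the norm of \<open>g\<close>.

  The cone carries the image of Lebesgue measure on \<open>\<real>\<^sup>d\<close> under \<open>y \<mapsto> (y, |y|)\<close>. The weights \<open>|y\<^sub>i|\<^bsup>2\<kappa>\<^sub>i\<^esup>\<close> and
  the integrations in \<open>u\<^sub>i\<close> and \<open>\<theta>\<close> act like additional dimensions; after passing to Cartesian coordinates
  in these dimensions, the dependence on \<open>x\<close> is removed by a rotation and that on \<open>t\<close> by a translation.
\<close>

section \<open>The Bessel function\<close>

text \<open>Two points shape the proof. The estimate has constant exactly 1, so no constant may be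
  lost. The bound for the Bessel factor, times the constant in front of the translation, is
  \<open>c_const (alpha \<kappa> - 1 / 2)\<close>, and this is the number that gives the weight
  \<open>(1 - v\<^sup>2) powr (alpha \<kappa> - 1)\<close> total mass 1 on \<open>[-1, 1]\<close>.
  The mass of the weighted sphere cancels against \<open>b_const\<close>, and the constants of the
  reduction to a line are the same for \<open>(x, t)\<close> and for the apex; hence the reduction
  only asserts that some \<open>C\<close> exists. Secondly, a Bochner integral is 0 where nothing
  converges. All estimates are therefore made with integrals of nonnegative functions in
  \<open>ennreal\<close>, where interchange and substitution ask for measurability only, and the
  convergence of the integrals defining \<open>f * g\<close> is read off from the finiteness of the
  same majorants. The exponents fit by a count of dimensions: \<open>d\<close> coordinates leave one
  line and a power law of exponent \<open>\<alpha> + 1 / 2\<close>, and the factor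
  \<open>1 / t\<close> of the weight cancels the Jacobian between the squared radius and the
  radius.\<close>

definition bessel_coeff :: "real \<Rightarrow> nat \<Rightarrow> real" where
  "bessel_coeff \<nu> k = (- 1) ^ k / fact k * rGamma (\<nu> + real k + 1) / 4 ^ k"

text \<open>The function \<open>2 powr \<nu> * bessel_j \<nu> z\<close> in the variable
  \<open>w = z\<^sup>2\<close>. There it is a power series in integer powers, also for non-integer
  \<open>\<nu>\<close>, and can be differentiated term by term.\<close>

definition bessel_aux :: "real \<Rightarrow> real \<Rightarrow> real" where
  "bessel_aux \<nu> w = (\<Sum>k. bessel_coeff \<nu> k * w ^ k)"

text \<open>From \<open>rGamma x = x * rGamma (x + 1)\<close>. It is used twice: for the ratio test,
  and as Bessel's equation read coefficient by coefficient.\<close>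

lemma bessel_coeff_Suc:
  "4 * (real k + 1) * (\<nu> + real k + 1) * bessel_coeff \<nu> (Suc k) = - bessel_coeff \<nu> k"
proof -
  have "rGamma (\<nu> + real k + 1) = (\<nu> + real k + 1) * rGamma (\<nu> + real (Suc k) + 1)"
    using rGamma_plus1[of "\<nu> + real k + 1"] by (simp add: add_ac)
  then have "bessel_coeff \<nu> k = (\<nu> + real k + 1) * ((- 1) ^ k / fact k * rGamma (\<nu> + real (Suc k) + 1) / 4 ^ k)"
    by (simp add: bessel_coeff_def)
  moreover have "bessel_coeff \<nu> (Suc k) = - ((- 1) ^ k / fact k * rGamma (\<nu> + real (Suc k) + 1) / 4 ^ k) / (4 * (real k + 1))"
    by (simp add: bessel_coeff_def field_simps)
  moreover have "4 * (real k + 1) * n * (- A / (4 * (real k + 1))) = - (n * A)" for n A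
    by simp
  ultimately show ?thesis
    by simp
qed

lemma summable_bessel_coeff:
  assumes "\<nu> \<ge> - 1 / 2"
  shows "summable (\<lambda>k. bessel_coeff \<nu> k * w ^ k)"
proof (rule summable_ratio_test[where c = "1 / 2" and N = "nat \<lceil>\<bar>w\<bar>\<rceil>"])
  fix k assume "k \<ge> nat \<lceil>\<bar>w\<bar>\<rceil>"
  then have k: "\<bar>w\<bar> \<le> real k" by linarith
  \<comment> \<open>By the recurrence, consecutive terms have ratio
    \<open>\<bar>w\<bar> / ?d\<close> in absolute value. Since
    \<open>\<nu> + k + 1 \<ge> 1 / 2\<close>, \<open>?d\<close> is at least
    \<open>2 * (k + 1)\<close>, hence at least \<open>2 * \<bar>w\<bar>\<close>.\<close>
  let ?d = "4 * (real k + 1) * (\<nu> + real k + 1)"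
  have "2 * \<bar>w\<bar> \<le> 4 * (real k + 1) * (1 / 2)"
    using k by simp
  also have "\<dots> \<le> ?d"
    using assms by (intro mult_left_mono) auto
  finally have d: "2 * \<bar>w\<bar> \<le> ?d" .
  have dpos: "?d > 0"
    using assms by (intro mult_pos_pos) auto
  have "?d * \<bar>bessel_coeff \<nu> (Suc k)\<bar> = \<bar>?d * bessel_coeff \<nu> (Suc k)\<bar>"
    using dpos unfolding abs_mult[of ?d] by simp
  also have "\<dots> = \<bar>bessel_coeff \<nu> k\<bar>"
    unfolding bessel_coeff_Suc by simp
  finally have "\<bar>bessel_coeff \<nu> k\<bar> = ?d * \<bar>bessel_coeff \<nu> (Suc k)\<bar>" ..
  then have "2 * \<bar>w\<bar> * \<bar>bessel_coeff \<nu> (Suc k)\<bar> \<le> \<bar>bessel_coeff \<nu> k\<bar>"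
    using d by (simp add: mult_right_mono)
  then have "2 * \<bar>w\<bar> * \<bar>bessel_coeff \<nu> (Suc k)\<bar> * \<bar>w\<bar> ^ k \<le> \<bar>bessel_coeff \<nu> k\<bar> * \<bar>w\<bar> ^ k"
    by (rule mult_right_mono) simp
  then show "norm (bessel_coeff \<nu> (Suc k) * w ^ Suc k) \<le> 1 / 2 * norm (bessel_coeff \<nu> k * w ^ k)"
    by (simp add: abs_mult power_abs mult_ac)
qed simp

lemma bessel_j_eq_aux:
  assumes "\<nu> \<ge> - 1 / 2" and "z \<ge> 0"
  shows "bessel_j \<nu> z = 2 powr (- \<nu>) * bessel_aux \<nu> (z\<^sup>2)"
proof (cases "z = 0")
  case True
  then show ?thesis
    by (simp add: bessel_j_def bessel_aux_def powr_minus_divide) (simp add: bessel_coeff_def)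
next
  case False
  with assms have z: "z > 0" by simp
  have p: "(z / 2) powr (\<nu> + 2 * real k) = z powr \<nu> * 2 powr (- \<nu>) * ((z\<^sup>2) ^ k / 4 ^ k)" for k
  proof -
    have "(z / 2) powr (2 * real k) = (z / 2) ^ (2 * k)"
      using z powr_realpow[of "z / 2" "2 * k"] by simp
    also have "\<dots> = (z\<^sup>2) ^ k / 4 ^ k"
      by (simp add: power_mult power_divide)
    finally have a: "(z / 2) powr (2 * real k) = (z\<^sup>2) ^ k / 4 ^ k" .
    have "(z / 2) powr \<nu> = z powr \<nu> * 2 powr (- \<nu>)"
      using z by (simp add: powr_divide powr_minus_divide)
    with a show ?thesis by (simp only: powr_add)
  qed
  have "bessel_J \<nu> z = (\<Sum>k. (z powr \<nu> * 2 powr (- \<nu>)) * (bessel_coeff \<nu> k * (z\<^sup>2) ^ k))"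
    unfolding bessel_J_def p bessel_coeff_def by (simp add: mult_ac)
  also have "\<dots> = (z powr \<nu> * 2 powr (- \<nu>)) * bessel_aux \<nu> (z\<^sup>2)"
    unfolding bessel_aux_def by (intro suminf_mult summable_bessel_coeff assms)
  finally show ?thesis
    using z by (simp add: bessel_j_def powr_minus)
qed

text \<open>
  With \<open>\<phi> = bessel_aux \<nu>\<close>, Bessel's equation reads \<open>4 w \<phi>'' + 4 (\<nu> + 1) \<phi>' + \<phi> = 0\<close>, and the energy
  \<open>\<phi>\<^sup>2 + 4 w \<phi>'\<^sup>2\<close> has derivative \<open>- (8 \<nu> + 4) \<phi>'\<^sup>2 \<le> 0\<close>. This is where \<open>\<alpha>\<^sub>\<kappa> \<ge> 1/2\<close> enters.
\<close>

lemma abs_bessel_aux_le: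
  assumes \<nu>: "\<nu> \<ge> - 1 / 2" and w: "w \<ge> 0"
  shows "\<bar>bessel_aux \<nu> w\<bar> \<le> \<bar>rGamma (\<nu> + 1)\<bar>"
proof -
  let ?c = "bessel_coeff \<nu>"
  define \<phi>1 where "\<phi>1 x = (\<Sum>k. diffs ?c k * x ^ k)" for x
  define \<phi>2 where "\<phi>2 x = (\<Sum>k. diffs (diffs ?c) k * x ^ k)" for x
  have s0: "summable (\<lambda>k. ?c k * x ^ k)" for x
    by (rule summable_bessel_coeff[OF \<nu>])
  have s1: "summable (\<lambda>k. diffs ?c k * x ^ k)" for x
    by (rule termdiff_converges_all) (rule s0)
  have s2: "summable (\<lambda>k. diffs (diffs ?c) k * x ^ k)" for x
    by (rule termdiff_converges_all) (rule s1)
  have d0: "(bessel_aux \<nu> has_real_derivative \<phi>1 x) (at x)" for x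
    unfolding bessel_aux_def \<phi>1_def by (rule termdiffs_strong_converges_everywhere) (rule s0)
  have d1: "(\<phi>1 has_real_derivative \<phi>2 x) (at x)" for x
    unfolding \<phi>1_def \<phi>2_def by (rule termdiffs_strong_converges_everywhere) (rule s1)
  have ode: "4 * x * \<phi>2 x + 4 * (\<nu> + 1) * \<phi>1 x + bessel_aux \<nu> x = 0" for x
  proof -
    \<comment> \<open>Differentiation lowers the power by one; the factor \<open>x\<close> in front
      of the second derivative restores it. For \<open>k = 0\<close>, where the natural subtraction
      is truncated, both sides are 0.\<close>
    have e: "x * (real k * diffs ?c k * x ^ (k - Suc 0)) = real k * diffs ?c k * x ^ k" for k
      by (cases k) auto
    have "(\<lambda>k. real k * diffs ?c k * x ^ k) sums (x * \<phi>2 x)"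
      unfolding \<phi>2_def e[symmetric] by (intro sums_mult diffs_equiv s2)
    then have "(\<lambda>k. 4 * (real k * diffs ?c k * x ^ k) + 4 * (\<nu> + 1) * (diffs ?c k * x ^ k) + ?c k * x ^ k)
      sums (4 * (x * \<phi>2 x) + 4 * (\<nu> + 1) * \<phi>1 x + bessel_aux \<nu> x)"
      unfolding \<phi>1_def bessel_aux_def
      by (intro sums_add sums_mult summable_sums s0 s1)
    moreover have "4 * (real k * diffs ?c k * x ^ k) + 4 * (\<nu> + 1) * (diffs ?c k * x ^ k) + ?c k * x ^ k = 0" for k
    proof -
      have "4 * (real k * diffs ?c k * x ^ k) + 4 * (\<nu> + 1) * (diffs ?c k * x ^ k) + ?c k * x ^ k =
        (4 * (real k + 1) * (\<nu> + real k + 1) * ?c (Suc k) + ?c k) * x ^ k"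
        by (simp add: diffs_def algebra_simps)
      then show ?thesis unfolding bessel_coeff_Suc by simp
    qed
    ultimately have "(\<lambda>k. 0) sums (4 * (x * \<phi>2 x) + 4 * (\<nu> + 1) * \<phi>1 x + bessel_aux \<nu> x)"
      by simp
    then show ?thesis
      using sums_zero sums_unique2 by (metis mult.assoc)
  qed
  define E where "E x = (bessel_aux \<nu> x)\<^sup>2 + 4 * x * (\<phi>1 x)\<^sup>2" for x
  have dE: "(E has_real_derivative - (8 * \<nu> + 4) * (\<phi>1 x)\<^sup>2) (at x)" for x
  proof -
    have "(E has_real_derivative (2 * bessel_aux \<nu> x * \<phi>1 x + (4 * (\<phi>1 x)\<^sup>2 + 8 * x * \<phi>1 x * \<phi>2 x))) (at x)"
      unfolding E_def by (auto intro!: derivative_eq_intros d0 d1 simp: power2_eq_square algebra_simps)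
    also have "2 * bessel_aux \<nu> x * \<phi>1 x + (4 * (\<phi>1 x)\<^sup>2 + 8 * x * \<phi>1 x * \<phi>2 x) =
       2 * \<phi>1 x * (4 * x * \<phi>2 x + 4 * (\<nu> + 1) * \<phi>1 x + bessel_aux \<nu> x) - (8 * \<nu> + 4) * (\<phi>1 x)\<^sup>2"
      by (simp add: power2_eq_square algebra_simps)
    finally show ?thesis unfolding ode by (simp only: mult_zero_right diff_0 mult_minus_left)
  qed
  have "E w \<le> E 0"
  proof (rule DERIV_nonpos_imp_nonincreasing[OF w])
    fix x :: real
    have "- (8 * \<nu> + 4) * (\<phi>1 x)\<^sup>2 \<le> 0"
      using \<nu> by (intro mult_nonpos_nonneg) auto
    with dE show "\<exists>y. DERIV E x :> y \<and> y \<le> 0" by blast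
  qed
  moreover have "E 0 = (rGamma (\<nu> + 1))\<^sup>2"
    unfolding E_def bessel_aux_def powser_zero by (simp add: bessel_coeff_def)
  moreover have "(bessel_aux \<nu> w)\<^sup>2 \<le> E w"
    using w by (simp add: E_def)
  ultimately have "(bessel_aux \<nu> w)\<^sup>2 \<le> (rGamma (\<nu> + 1))\<^sup>2" by simp
  then show ?thesis by (rule abs_le_square_iff[THEN iffD2])
qed

lemma abs_bessel_j_le:
  assumes "\<nu> \<ge> - 1 / 2" and "z \<ge> 0"
  shows "\<bar>bessel_j \<nu> z\<bar> \<le> 2 powr (- \<nu>) * \<bar>rGamma (\<nu> + 1)\<bar>"
  using assms by (simp add: bessel_j_eq_aux abs_mult abs_bessel_aux_le)

lemma measurable_bessel_j [measurable]: "bessel_j \<nu> \<in> borel_measurable borel"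
proof -
  have "bessel_J \<nu> \<in> borel_measurable borel"
    unfolding bessel_J_def by measurable
  then show ?thesis unfolding bessel_j_def by measurable
qed

section \<open>One-dimensional substitutions and power laws\<close>

text \<open>Exhaustion by compact intervals lets a substitution carried out on \<open>[0, n]\<close>
  pass to the half-line; the end point 0 is a null set.\<close>

lemma nn_integral_pos_union_interval:
  fixes f :: "real \<Rightarrow> ennreal"
  assumes [measurable]: "f \<in> borel_measurable borel"
  shows "(\<integral>\<^sup>+x\<in>{0<..}. f x \<partial>lborel) = (SUP n::nat. \<integral>\<^sup>+x\<in>{0..real n}. f x \<partial>lborel)"
proof -
  have "(\<integral>\<^sup>+x\<in>{0<..}. f x \<partial>lborel) = (\<integral>\<^sup>+x. (SUP n::nat. f x * indicator {0..real n} x) \<partial>lborel)"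
  proof (rule nn_integral_cong_AE, use AE_lborel_singleton[of 0] in eventually_elim)
    fix x :: real assume "x \<noteq> 0"
    show "f x * indicator {0<..} x = (SUP n::nat. f x * indicator {0..real n} x)"
    proof (cases "x > 0")
      case True
      obtain m :: nat where m: "x \<le> real m" using real_arch_simple by blast
      show ?thesis
      proof (rule antisym)
        show "f x * indicator {0<..} x \<le> (SUP n::nat. f x * indicator {0..real n} x)"
          by (rule SUP_upper2[of m]) (use True m in auto)
        show "(SUP n::nat. f x * indicator {0..real n} x) \<le> f x * indicator {0<..} x"
          by (rule SUP_least) (use True in \<open>auto split: split_indicator\<close>)
      qed
    next
      case False
      with \<open>x \<noteq> 0\<close> show ?thesis by simp
    qed
  qed
  also have "\<dots> = (SUP n::nat. \<integral>\<^sup>+x\<in>{0..real n}. f x \<partial>lborel)"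
    by (rule nn_integral_monotone_convergence_SUP)
      (auto simp: incseq_def le_fun_def split: split_indicator)
  finally show ?thesis .
qed

text \<open>The substitution \<open>x = y\<^sup>2\<close> maps \<open>[0, n]\<close> onto
  \<open>[0, n\<^sup>2]\<close>. These intervals exhaust the half-line as well as the intervals
  \<open>[0, n]\<close> do, so both suprema agree.\<close>

lemma nn_integral_pos_square:
  fixes f :: "real \<Rightarrow> ennreal"
  assumes [measurable]: "f \<in> borel_measurable borel"
  shows "(\<integral>\<^sup>+x\<in>{0<..}. f x \<partial>lborel) = (\<integral>\<^sup>+y\<in>{0<..}. ennreal (2 * y) * f (y\<^sup>2) \<partial>lborel)"
proof -
  have s: "(\<integral>\<^sup>+x\<in>{0..(real n)\<^sup>2}. f x \<partial>lborel) = (\<integral>\<^sup>+y\<in>{0..real n}. ennreal (2 * y) * f (y\<^sup>2) \<partial>lborel)" for n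
  proof (cases "n = 0")
    \<comment> \<open>The substitution needs a nondegenerate interval; for \<open>n = 0\<close> both
      integrals run over a null set.\<close>
    case True
    have "(\<integral>\<^sup>+x\<in>{0}. h x \<partial>lborel) = 0" for h :: "real \<Rightarrow> ennreal"
    proof -
      have "(\<integral>\<^sup>+x\<in>{0}. h x \<partial>lborel) = (\<integral>\<^sup>+(x::real). 0 \<partial>lborel)"
        by (rule nn_integral_cong_AE, use AE_lborel_singleton[of "0::real"] in eventually_elim) simp
      then show ?thesis by simp
    qed
    then show ?thesis using True by simp
  next
    case False
    have "(\<integral>\<^sup>+x. f x * indicator {0\<^sup>2..(real n)\<^sup>2} x \<partial>lborel) =
        (\<integral>\<^sup>+y. f (y\<^sup>2) * ennreal (2 * y) * indicator {0..real n} y \<partial>lborel)"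
      using False by (intro nn_integral_substitution_aux) (auto intro!: derivative_eq_intros continuous_on_mult)
    then show ?thesis by (simp add: mult_ac)
  qed
  have "(\<integral>\<^sup>+y\<in>{0<..}. ennreal (2 * y) * f (y\<^sup>2) \<partial>lborel) = (SUP n::nat. \<integral>\<^sup>+y\<in>{0..real n}. ennreal (2 * y) * f (y\<^sup>2) \<partial>lborel)"
    by (rule nn_integral_pos_union_interval) measurable
  also have "\<dots> = (SUP n::nat. \<integral>\<^sup>+x\<in>{0..(real n)\<^sup>2}. f x \<partial>lborel)"
    by (simp add: s)
  also have "\<dots> = (SUP n::nat. \<integral>\<^sup>+x\<in>{0..real n}. f x \<partial>lborel)"
  proof (rule antisym)
    show "(SUP n::nat. \<integral>\<^sup>+x\<in>{0..(real n)\<^sup>2}. f x \<partial>lborel) \<le> (SUP n::nat. \<integral>\<^sup>+x\<in>{0..real n}. f x \<partial>lborel)"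
    proof (rule SUP_least)
      fix n :: nat
      show "(\<integral>\<^sup>+x\<in>{0..(real n)\<^sup>2}. f x \<partial>lborel) \<le> (SUP n::nat. \<integral>\<^sup>+x\<in>{0..real n}. f x \<partial>lborel)"
        by (rule SUP_upper2[of "n\<^sup>2"]) simp_all
    qed
    show "(SUP n::nat. \<integral>\<^sup>+x\<in>{0..real n}. f x \<partial>lborel) \<le> (SUP n::nat. \<integral>\<^sup>+x\<in>{0..(real n)\<^sup>2}. f x \<partial>lborel)"
    proof (rule SUP_least, rule SUP_upper2)
      fix i :: nat
      have "real i \<le> (real i)\<^sup>2"
        by (metis le_square of_nat_mono of_nat_mult power2_eq_square)
      then have "{0..real i} \<subseteq> {0..(real i)\<^sup>2}" by auto
      then show "(\<integral>\<^sup>+x\<in>{0..real i}. f x \<partial>lborel) \<le> (\<integral>\<^sup>+x\<in>{0..(real i)\<^sup>2}. f x \<partial>lborel)"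
        by (rule nn_set_integral_set_mono)
    qed simp
  qed
  finally show ?thesis
    by (simp add: nn_integral_pos_union_interval)
qed

lemma nn_integral_even_odd:
  fixes f :: "real \<Rightarrow> ennreal"
  assumes [measurable]: "f \<in> borel_measurable borel"
  shows "(\<integral>\<^sup>+x. f x \<partial>lborel) = (\<integral>\<^sup>+x\<in>{0<..}. f x + f (- x) \<partial>lborel)"
proof -
  have "(\<integral>\<^sup>+x. f x \<partial>lborel) = (\<integral>\<^sup>+x. f x * indicator {0<..} x + f x * indicator {..<0} x \<partial>lborel)"
    by (rule nn_integral_cong_AE, use AE_lborel_singleton[of 0] in eventually_elim)
      (auto split: split_indicator)
  also have "\<dots> = (\<integral>\<^sup>+x\<in>{0<..}. f x \<partial>lborel) + (\<integral>\<^sup>+x\<in>{..<0}. f x \<partial>lborel)"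
    by (rule nn_integral_add) measurable
  also have "(\<integral>\<^sup>+x\<in>{..<0}. f x \<partial>lborel) = (\<integral>\<^sup>+x. f (- x) * indicator {..<0} (- x) \<partial>lborel)"
    by (subst nn_integral_real_affine[of _ "-1" 0]) auto
  also have "\<dots> = (\<integral>\<^sup>+x\<in>{0<..}. f (- x) \<partial>lborel)"
    by (rule nn_integral_cong) (auto split: split_indicator)
  also have "(\<integral>\<^sup>+x\<in>{0<..}. f x \<partial>lborel) + \<dots> = (\<integral>\<^sup>+x\<in>{0<..}. f x + f (- x) \<partial>lborel)"
    by (subst nn_integral_add[symmetric]) (auto simp: distrib_right)
  finally show ?thesis .
qed

lemma nn_integral_lborel_translate:
  fixes f :: "real \<Rightarrow> ennreal"
  assumes [measurable]: "f \<in> borel_measurable borel"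
  shows "(\<integral>\<^sup>+x. f (a + x) \<partial>lborel) = (\<integral>\<^sup>+x. f x \<partial>lborel)"
  using nn_integral_real_affine[of f 1 a] by simp

text \<open>
  Up to a factor \<open>\<Gamma> a\<close> these are the kernels of fractional integration, with \<open>a = 0\<close> as the limit
  point mass; hence they form a convolution semigroup up to constants.
\<close>

definition pow_measure :: "real \<Rightarrow> real measure" where
  "pow_measure a =
     (if a = 0 then return borel 0
      else density lborel (\<lambda>q. ennreal (indicator {0<..} q * q powr (a - 1))))"

lemma sets_pow_measure [measurable_cong, simp]: "sets (pow_measure a) = sets borel"
  by (simp add: pow_measure_def)

lemma space_pow_measure [simp]: "space (pow_measure a) = UNIV"
  by (simp add: pow_measure_def)

lemma sigma_finite_pow_measure: "sigma_finite_measure (pow_measure a)"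
proof (cases "a = 0")
  case True
  have "prob_space (return borel (0::real))"
    by (rule prob_space_return) simp
  then show ?thesis
    using True by (simp add: pow_measure_def finite_measure.axioms prob_space.axioms(1))
next
  case False
  then show ?thesis
    unfolding pow_measure_def
    by (simp add: sigma_finite_measure.sigma_finite_iff_density_finite[OF sigma_finite_lborel])
qed

interpretation pow_measure: sigma_finite_measure "pow_measure a" for a
  by (rule sigma_finite_pow_measure)

lemma nn_integral_pow_measure:
  assumes [measurable]: "f \<in> borel_measurable borel" and "a \<noteq> 0"
  shows "(\<integral>\<^sup>+q. f q \<partial>pow_measure a) = (\<integral>\<^sup>+q\<in>{0<..}. ennreal (q powr (a - 1)) * f q \<partial>lborel)"
  using assms(2) unfolding pow_measure_def
  by (simp add: nn_integral_density) (auto intro!: nn_integral_cong split: split_indicator)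

lemma nn_integral_pow_measure_0:
  assumes [measurable]: "f \<in> borel_measurable borel"
  shows "(\<integral>\<^sup>+q. f q \<partial>pow_measure 0) = f 0"
  by (simp add: pow_measure_def nn_integral_return)

text \<open>The square of a Lebesgue-distributed coordinate follows the power law of exponent
  \<open>1 / 2\<close>: the Jacobian of the square root contributes a factor \<open>1 / 2\<close>,
  which the two signs of \<open>x\<close> compensate. A coordinate that enters only through its
  square thus adds \<open>1 / 2\<close> to an exponent.\<close>

lemma nn_integral_square_pow_measure:
  assumes [measurable]: "f \<in> borel_measurable borel"
  shows "(\<integral>\<^sup>+x. f (x\<^sup>2) \<partial>lborel) = (\<integral>\<^sup>+q. f q \<partial>pow_measure (1 / 2))"
proof -
  have "(\<integral>\<^sup>+q. f q \<partial>pow_measure (1 / 2)) = (\<integral>\<^sup>+q\<in>{0<..}. ennreal (q powr (- 1 / 2)) * f q \<partial>lborel)"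
    by (simp add: nn_integral_pow_measure)
  also have "\<dots> = (\<integral>\<^sup>+y\<in>{0<..}. ennreal (2 * y) * (ennreal ((y\<^sup>2) powr (- 1 / 2)) * f (y\<^sup>2)) \<partial>lborel)"
    by (rule nn_integral_pos_square) measurable
  also have "\<dots> = (\<integral>\<^sup>+y\<in>{0<..}. f (y\<^sup>2) + f ((- y)\<^sup>2) \<partial>lborel)"
  proof (rule nn_integral_cong)
    fix y :: real
    have "ennreal (2 * y) * ennreal ((y\<^sup>2) powr (- 1 / 2)) = 2" if "y > 0"
    proof -
      have "(y\<^sup>2) powr (- 1 / 2) = y powr (-1)"
        using that by (simp add: powr_powr flip: powr_numeral)
      then show ?thesis
        using that by (simp add: powr_minus ennreal_mult[symmetric] field_simps)
    qed
    then have "ennreal (2 * y) * (ennreal ((y\<^sup>2) powr (- 1 / 2)) * f (y\<^sup>2)) = f (y\<^sup>2) + f ((- y)\<^sup>2)" if "y > 0"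
      using that unfolding mult.assoc[symmetric] power2_minus mult_2[symmetric] by (simp only:)
    then show "ennreal (2 * y) * (ennreal ((y\<^sup>2) powr (- 1 / 2)) * f (y\<^sup>2)) * indicator {0<..} y =
       (f (y\<^sup>2) + f ((- y)\<^sup>2)) * indicator {0<..} y"
      by (cases "y > 0") simp_all
  qed
  also have "\<dots> = (\<integral>\<^sup>+x. f (x\<^sup>2) \<partial>lborel)"
    by (rule nn_integral_even_odd[symmetric]) measurable
  finally show ?thesis ..
qed

text \<open>With \<open>r = p + q\<close> and \<open>p = r * v\<close> all powers of
  \<open>r\<close> collect to \<open>r powr (a + b - 1)\<close>, and what remains is the beta
  integral in \<open>v\<close>, which is \<open>C\<close>. A point mass at 0, for
  \<open>a = 0\<close> or \<open>b = 0\<close>, is neutral.\<close>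

lemma nn_integral_pow_measure_convolution:
  assumes a: "a \<ge> 0" and b: "b \<ge> 0"
  shows "\<exists>C. \<forall>f. f \<in> borel_measurable borel \<longrightarrow>
      (\<integral>\<^sup>+p. (\<integral>\<^sup>+q. f (p + q) \<partial>pow_measure b) \<partial>pow_measure a) = C * (\<integral>\<^sup>+r. f r \<partial>pow_measure (a + b))"
proof -
  consider "a = 0" | "b = 0" | "a > 0" "b > 0" using a b by linarith
  then show ?thesis
  proof cases
    case 1
    show ?thesis by (intro exI[of _ 1]) (simp add: 1 nn_integral_pow_measure_0)
  next
    case 2
    show ?thesis by (intro exI[of _ 1]) (simp add: 2 nn_integral_pow_measure_0)
  next
    case 3
    define C where "C = (\<integral>\<^sup>+v\<in>{0<..<1}. ennreal (v powr (a - 1) * (1 - v) powr (b - 1)) \<partial>lborel)"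
    show ?thesis
    proof (intro exI[of _ C] allI impI)
      fix f :: "real \<Rightarrow> ennreal" assume f[measurable]: "f \<in> borel_measurable borel"
  let ?k = "\<lambda>p q. ennreal (p powr (a - 1)) * indicator {0<..} p * (ennreal (q powr (b - 1)) * f (p + q) * indicator {0<..} q)"
  let ?h = "\<lambda>p r. ennreal (p powr (a - 1)) * indicator {0<..} p * (ennreal ((r - p) powr (b - 1)) * f r * indicator {0<..} (r - p))"
      have "(\<integral>\<^sup>+p. (\<integral>\<^sup>+q. f (p + q) \<partial>pow_measure b) \<partial>pow_measure a) =
          (\<integral>\<^sup>+p\<in>{0<..}. ennreal (p powr (a - 1)) * (\<integral>\<^sup>+q\<in>{0<..}. ennreal (q powr (b - 1)) * f (p + q) \<partial>lborel) \<partial>lborel)"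
        using 3 by (simp add: nn_integral_pow_measure)
      also have "\<dots> = (\<integral>\<^sup>+p. \<integral>\<^sup>+q. ?k p q \<partial>lborel \<partial>lborel)"
      proof (rule nn_integral_cong)
        fix p :: real
        have "(\<integral>\<^sup>+q. ?k p q \<partial>lborel) =
          ennreal (p powr (a - 1)) * indicator {0<..} p *
            (\<integral>\<^sup>+q. ennreal (q powr (b - 1)) * f (p + q) * indicator {0<..} q \<partial>lborel)"
          by (rule nn_integral_cmult) measurable
        then show "ennreal (p powr (a - 1)) * (\<integral>\<^sup>+q\<in>{0<..}. ennreal (q powr (b - 1)) * f (p + q) \<partial>lborel) *
            indicator {0<..} p =
          (\<integral>\<^sup>+q. ?k p q \<partial>lborel)"
          by (simp add: mult_ac)
      qed
      also have "\<dots> = (\<integral>\<^sup>+p. \<integral>\<^sup>+r. ?h p r \<partial>lborel \<partial>lborel)"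
      proof (rule nn_integral_cong)
        fix p :: real
        show "(\<integral>\<^sup>+q. ?k p q \<partial>lborel) =
          (\<integral>\<^sup>+r. ?h p r \<partial>lborel)"
          by (subst nn_integral_lborel_translate[of "\<lambda>r. ?h p r" p, symmetric]) auto
      qed
      also have "\<dots> = (\<integral>\<^sup>+r. \<integral>\<^sup>+p. ?h p r \<partial>lborel \<partial>lborel)"
        by (rule lborel_pair.Fubini') measurable
      also have "\<dots> = (\<integral>\<^sup>+r. C * (ennreal (r powr (a + b - 1)) * f r * indicator {0<..} r) \<partial>lborel)"
      proof (rule nn_integral_cong)
        fix r :: real
        show "(\<integral>\<^sup>+p. ?h p r \<partial>lborel) =
          C * (ennreal (r powr (a + b - 1)) * f r * indicator {0<..} r)"
        proof (cases "r > 0")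
          case False
          have "(\<integral>\<^sup>+p. ?h p r \<partial>lborel) = (\<integral>\<^sup>+(p::real). 0 \<partial>lborel)"
            by (rule nn_integral_cong) (use False in \<open>auto split: split_indicator\<close>)
          then show ?thesis using False by simp
        next
          case True
          have "(\<integral>\<^sup>+p. ?h p r \<partial>lborel) =
            ennreal r * (\<integral>\<^sup>+v. ennreal ((r * v) powr (a - 1)) * indicator {0<..} (r * v) *
            (ennreal ((r - r * v) powr (b - 1)) * f r * indicator {0<..} (r - r * v)) \<partial>lborel)"
            by (subst nn_integral_real_affine[of _ r 0]) (use True in auto)
          also have "\<dots> = ennreal r * (\<integral>\<^sup>+v. (ennreal (r powr (a - 1)) * ennreal (r powr (b - 1)) * f r) *
              (ennreal (v powr (a - 1) * (1 - v) powr (b - 1)) * indicator {0<..<1} v) \<partial>lborel)"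
          proof (intro arg_cong[where f = "\<lambda>x. ennreal r * x"] nn_integral_cong)
            fix v :: real
            have "(r - r * v) = r * (1 - v)" by (simp add: algebra_simps)
            moreover have "indicator {0<..} (r * v) * indicator {0<..} (r * (1 - v)) = (indicator {0<..<1} v :: ennreal)"
              using True by (auto split: split_indicator simp: zero_less_mult_iff)
            moreover have "v \<in> {0<..<1} \<Longrightarrow> (r * v) powr (a - 1) = r powr (a - 1) * v powr (a - 1)"
              "v \<in> {0<..<1} \<Longrightarrow> (r * (1 - v)) powr (b - 1) = r powr (b - 1) * (1 - v) powr (b - 1)"
              using True by (auto simp: powr_mult)
            ultimately show "ennreal ((r * v) powr (a - 1)) * indicator {0<..} (r * v) *
              (ennreal ((r - r * v) powr (b - 1)) * f r * indicator {0<..} (r - r * v)) =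
              (ennreal (r powr (a - 1)) * ennreal (r powr (b - 1)) * f r) *
              (ennreal (v powr (a - 1) * (1 - v) powr (b - 1)) * indicator {0<..<1} v)"
              by (cases "v \<in> {0<..<1}") (auto simp: ennreal_mult mult_ac split: split_indicator)
          qed
          also have "\<dots> = ennreal r * ((ennreal (r powr (a - 1)) * ennreal (r powr (b - 1)) * f r) * C)"
            unfolding C_def by (subst nn_integral_cmult) auto
          also have "\<dots> = (ennreal r * ennreal (r powr (a - 1)) * ennreal (r powr (b - 1))) * f r * C"
            by (simp add: mult_ac)
          also have "ennreal r * ennreal (r powr (a - 1)) * ennreal (r powr (b - 1)) = ennreal (r powr (a + b - 1))"
          proof -
            have "r * r powr (a - 1) * r powr (b - 1) = r powr 1 * r powr (a - 1) * r powr (b - 1)"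
              using True by simp
            also have "\<dots> = r powr (a + b - 1)"
              by (simp only: powr_add[symmetric]) (simp add: algebra_simps)
            finally show ?thesis
              using True by (simp add: ennreal_mult[symmetric])
          qed
          finally show ?thesis using True by (simp add: mult_ac)
        qed
      qed
      also have "\<dots> = C * (\<integral>\<^sup>+r. f r \<partial>pow_measure (a + b))"
        using 3 by (subst nn_integral_cmult) (auto simp: nn_integral_pow_measure)
      finally show "(\<integral>\<^sup>+p. (\<integral>\<^sup>+q. f (p + q) \<partial>pow_measure b) \<partial>pow_measure a) = C * (\<integral>\<^sup>+r. f r \<partial>pow_measure (a + b))" .
    qed
  qed
qed

section \<open>The angular measures\<close>

text \<open>Folding at 0 and putting \<open>a = u\<^sup>2\<close> gives
  \<open>Beta (1 / 2) k\<close>, whose reciprocal is \<open>c_const (k - 1 / 2)\<close>. The lemma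
  normalizes the measures in \<open>u\<close> and, with \<open>k = alpha \<kappa>\<close>, also the
  integral over the angle.\<close>

lemma nn_integral_symmetric_beta:
  assumes k: "k > 0"
  shows "(\<integral>\<^sup>+u\<in>{-1..1}. ennreal (c_const (k - 1 / 2) * (1 - u\<^sup>2) powr (k - 1)) \<partial>lborel) = 1"
proof -
  have B: "(\<integral>\<^sup>+u\<in>{-1..1}. ennreal ((1 - u\<^sup>2) powr (k - 1)) \<partial>lborel) = ennreal (Beta (1 / 2) k)"
  proof -
    have "(\<integral>\<^sup>+u\<in>{-1..1}. ennreal ((1 - u\<^sup>2) powr (k - 1)) \<partial>lborel) =
        (\<integral>\<^sup>+u\<in>{0<..}. ennreal ((1 - u\<^sup>2) powr (k - 1)) * indicator {-1..1} u +
            ennreal ((1 - (- u)\<^sup>2) powr (k - 1)) * indicator {-1..1} (- u) \<partial>lborel)"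
      by (rule nn_integral_even_odd) measurable
    also have "\<dots> = (\<integral>\<^sup>+y\<in>{0<..}. ennreal (2 * y) *
        (ennreal ((y\<^sup>2) powr (1 / 2 - 1) * (1 - y\<^sup>2) powr (k - 1)) * indicator {0..1} (y\<^sup>2)) \<partial>lborel)"
    proof (rule nn_integral_cong)
      fix u :: real
      have "ennreal ((1 - u\<^sup>2) powr (k - 1)) + ennreal ((1 - u\<^sup>2) powr (k - 1)) =
          ennreal (2 * u) * ennreal ((u\<^sup>2) powr (1 / 2 - 1) * (1 - u\<^sup>2) powr (k - 1))" if u: "u > 0"
      proof -
        have "(u\<^sup>2) powr (1 / 2 - 1) = u powr (-1)"
          using u by (simp add: powr_powr flip: powr_numeral)
        then have "2 * u * ((u\<^sup>2) powr (1 / 2 - 1) * (1 - u\<^sup>2) powr (k - 1)) = 2 * (1 - u\<^sup>2) powr (k - 1)"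
          using u by (simp add: powr_minus field_simps)
        then show ?thesis
          using u by (simp add: ennreal_mult[symmetric] ennreal_plus[symmetric] del: ennreal_plus)
      qed
      moreover have "indicator {-1..1} u = (indicator {0..1} (u\<^sup>2) :: ennreal)"
        "indicator {-1..1} (- u) = (indicator {0..1} (u\<^sup>2) :: ennreal)" if "u > 0"
        using that abs_square_le_1[of u] by (auto split: split_indicator)
      ultimately show "(ennreal ((1 - u\<^sup>2) powr (k - 1)) * indicator {-1..1} u +
            ennreal ((1 - (- u)\<^sup>2) powr (k - 1)) * indicator {-1..1} (- u)) * indicator {0<..} u =
          ennreal (2 * u) * (ennreal ((u\<^sup>2) powr (1 / 2 - 1) * (1 - u\<^sup>2) powr (k - 1)) *
            indicator {0..1} (u\<^sup>2)) * indicator {0<..} u"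
        by (cases "u > 0") (simp_all add: distrib_right[symmetric] mult.assoc[symmetric])
    qed
    also have "\<dots> = (\<integral>\<^sup>+a\<in>{0<..}. ennreal (a powr (1 / 2 - 1) * (1 - a) powr (k - 1)) * indicator {0..1} a \<partial>lborel)"
      by (rule nn_integral_pos_square[symmetric]) measurable
    also have "\<dots> = (\<integral>\<^sup>+a. ennreal (a powr (1 / 2 - 1) * (1 - a) powr (k - 1)) * indicator {0..1} a \<partial>lborel)"
      by (rule nn_integral_cong) (auto split: split_indicator)
    also have "\<dots> = ennreal (Beta (1 / 2) k)"
      using has_integral_Beta_real[of "1 / 2" k] k
      by (intro nn_integral_has_integral_lebesgue') auto
    finally show ?thesis .
  qed
  have c: "c_const (k - 1 / 2) \<ge> 0"
    using k by (simp add: c_const_def Gamma_real_nonneg)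
  have "(\<integral>\<^sup>+u\<in>{-1..1}. ennreal (c_const (k - 1 / 2) * (1 - u\<^sup>2) powr (k - 1)) \<partial>lborel) =
      (\<integral>\<^sup>+u. ennreal (c_const (k - 1 / 2)) * (ennreal ((1 - u\<^sup>2) powr (k - 1)) * indicator {-1..1} u) \<partial>lborel)"
    using c by (simp add: ennreal_mult mult.assoc)
  also have "\<dots> = ennreal (c_const (k - 1 / 2)) * ennreal (Beta (1 / 2) k)"
    by (subst nn_integral_cmult) (auto simp: B)
  also have "\<dots> = 1"
  proof -
    have "c_const (k - 1 / 2) * Beta (1 / 2) k = 1"
    proof -
      have "Gamma k > 0" "Gamma (k + 1 / 2) > 0"
        using k by (auto intro!: Gamma_real_pos)
      then show ?thesis
        by (simp add: c_const_def Beta_def add.commute Gamma_one_half_real)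
    qed
    then show ?thesis using c by (metis ennreal_1 ennreal_mult')
  qed
  finally show ?thesis .
qed

lemma sets_Phi_measure1 [measurable_cong]:
  "sets (Phi_measure1 k) = sets (restrict_space borel {-1..1})"
  by (simp add: Phi_measure1_def sets_restrict_space)

lemma space_Phi_measure1 [simp]: "space (Phi_measure1 k) = {-1..1}"
  by (simp add: Phi_measure1_def space_restrict_space)

lemma measurable_Phi_measure1I: "f \<in> borel \<rightarrow>\<^sub>M M \<Longrightarrow> f \<in> Phi_measure1 k \<rightarrow>\<^sub>M M"
  by (simp add: measurable_cong_sets[OF sets_Phi_measure1 refl] measurable_restrict_space1)

lemma nn_integral_Phi_measure1:
  assumes [measurable]: "f \<in> borel_measurable borel" and "k \<noteq> 0"
  shows "(\<integral>\<^sup>+u. f u \<partial>Phi_measure1 k) =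
    (\<integral>\<^sup>+u\<in>{-1..1}. ennreal (c_const (k - 1 / 2) * ((1 + u) * (1 - u\<^sup>2) powr (k - 1))) * f u \<partial>lborel)"
proof -
  have m: "h \<in> borel_measurable (restrict_space lborel {-1..1})" if "h \<in> borel_measurable borel" for h :: "real \<Rightarrow> ennreal"
    using that by (intro measurable_restrict_space1) simp
  show ?thesis
    using assms(2) unfolding Phi_measure1_def
    by (simp add: nn_integral_density m nn_integral_restrict_space)
qed

lemma nn_integral_Phi_measure1_0:
  assumes "f \<in> borel_measurable borel"
  shows "(\<integral>\<^sup>+u. f u \<partial>Phi_measure1 0) = f 1"
  using assms by (simp add: Phi_measure1_def nn_integral_return measurable_restrict_space1 space_restrict_space)

text \<open>The weights \<open>1 + u\<close> and \<open>1 - u\<close> add up to 2, so averaging over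
  the sign of \<open>u\<close> leaves the even weight. The reflection will come from pairing
  \<open>y\<close> with \<open>- y\<close>.\<close>

lemma nn_integral_Phi_measure1_symmetrized:
  assumes f[measurable]: "f \<in> borel_measurable borel" and k: "k > 0"
  shows "(\<integral>\<^sup>+u. f u \<partial>Phi_measure1 k) + (\<integral>\<^sup>+u. f (- u) \<partial>Phi_measure1 k) =
    2 * (\<integral>\<^sup>+u\<in>{-1..1}. ennreal (c_const (k - 1 / 2) * (1 - u\<^sup>2) powr (k - 1)) * f u \<partial>lborel)"
proof -
  let ?w = "\<lambda>u. ennreal (c_const (k - 1 / 2) * (1 - u\<^sup>2) powr (k - 1))"
  have c: "c_const (k - 1 / 2) \<ge> 0"
    using k by (simp add: c_const_def Gamma_real_nonneg)
  let ?W = "\<lambda>u::real. ennreal (c_const (k - 1 / 2) * ((1 + u) * (1 - u\<^sup>2) powr (k - 1)))"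
  have "(\<integral>\<^sup>+u. f (- u) \<partial>Phi_measure1 k) = (\<integral>\<^sup>+u. ?W u * f (- u) * indicator {-1..1} u \<partial>lborel)"
    using k by (intro nn_integral_Phi_measure1) auto
  also have "\<dots> = (\<integral>\<^sup>+u. ?W (- u) * f u * indicator {-1..1} (- u) \<partial>lborel)"
    by (subst nn_integral_real_affine[of _ "-1" 0]) auto
  also have "\<dots> = (\<integral>\<^sup>+u. ?W (- u) * f u * indicator {-1..1} u \<partial>lborel)"
    by (rule nn_integral_cong) (auto split: split_indicator)
  finally have "(\<integral>\<^sup>+u. f u \<partial>Phi_measure1 k) + (\<integral>\<^sup>+u. f (- u) \<partial>Phi_measure1 k) =
      (\<integral>\<^sup>+u. ?W u * f u * indicator {-1..1} u + ?W (- u) * f u * indicator {-1..1} u \<partial>lborel)"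
    using k by (subst nn_integral_add) (auto simp: nn_integral_Phi_measure1)
  also have "\<dots> = (\<integral>\<^sup>+u. 2 * (?w u * f u * indicator {-1..1} u) \<partial>lborel)"
  proof (rule nn_integral_cong)
    fix u :: real
    have "?W u + ?W (- u) = 2 * ?w u" if "u \<in> {-1..1}"
    proof -
      have "?W u + ?W (- u) = ennreal (c_const (k - 1 / 2) * ((1 + u) * (1 - u\<^sup>2) powr (k - 1)) +
          c_const (k - 1 / 2) * ((1 + - u) * (1 - (- u)\<^sup>2) powr (k - 1)))"
        using that c by (intro ennreal_plus[symmetric]) auto
      also have "\<dots> = ennreal (2 * (c_const (k - 1 / 2) * (1 - u\<^sup>2) powr (k - 1)))"
        by (simp add: algebra_simps)
      finally show ?thesis using c by (simp add: ennreal_mult')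
    qed
    then show "?W u * f u * indicator {-1..1} u + ?W (- u) * f u * indicator {-1..1} u =
      2 * (?w u * f u * indicator {-1..1} u)"
      by (cases "u \<in> {-1..1}") (simp_all add: distrib_right[symmetric] mult.assoc)
  qed
  also have "\<dots> = 2 * (\<integral>\<^sup>+u\<in>{-1..1}. ?w u * f u \<partial>lborel)"
    by (rule nn_integral_cmult) measurable
  finally show ?thesis .
qed

lemma prob_space_Phi_measure1:
  assumes k: "k \<ge> 0"
  shows "prob_space (Phi_measure1 k)"
proof
  show "emeasure (Phi_measure1 k) (space (Phi_measure1 k)) = 1"
  proof (cases "k = 0")
    case True
    have "(\<integral>\<^sup>+u. 1 \<partial>Phi_measure1 0) = 1"
      by (rule nn_integral_Phi_measure1_0) simp
    then show ?thesis using True by simp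
  next
    case False
    \<comment> \<open>For the constant function the two symmetrized terms coincide, so the odd part
      of the weight carries no mass.\<close>
    with k have "2 * (\<integral>\<^sup>+u. 1 \<partial>Phi_measure1 k) = 2"
      using nn_integral_Phi_measure1_symmetrized[of "\<lambda>_. 1" k]
      by (simp add: nn_integral_symmetric_beta mult_2[symmetric] del: nn_integral_const)
    then have "(\<integral>\<^sup>+u. 1 \<partial>Phi_measure1 k) = 1"
      using ennreal_mult_cancel_left[of 2 _ 1] by simp
    then show ?thesis by simp
  qed
qed

text \<open>The substitution \<open>u = cos \<theta>\<close>, done through the increasing function
  \<open>- cos\<close>. One factor \<open>sin \<theta>\<close> is spent as Jacobian, which turns the
  exponent \<open>2 * a - 1\<close> into \<open>2 * (a - 1)\<close>.\<close>

lemma nn_integral_angle: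
  fixes F :: "real \<Rightarrow> ennreal"
  assumes [measurable]: "F \<in> borel_measurable borel"
  shows "(\<integral>\<^sup>+\<theta>\<in>{0..pi}. F (cos \<theta>) * ennreal (sin \<theta> powr (2 * a - 1)) \<partial>lborel) =
    (\<integral>\<^sup>+u\<in>{-1..1}. F u * ennreal ((1 - u\<^sup>2) powr (a - 1)) \<partial>lborel)"
proof -
  have "(\<integral>\<^sup>+u\<in>{-1..1}. F u * ennreal ((1 - u\<^sup>2) powr (a - 1)) \<partial>lborel) =
      (\<integral>\<^sup>+u. F (- u) * ennreal ((1 - u\<^sup>2) powr (a - 1)) * indicator {-1..1} (- u) \<partial>lborel)"
    by (subst nn_integral_real_affine[of _ "-1" 0]) auto
  also have "\<dots> = (\<integral>\<^sup>+u. F (- u) * ennreal ((1 - u\<^sup>2) powr (a - 1)) * indicator {- cos 0..- cos pi} u \<partial>lborel)"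
    by (rule nn_integral_cong) (auto split: split_indicator)
  also have "\<dots> = (\<integral>\<^sup>+\<theta>. F (- (- cos \<theta>)) * ennreal ((1 - (- cos \<theta>)\<^sup>2) powr (a - 1)) * ennreal (sin \<theta>) * indicator {0..pi} \<theta> \<partial>lborel)"
    by (rule nn_integral_substitution_aux)
      (auto intro!: derivative_eq_intros continuous_intros simp: sin_ge_zero)
  also have "\<dots> = (\<integral>\<^sup>+\<theta>\<in>{0..pi}. F (cos \<theta>) * ennreal (sin \<theta> powr (2 * a - 1)) \<partial>lborel)"
  proof (rule nn_integral_cong)
    fix \<theta> :: real
    have "(1 - (cos \<theta>)\<^sup>2) powr (a - 1) * sin \<theta> = sin \<theta> powr (2 * a - 1)" if "\<theta> \<in> {0..pi}"
    proof (cases "sin \<theta> = 0")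
      case False
      then have s: "sin \<theta> > 0"
        using sin_ge_zero[of \<theta>] that by auto
      have "(1 - (cos \<theta>)\<^sup>2) powr (a - 1) = (sin \<theta> powr 2) powr (a - 1)"
        using s by (simp add: sin_squared_eq[symmetric])
      also have "\<dots> * sin \<theta> = sin \<theta> powr (2 * (a - 1)) * sin \<theta> powr 1"
        using s by (simp only: powr_powr powr_one)
      also have "\<dots> = sin \<theta> powr (2 * a - 1)"
        by (simp only: powr_add[symmetric]) (simp add: algebra_simps)
      finally show ?thesis .
    qed simp
    then show "F (- (- cos \<theta>)) * ennreal ((1 - (- cos \<theta>)\<^sup>2) powr (a - 1)) * ennreal (sin \<theta>) * indicator {0..pi} \<theta> =
        F (cos \<theta>) * ennreal (sin \<theta> powr (2 * a - 1)) * indicator {0..pi} \<theta>"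
      by (cases "\<theta> \<in> {0..pi}") (simp_all add: mult.assoc ennreal_mult'[symmetric] sin_ge_zero ennreal_mult''[symmetric])
  qed
  finally show ?thesis ..
qed

text \<open>
  The substitution \<open>(X, q) = (y u, y\<^sup>2 (1 - u\<^sup>2))\<close>.
\<close>

lemma nn_integral_half_disc:
  fixes F :: "real \<Rightarrow> real \<Rightarrow> ennreal"
  assumes F[measurable]: "case_prod F \<in> borel_measurable (borel \<Otimes>\<^sub>M borel)" and k: "k > 0"
  shows "(\<integral>\<^sup>+y\<in>{0<..}. ennreal (2 * y powr (2 * k)) *
       (\<integral>\<^sup>+u\<in>{-1..1}. ennreal ((1 - u\<^sup>2) powr (k - 1)) * F (y\<^sup>2) (y * u) \<partial>lborel) \<partial>lborel) =
     (\<integral>\<^sup>+X. \<integral>\<^sup>+q. F (X\<^sup>2 + q) X \<partial>pow_measure k \<partial>lborel)"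
proof -
  let ?I = "\<lambda>y. (\<integral>\<^sup>+u\<in>{-1..1}. ennreal ((1 - u\<^sup>2) powr (k - 1)) * F (y\<^sup>2) (y * u) \<partial>lborel)"
  define \<phi> where "\<phi> X a = ennreal ((a - X\<^sup>2) powr (k - 1)) * F a X * indicator {0<..} (a - X\<^sup>2)" for X a
  have \<phi>[measurable]: "case_prod \<phi> \<in> borel_measurable (borel \<Otimes>\<^sub>M borel)"
    unfolding \<phi>_def by measurable
  have inner: "ennreal (2 * y powr (2 * k)) *
       ?I y =
       (\<integral>\<^sup>+X. ennreal (2 * y) * \<phi> X (y\<^sup>2) \<partial>lborel)" if y: "y > 0" for y
  proof -
    have "?I y =
      ennreal \<bar>1 / y\<bar> * (\<integral>\<^sup>+X. ennreal ((1 - (0 + 1 / y * X)\<^sup>2) powr (k - 1)) * F (y\<^sup>2) (y * (0 + 1 / y * X)) *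
         indicator {-1..1} (0 + 1 / y * X) \<partial>lborel)"
      by (rule nn_integral_real_affine) (use y in auto)
    then have "ennreal (2 * y powr (2 * k)) * ?I y =
      ennreal (2 * y powr (2 * k)) * (ennreal (1 / y) * (\<integral>\<^sup>+X. ennreal ((1 - (X / y)\<^sup>2) powr (k - 1)) * F (y\<^sup>2) X *
         indicator {-1..1} (X / y) \<partial>lborel))"
      using y by simp
    also have "\<dots> = (\<integral>\<^sup>+X. ennreal (2 * y powr (2 * k)) * (ennreal (1 / y) * (ennreal ((1 - (X / y)\<^sup>2) powr (k - 1)) * F (y\<^sup>2) X *
         indicator {-1..1} (X / y))) \<partial>lborel)"
      by (subst nn_integral_cmult[symmetric], measurable)+
    also have "\<dots> = (\<integral>\<^sup>+X. ennreal (2 * y) * \<phi> X (y\<^sup>2) \<partial>lborel)"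
    proof (rule nn_integral_cong)
      fix X :: real
      have X: "1 - (X / y)\<^sup>2 = (y\<^sup>2 - X\<^sup>2) / y\<^sup>2"
        using y by (simp add: power_divide diff_divide_distrib)
      \<comment> \<open>On the boundary \<open>X\<^sup>2 = y\<^sup>2\<close> both sides vanish: the
        left one because \<open>0 powr a = 0\<close> for every \<open>a\<close>, the right one
        because the indicator in \<open>\<phi>\<close> is open.\<close>
      consider "X\<^sup>2 = y\<^sup>2" | "X\<^sup>2 > y\<^sup>2" | "X\<^sup>2 < y\<^sup>2" by linarith
      then show "ennreal (2 * y powr (2 * k)) * (ennreal (1 / y) * (ennreal ((1 - (X / y)\<^sup>2) powr (k - 1)) * F (y\<^sup>2) X *
         indicator {-1..1} (X / y))) = ennreal (2 * y) * \<phi> X (y\<^sup>2)"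
      proof cases
        case 1
        then show ?thesis using y by (simp add: \<phi>_def X)
      next
        case 2
        then have "\<bar>X / y\<bar> > 1"
          using y abs_le_square_iff[of X y] by (simp add: not_le)
        then have "X / y \<notin> {-1..1}" by auto
        then show ?thesis using 2 by (simp add: \<phi>_def)
      next
        case 3
        then have "\<bar>X / y\<bar> < 1"
          using y abs_le_square_iff[of y X] by (simp add: not_le)
        then have i: "X / y \<in> {-1..1}" unfolding abs_less_iff by simp
        have "(1 - (X / y)\<^sup>2) powr (k - 1) = (y\<^sup>2 - X\<^sup>2) powr (k - 1) / (y powr 2) powr (k - 1)"
          unfolding X using 3 y by (simp add: powr_divide)
        also have "(y powr 2) powr (k - 1) = y powr (2 * k) / y powr 2"
          by (simp add: powr_powr powr_diff[symmetric] algebra_simps)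
        finally have "2 * y powr (2 * k) * (1 / y * (1 - (X / y)\<^sup>2) powr (k - 1)) = 2 * y * (y\<^sup>2 - X\<^sup>2) powr (k - 1)"
          using y by (simp add: field_simps power2_eq_square)
        then have "ennreal (2 * y powr (2 * k)) * (ennreal (1 / y) * ennreal ((1 - (X / y)\<^sup>2) powr (k - 1))) =
            ennreal (2 * y) * ennreal ((y\<^sup>2 - X\<^sup>2) powr (k - 1))"
          using y by (simp add: ennreal_mult[symmetric])
        then have "ennreal (2 * y powr (2 * k)) * (ennreal (1 / y) * ennreal ((1 - (X / y)\<^sup>2) powr (k - 1))) * F (y\<^sup>2) X =
            ennreal (2 * y) * ennreal ((y\<^sup>2 - X\<^sup>2) powr (k - 1)) * F (y\<^sup>2) X" by (rule arg_cong)
        then show ?thesis using i 3 by (simp add: \<phi>_def mult.assoc)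
      qed
    qed
    finally show ?thesis .
  qed
  have "(\<integral>\<^sup>+y\<in>{0<..}. ennreal (2 * y powr (2 * k)) *
       ?I y \<partial>lborel) =
      (\<integral>\<^sup>+y. \<integral>\<^sup>+X. ennreal (2 * y) * \<phi> X (y\<^sup>2) * indicator {0<..} y \<partial>lborel \<partial>lborel)"
  proof (rule nn_integral_cong)
    fix y :: real
    show "ennreal (2 * y powr (2 * k)) *
       ?I y * indicator {0<..} y =
      (\<integral>\<^sup>+X. ennreal (2 * y) * \<phi> X (y\<^sup>2) * indicator {0<..} y \<partial>lborel)"
      by (cases "y > 0") (simp_all add: inner)
  qed
  also have "\<dots> = (\<integral>\<^sup>+X. \<integral>\<^sup>+y. ennreal (2 * y) * \<phi> X (y\<^sup>2) * indicator {0<..} y \<partial>lborel \<partial>lborel)"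
    by (rule lborel_pair.Fubini') measurable
  also have "\<dots> = (\<integral>\<^sup>+X. \<integral>\<^sup>+q. F (X\<^sup>2 + q) X \<partial>pow_measure k \<partial>lborel)"
  proof (rule nn_integral_cong)
    fix X :: real
    have "(\<integral>\<^sup>+y. ennreal (2 * y) * \<phi> X (y\<^sup>2) * indicator {0<..} y \<partial>lborel) = (\<integral>\<^sup>+a\<in>{0<..}. \<phi> X a \<partial>lborel)"
      by (rule nn_integral_pos_square[symmetric]) measurable
    also have "\<dots> = (\<integral>\<^sup>+a. \<phi> X a \<partial>lborel)"
    proof (rule nn_integral_cong)
      fix a :: real
      have "a > 0" if "a - X\<^sup>2 > 0" using that zero_le_power2[of X] by linarith
      then show "\<phi> X a * indicator {0<..} a = \<phi> X a"
        by (auto simp: \<phi>_def split: split_indicator)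
    qed
    also have "\<dots> = (\<integral>\<^sup>+q. \<phi> X (X\<^sup>2 + q) \<partial>lborel)"
      by (rule nn_integral_lborel_translate[symmetric]) measurable
    also have "\<dots> = (\<integral>\<^sup>+q. F (X\<^sup>2 + q) X \<partial>pow_measure k)"
      using k by (subst nn_integral_pow_measure) (simp_all add: \<phi>_def)
    finally show "(\<integral>\<^sup>+y. ennreal (2 * y) * \<phi> X (y\<^sup>2) * indicator {0<..} y \<partial>lborel) = \<dots>" .
  qed
  finally show ?thesis .
qed

text \<open>Only \<open>y * u\<close> and \<open>y\<^sup>2\<close> occur in \<open>F\<close>, so
  replacing \<open>y\<close> by \<open>- y\<close> amounts to replacing \<open>u\<close> by
  \<open>- u\<close>. Folding the line therefore removes the factor \<open>1 + u\<close>, and the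
  half-disc substitution applies to the rest. For \<open>k = 0\<close> the point masses at
  \<open>u = 1\<close> and \<open>q = 0\<close> correspond to each other.\<close>

lemma nn_integral_Phi_measure1_line:
  assumes k: "k \<ge> 0"
  shows "\<exists>C. \<forall>F. case_prod F \<in> borel_measurable (borel \<Otimes>\<^sub>M borel) \<longrightarrow>
      (\<integral>\<^sup>+y. ennreal (\<bar>y\<bar> powr (2 * k)) * (\<integral>\<^sup>+u. F (y\<^sup>2) (y * u) \<partial>Phi_measure1 k) \<partial>lborel) =
      C * (\<integral>\<^sup>+X. \<integral>\<^sup>+q. F (X\<^sup>2 + q) X \<partial>pow_measure k \<partial>lborel)"
proof (cases "k = 0")
  case True
  show ?thesis
  proof (intro exI[of _ 1] allI impI)
    fix F :: "real \<Rightarrow> real \<Rightarrow> ennreal"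
    assume [measurable]: "case_prod F \<in> borel_measurable (borel \<Otimes>\<^sub>M borel)"
    have "(\<integral>\<^sup>+y. ennreal (\<bar>y\<bar> powr (2 * k)) * (\<integral>\<^sup>+u. F (y\<^sup>2) (y * u) \<partial>Phi_measure1 k) \<partial>lborel) =
        (\<integral>\<^sup>+y. F (y\<^sup>2) y \<partial>lborel)"
      \<comment> \<open>Only almost everywhere, since \<open>0 powr 0 = 0\<close> makes the weight
        vanish at \<open>y = 0\<close>.\<close>
      by (rule nn_integral_cong_AE, use AE_lborel_singleton[of 0] in eventually_elim)
        (simp add: True nn_integral_Phi_measure1_0)
    then show "(\<integral>\<^sup>+y. ennreal (\<bar>y\<bar> powr (2 * k)) * (\<integral>\<^sup>+u. F (y\<^sup>2) (y * u) \<partial>Phi_measure1 k) \<partial>lborel) =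
      1 * (\<integral>\<^sup>+X. \<integral>\<^sup>+q. F (X\<^sup>2 + q) X \<partial>pow_measure k \<partial>lborel)"
      by (simp add: True nn_integral_pow_measure_0)
  qed
next
  case False
  with k have k: "k > 0" by simp
  define c where "c = c_const (k - 1 / 2)"
  have c: "c \<ge> 0"
    using k by (simp add: c_def c_const_def Gamma_real_nonneg)
  interpret Phi: prob_space "Phi_measure1 k"
    using k by (intro prob_space_Phi_measure1) simp
  show ?thesis
  proof (intro exI[of _ "ennreal c"] allI impI)
    fix F :: "real \<Rightarrow> real \<Rightarrow> ennreal"
    assume F[measurable]: "case_prod F \<in> borel_measurable (borel \<Otimes>\<^sub>M borel)"
  let ?I = "\<lambda>y. (\<integral>\<^sup>+u\<in>{-1..1}. ennreal ((1 - u\<^sup>2) powr (k - 1)) * F (y\<^sup>2) (y * u) \<partial>lborel)"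
  let ?\<Phi> = "\<lambda>y. (\<integral>\<^sup>+u. F (y\<^sup>2) (y * u) \<partial>Phi_measure1 k)"
    have W: "?\<Phi> y = (\<integral>\<^sup>+u\<in>{-1..1}. ennreal (c * ((1 + u) * (1 - u\<^sup>2) powr (k - 1))) * F (y\<^sup>2) (y * u) \<partial>lborel)" for y
      unfolding c_def using k by (intro nn_integral_Phi_measure1) auto
    have "(\<integral>\<^sup>+y. ennreal (\<bar>y\<bar> powr (2 * k)) * ?\<Phi> y \<partial>lborel) =
       (\<integral>\<^sup>+y\<in>{0<..}. ennreal (\<bar>y\<bar> powr (2 * k)) * ?\<Phi> y +
         ennreal (\<bar>- y\<bar> powr (2 * k)) * (\<integral>\<^sup>+u. F ((- y)\<^sup>2) (- y * u) \<partial>Phi_measure1 k) \<partial>lborel)"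
      unfolding W by (rule nn_integral_even_odd) measurable
    also have "\<dots> = (\<integral>\<^sup>+y. ennreal c * (ennreal (2 * y powr (2 * k)) *
       ?I y * indicator {0<..} y) \<partial>lborel)"
    proof (rule nn_integral_cong)
      fix y :: real
      show "(ennreal (\<bar>y\<bar> powr (2 * k)) * ?\<Phi> y +
         ennreal (\<bar>- y\<bar> powr (2 * k)) * (\<integral>\<^sup>+u. F ((- y)\<^sup>2) (- y * u) \<partial>Phi_measure1 k)) * indicator {0<..} y =
        ennreal c * (ennreal (2 * y powr (2 * k)) *
         ?I y * indicator {0<..} y)"
      proof (cases "y > 0")
        case True
        have "(\<integral>\<^sup>+u\<in>{-1..1}. ennreal (c * (1 - u\<^sup>2) powr (k - 1)) * F (y\<^sup>2) (y * u) \<partial>lborel) =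
            (\<integral>\<^sup>+u. ennreal c * (ennreal ((1 - u\<^sup>2) powr (k - 1)) * F (y\<^sup>2) (y * u) * indicator {-1..1} u) \<partial>lborel)"
          using c by (simp add: ennreal_mult mult.assoc)
        also have "\<dots> = ennreal c * ?I y"
          by (rule nn_integral_cmult) measurable
        finally have e: "(\<integral>\<^sup>+u\<in>{-1..1}. ennreal (c * (1 - u\<^sup>2) powr (k - 1)) * F (y\<^sup>2) (y * u) \<partial>lborel) = \<dots>" .
        have "?\<Phi> y + (\<integral>\<^sup>+u. F (y\<^sup>2) (y * (- u)) \<partial>Phi_measure1 k) =
            2 * (\<integral>\<^sup>+u\<in>{-1..1}. ennreal (c * (1 - u\<^sup>2) powr (k - 1)) * F (y\<^sup>2) (y * u) \<partial>lborel)"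
          unfolding c_def by (rule nn_integral_Phi_measure1_symmetrized) (use k in auto)
        then have s: "?\<Phi> y + (\<integral>\<^sup>+u. F (y\<^sup>2) (- y * u) \<partial>Phi_measure1 k) =
            2 * (ennreal c * ?I y)"
          unfolding e by simp
        have "ennreal (2 * y powr (2 * k)) = ennreal (y powr (2 * k)) * 2"
          by (simp add: ennreal_mult' mult.commute)
        then show ?thesis
          using True unfolding power2_minus abs_minus_cancel distrib_left[symmetric] s
          by (simp add: mult_ac)
      qed simp
    qed
    also have "\<dots> = ennreal c * (\<integral>\<^sup>+y. (ennreal (2 * y powr (2 * k)) *
       ?I y * indicator {0<..} y) \<partial>lborel)"
      by (rule nn_integral_cmult) measurable
    also have "\<dots> = ennreal c * (\<integral>\<^sup>+X. \<integral>\<^sup>+q. F (X\<^sup>2 + q) X \<partial>pow_measure k \<partial>lborel)"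
      by (simp only: nn_integral_half_disc[OF F k])
    finally show "(\<integral>\<^sup>+y. ennreal (\<bar>y\<bar> powr (2 * k)) * ?\<Phi> y \<partial>lborel) = \<dots>" .
  qed
qed

text \<open>Rotation invariance of plane Lebesgue measure, for functions of the radius and of one
  linear form. The rotation is split into two one-dimensional affine substitutions, \<open>X\<close>
  by \<open>U\<close> at fixed \<open>Z\<close> and then \<open>Z\<close> by \<open>V\<close> at
  fixed \<open>U\<close>; the factor \<open>\<bar>c / a\<bar>\<close> produced by the first is
  absorbed by the second. For \<open>a = 0\<close> exchanging the variables, with a reflection if
  \<open>b < 0\<close>, is enough.\<close>

lemma nn_integral_plane_rotation:
  fixes K :: "real \<Rightarrow> real \<Rightarrow> ennreal"
  assumes K[measurable]: "case_prod K \<in> borel_measurable (borel \<Otimes>\<^sub>M borel)"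
  shows "(\<integral>\<^sup>+X. \<integral>\<^sup>+Z. K (X\<^sup>2 + Z\<^sup>2) (a * X + b * Z) \<partial>lborel \<partial>lborel) =
    (\<integral>\<^sup>+U. \<integral>\<^sup>+V. K (U\<^sup>2 + V\<^sup>2) (sqrt (a\<^sup>2 + b\<^sup>2) * U) \<partial>lborel \<partial>lborel)"
proof -
  have swap: "(\<integral>\<^sup>+X. \<integral>\<^sup>+Z. K (X\<^sup>2 + Z\<^sup>2) (a * X + b * Z) \<partial>lborel \<partial>lborel) =
      (\<integral>\<^sup>+Z. \<integral>\<^sup>+X. K (X\<^sup>2 + Z\<^sup>2) (a * X + b * Z) \<partial>lborel \<partial>lborel)"
    by (rule lborel_pair.Fubini') measurable
  show ?thesis
  proof (cases "a = 0")
    case True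
    show ?thesis
    proof (cases "b \<ge> 0")
      case True
      then show ?thesis unfolding swap using \<open>a = 0\<close> by (simp add: add.commute)
    next
      case False
      have "(\<integral>\<^sup>+Z. \<integral>\<^sup>+X. K (X\<^sup>2 + Z\<^sup>2) (b * Z) \<partial>lborel \<partial>lborel) =
          ennreal \<bar>-1\<bar> * (\<integral>\<^sup>+Z. \<integral>\<^sup>+X. K (X\<^sup>2 + (0 + -1 * Z)\<^sup>2) (b * (0 + -1 * Z)) \<partial>lborel \<partial>lborel)"
        by (rule nn_integral_real_affine) auto
      then show ?thesis
        unfolding swap using \<open>a = 0\<close> False by (simp add: add.commute)
    qed
  next
    case a: False
    define c where "c = sqrt (a\<^sup>2 + b\<^sup>2)"
    have c: "c > 0" and c2: "c\<^sup>2 = a\<^sup>2 + b\<^sup>2"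
      using a by (auto simp: c_def sum_power2_gt_zero_iff)
    let ?r = "ennreal \<bar>c / a\<bar>"
    let ?X = "\<lambda>U Z. - b * Z / a + c / a * U"
  let ?K = "\<lambda>U Z. K ((?X U Z)\<^sup>2 + Z\<^sup>2) (a * ?X U Z + b * Z)"
    have "(\<integral>\<^sup>+Z. \<integral>\<^sup>+X. K (X\<^sup>2 + Z\<^sup>2) (a * X + b * Z) \<partial>lborel \<partial>lborel) =
        (\<integral>\<^sup>+Z. ?r * (\<integral>\<^sup>+U. ?K U Z \<partial>lborel) \<partial>lborel)"
      by (intro nn_integral_cong nn_integral_real_affine) (use a c in auto)
    also have "\<dots> = ?r * (\<integral>\<^sup>+Z. \<integral>\<^sup>+U. ?K U Z \<partial>lborel \<partial>lborel)"
      by (rule nn_integral_cmult) measurable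
    also have "(\<integral>\<^sup>+Z. \<integral>\<^sup>+U. ?K U Z \<partial>lborel \<partial>lborel) =
        (\<integral>\<^sup>+U. \<integral>\<^sup>+Z. ?K U Z \<partial>lborel \<partial>lborel)"
      by (rule lborel_pair.Fubini') measurable
    also have "?r * \<dots> = (\<integral>\<^sup>+U. ?r * (\<integral>\<^sup>+Z. ?K U Z \<partial>lborel) \<partial>lborel)"
      by (rule nn_integral_cmult[symmetric]) measurable
    also have "\<dots> = (\<integral>\<^sup>+U. \<integral>\<^sup>+V. K (U\<^sup>2 + V\<^sup>2) (c * U) \<partial>lborel \<partial>lborel)"
    proof (rule nn_integral_cong)
      fix U :: real
      \<comment> \<open>With \<open>U = (a * X + b * Z) / c\<close>, the orthogonal coordinate
        \<open>(b * X - a * Z) / c\<close> becomes \<open>(b * U - c * Z) / a\<close> after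
        eliminating \<open>X\<close>; this is the substituted \<open>V\<close>.\<close>
      have "(\<integral>\<^sup>+V. K (U\<^sup>2 + V\<^sup>2) (c * U) \<partial>lborel) =
          ennreal \<bar>- c / a\<bar> * (\<integral>\<^sup>+Z. K (U\<^sup>2 + (b * U / a + (- c / a) * Z)\<^sup>2) (c * U) \<partial>lborel)"
        by (rule nn_integral_real_affine) (use a c in auto)
      also have "(\<integral>\<^sup>+Z. K (U\<^sup>2 + (b * U / a + (- c / a) * Z)\<^sup>2) (c * U) \<partial>lborel) =
          (\<integral>\<^sup>+Z. ?K U Z \<partial>lborel)"
      proof (rule nn_integral_cong)
        fix Z :: real
        have "a\<^sup>2 * (U\<^sup>2 + (b * U / a + (- c / a) * Z)\<^sup>2) = a\<^sup>2 * U\<^sup>2 + (b * U - c * Z)\<^sup>2"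
          using a by (simp add: field_simps power2_eq_square)
        also have "\<dots> = c\<^sup>2 * U\<^sup>2 + (b\<^sup>2 + a\<^sup>2) * Z\<^sup>2 - 2 * b * c * U * Z"
          using c2 by (simp add: power2_eq_square algebra_simps)
        also have "\<dots> = (c * U - b * Z)\<^sup>2 + a\<^sup>2 * Z\<^sup>2"
          by (simp add: power2_eq_square algebra_simps)
        also have "\<dots> = a\<^sup>2 * ((?X U Z)\<^sup>2 + Z\<^sup>2)"
          using a by (simp add: field_simps power2_eq_square)
        finally have "U\<^sup>2 + (b * U / a + (- c / a) * Z)\<^sup>2 = (?X U Z)\<^sup>2 + Z\<^sup>2"
          using a by simp
        moreover have "c * U = a * ?X U Z + b * Z"
          using a by (simp add: field_simps)
        ultimately show "K (U\<^sup>2 + (b * U / a + (- c / a) * Z)\<^sup>2) (c * U) = ?K U Z"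
          by (rule arg_cong2)
      qed
      finally show "?r * (\<integral>\<^sup>+Z. ?K U Z \<partial>lborel) = (\<integral>\<^sup>+V. K (U\<^sup>2 + V\<^sup>2) (c * U) \<partial>lborel)"
        by simp
    qed
    finally show ?thesis unfolding swap c_def .
  qed
qed

section \<open>Reduction to a line\<close>

text \<open>The integral of a kernel over the cone in the Cartesian coordinates \<open>y\<close>.
  Vectors are functions on a finite set \<open>I\<close>, so that coordinates can be added one at a
  time; the radius enters through its square because squares, like inner products, are additive over
  the coordinates.\<close>

definition cone_transform ::
  "('i \<Rightarrow> real) \<Rightarrow> 'i set \<Rightarrow> ('i \<Rightarrow> real) \<Rightarrow> (real \<Rightarrow> real \<Rightarrow> ennreal) \<Rightarrow> ennreal" where
  "cone_transform \<kappa> I x F =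
    (\<integral>\<^sup>+y. ennreal (\<Prod>i\<in>I. \<bar>y i\<bar> powr (2 * \<kappa> i)) *
      (\<integral>\<^sup>+u. F (\<Sum>i\<in>I. (y i)\<^sup>2) (\<Sum>i\<in>I. x i * y i * u i) \<partial>PiM I (\<lambda>i. Phi_measure1 (\<kappa> i)))
      \<partial>PiM I (\<lambda>_. lborel))"

lemma measurable_component_Phi_measure:
  "i \<in> I \<Longrightarrow> (\<lambda>u. u i) \<in> borel_measurable (PiM I (\<lambda>i. Phi_measure1 (\<kappa> i)))"
  by (rule measurable_compose[OF measurable_component_singleton])
    (auto intro: measurable_Phi_measure1I)

lemma measurable_component_lborel:
  "i \<in> I \<Longrightarrow> (\<lambda>y. y i) \<in> borel_measurable (PiM I (\<lambda>_. lborel :: real measure))"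
  using measurable_component_singleton[of i I "\<lambda>_. lborel :: real measure"] by simp

lemma cone_transform_singleton:
  fixes \<kappa> :: "'i \<Rightarrow> real"
  assumes \<kappa>: "\<And>i. \<kappa> i \<ge> 0" and [measurable]: "case_prod F \<in> borel_measurable (borel \<Otimes>\<^sub>M borel)"
  shows "cone_transform \<kappa> {j} x F =
    (\<integral>\<^sup>+y. ennreal (\<bar>y\<bar> powr (2 * \<kappa> j)) * (\<integral>\<^sup>+u. F (y\<^sup>2) (x j * (y * u)) \<partial>Phi_measure1 (\<kappa> j)) \<partial>lborel)"
proof -
  interpret Phi1: prob_space "Phi_measure1 (\<kappa> i)" for i
    using \<kappa> by (rule prob_space_Phi_measure1)
  interpret Phi: product_prob_space "\<lambda>i. Phi_measure1 (\<kappa> i)"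
    by unfold_locales
  interpret L: product_sigma_finite "\<lambda>_::'i. lborel :: real measure"
    by unfold_locales
  have "(\<integral>\<^sup>+u. F a (b * u j) \<partial>PiM {j} (\<lambda>i. Phi_measure1 (\<kappa> i))) = (\<integral>\<^sup>+u. F a (b * u) \<partial>Phi_measure1 (\<kappa> j))" for a b
    by (rule Phi.product_nn_integral_singleton) (rule measurable_Phi_measure1I, measurable)
  then have "cone_transform \<kappa> {j} x F = (\<integral>\<^sup>+y. ennreal (\<bar>y j\<bar> powr (2 * \<kappa> j)) *
      (\<integral>\<^sup>+u. F ((y j)\<^sup>2) (x j * y j * u) \<partial>Phi_measure1 (\<kappa> j)) \<partial>PiM {j} (\<lambda>_. lborel))"
    by (simp add: cone_transform_def)
  also have "\<dots> = (\<integral>\<^sup>+y. ennreal (\<bar>y\<bar> powr (2 * \<kappa> j)) *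
      (\<integral>\<^sup>+u. F (y\<^sup>2) (x j * y * u) \<partial>Phi_measure1 (\<kappa> j)) \<partial>lborel)"
  proof (rule L.product_nn_integral_singleton)
    have [measurable]: "(\<lambda>z. snd z) \<in> borel_measurable (lborel \<Otimes>\<^sub>M Phi_measure1 (\<kappa> j))"
      by (rule measurable_compose[OF measurable_snd]) (rule measurable_Phi_measure1I, simp)
    have [measurable]: "(\<lambda>z. F ((fst z)\<^sup>2) (x j * fst z * snd z)) \<in> borel_measurable (lborel \<Otimes>\<^sub>M Phi_measure1 (\<kappa> j))"
      by measurable
    have [measurable]: "(\<lambda>y. \<integral>\<^sup>+u. F (y\<^sup>2) (x j * y * u) \<partial>Phi_measure1 (\<kappa> j)) \<in> borel_measurable lborel"
      by (rule Phi1.borel_measurable_nn_integral) (simp add: case_prod_beta')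
    show "(\<lambda>y. ennreal (\<bar>y\<bar> powr (2 * \<kappa> j)) *
      (\<integral>\<^sup>+u. F (y\<^sup>2) (x j * y * u) \<partial>Phi_measure1 (\<kappa> j))) \<in> borel_measurable lborel"
      by measurable
  qed
  finally show ?thesis by (simp add: mult.assoc)
qed

text \<open>Both arguments of \<open>F\<close> are sums over coordinates, so splitting off the
  variables of index \<open>j\<close> leaves the transform over \<open>I\<close> of a shifted
  \<open>F\<close>. The work lies in interchanging the integration in \<open>v\<close> with that in
  the remaining \<open>y\<close>.\<close>

lemma cone_transform_insert:
  fixes \<kappa> :: "'i \<Rightarrow> real"
  assumes \<kappa>: "\<And>i. \<kappa> i \<ge> 0" and F[measurable]: "case_prod F \<in> borel_measurable (borel \<Otimes>\<^sub>M borel)"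
    and I: "finite I" "j \<notin> I"
  shows "cone_transform \<kappa> (insert j I) x F =
    (\<integral>\<^sup>+z. ennreal (\<bar>z\<bar> powr (2 * \<kappa> j)) *
      (\<integral>\<^sup>+v. cone_transform \<kappa> I x (\<lambda>a b. F (z\<^sup>2 + a) (x j * (z * v) + b)) \<partial>Phi_measure1 (\<kappa> j)) \<partial>lborel)"
proof -
  interpret Phi1: prob_space "Phi_measure1 (\<kappa> i)" for i
    using \<kappa> by (rule prob_space_Phi_measure1)
  interpret Phi: product_prob_space "\<lambda>i. Phi_measure1 (\<kappa> i)"
    by unfold_locales
  interpret L: product_sigma_finite "\<lambda>_::'i. lborel :: real measure"
    by unfold_locales
  let ?\<Phi> = "\<lambda>I. PiM I (\<lambda>i. Phi_measure1 (\<kappa> i))" and ?L = "\<lambda>I::'i set. PiM I (\<lambda>_. lborel :: real measure)"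
  have \<Phi>I: "sigma_finite_measure (?\<Phi> I)"
    by (intro prob_space_imp_sigma_finite prob_space_PiM Phi1.prob_space_axioms)
  interpret LI: sigma_finite_measure "?L I" by (rule L.sigma_finite) fact
  define W where "W y = (\<Prod>i\<in>I. \<bar>y i\<bar> powr (2 * \<kappa> i))" for y :: "'i \<Rightarrow> real"
  define S where "S y = (\<Sum>i\<in>I. (y i)\<^sup>2)" for y :: "'i \<Rightarrow> real"
  define T where "T y u = (\<Sum>i\<in>I. x i * y i * u i)" for y u :: "'i \<Rightarrow> real"
  let ?F = "\<lambda>z v y. (\<integral>\<^sup>+u. F (z\<^sup>2 + S y) (x j * (z * v) + T y u) \<partial>?\<Phi> I)"
  let ?J = "insert j I"
  let ?P = "Phi_measure1 (\<kappa> j)"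
  have T[measurable]: "(\<lambda>w. T (fst w) (snd w)) \<in> borel_measurable (?L I \<Otimes>\<^sub>M ?\<Phi> I)"
    unfolding T_def
    by (intro borel_measurable_sum borel_measurable_times borel_measurable_const
        measurable_compose[OF measurable_fst measurable_component_lborel]
        measurable_compose[OF measurable_snd measurable_component_Phi_measure])
  have S[measurable]: "S \<in> borel_measurable (?L I)" and W[measurable]: "W \<in> borel_measurable (?L I)"
    unfolding W_def S_def by measurable
  have ct: "cone_transform \<kappa> I x G = (\<integral>\<^sup>+y. ennreal (W y) * (\<integral>\<^sup>+u. G (S y) (T y u) \<partial>?\<Phi> I) \<partial>?L I)" for G
    by (simp add: cone_transform_def W_def S_def T_def)
  have upd: "(\<Prod>i\<in>?J. \<bar>(y(j := z)) i\<bar> powr (2 * \<kappa> i)) = \<bar>z\<bar> powr (2 * \<kappa> j) * W y"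
    "(\<Sum>i\<in>?J. ((y(j := z)) i)\<^sup>2) = z\<^sup>2 + S y"
    "(\<Sum>i\<in>?J. x i * (y(j := z)) i * (u(j := v)) i) = x j * (z * v) + T y u" for y u z v
    using I by (auto simp: W_def S_def T_def mult.assoc intro!: prod.cong sum.cong)
  have inner: "(\<integral>\<^sup>+u. F a (\<Sum>i\<in>?J. x i * y i * u i) \<partial>?\<Phi> (?J)) =
      (\<integral>\<^sup>+v. \<integral>\<^sup>+u. F a (\<Sum>i\<in>?J. x i * y i * (u(j := v)) i) \<partial>?\<Phi> I \<partial>?P)" for a y
  proof (rule Phi.product_nn_integral_insert_rev[OF I])
    have [measurable]: "(\<lambda>u. \<Sum>i\<in>?J. x i * y i * u i) \<in> borel_measurable (?\<Phi> (?J))"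
      by (intro borel_measurable_sum borel_measurable_times borel_measurable_const measurable_component_Phi_measure)
    show "(\<lambda>u. F a (\<Sum>i\<in>?J. x i * y i * u i)) \<in> borel_measurable (?\<Phi> (?J))"
      by measurable
  qed
  have "cone_transform \<kappa> (?J) x F =
    (\<integral>\<^sup>+z. \<integral>\<^sup>+y. ennreal (\<Prod>i\<in>?J. \<bar>(y(j := z)) i\<bar> powr (2 * \<kappa> i)) *
      (\<integral>\<^sup>+u. F (\<Sum>i\<in>?J. ((y(j := z)) i)\<^sup>2) (\<Sum>i\<in>?J. x i * (y(j := z)) i * u i) \<partial>?\<Phi> (?J))
        \<partial>?L I \<partial>lborel)"
    unfolding cone_transform_def
  proof (rule L.product_nn_integral_insert_rev[OF I])
    interpret \<Phi>J: prob_space "?\<Phi> (?J)" by (intro prob_space_PiM Phi1.prob_space_axioms)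
    have [measurable]: "(\<lambda>w. \<Sum>i\<in>?J. x i * fst w i * snd w i) \<in> borel_measurable (?L (?J) \<Otimes>\<^sub>M ?\<Phi> (?J))"
      by (intro borel_measurable_sum borel_measurable_times borel_measurable_const
          measurable_compose[OF measurable_fst measurable_component_lborel]
          measurable_compose[OF measurable_snd measurable_component_Phi_measure])
    have [measurable]: "(\<lambda>w. \<Sum>i\<in>?J. (fst w i)\<^sup>2) \<in> borel_measurable (?L (?J) \<Otimes>\<^sub>M ?\<Phi> (?J))"
      by (intro borel_measurable_sum borel_measurable_power
          measurable_compose[OF measurable_fst measurable_component_lborel])
    have "(\<lambda>w. F (\<Sum>i\<in>?J. (fst w i)\<^sup>2) (\<Sum>i\<in>?J. x i * fst w i * snd w i))
        \<in> borel_measurable (?L (?J) \<Otimes>\<^sub>M ?\<Phi> (?J))"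
      by measurable
    then have [measurable]: "(\<lambda>y. \<integral>\<^sup>+u. F (\<Sum>i\<in>?J. (y i)\<^sup>2) (\<Sum>i\<in>?J. x i * y i * u i) \<partial>?\<Phi> (?J))
        \<in> borel_measurable (?L (?J))"
      by (intro \<Phi>J.borel_measurable_nn_integral) (simp add: case_prod_beta')
    show "(\<lambda>y. ennreal (\<Prod>i\<in>?J. \<bar>y i\<bar> powr (2 * \<kappa> i)) *
        (\<integral>\<^sup>+u. F (\<Sum>i\<in>?J. (y i)\<^sup>2) (\<Sum>i\<in>?J. x i * y i * u i) \<partial>?\<Phi> (?J)))
        \<in> borel_measurable (?L (?J))"
      by measurable
  qed
  also have "\<dots> = (\<integral>\<^sup>+z. \<integral>\<^sup>+y. ennreal (\<bar>z\<bar> powr (2 * \<kappa> j) * W y) *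
      (\<integral>\<^sup>+v. \<integral>\<^sup>+u. F (z\<^sup>2 + S y) (x j * (z * v) + T y u) \<partial>?\<Phi> I \<partial>?P) \<partial>?L I \<partial>lborel)"
    unfolding inner upd ..
  also have "\<dots> = (\<integral>\<^sup>+z. ennreal (\<bar>z\<bar> powr (2 * \<kappa> j)) *
      (\<integral>\<^sup>+v. \<integral>\<^sup>+y. ennreal (W y) * ?F z v y \<partial>?L I \<partial>?P) \<partial>lborel)"
  proof (rule nn_integral_cong)
    fix z :: real
    define H where "H y v = ?F z v y" for y v
    have "(\<lambda>w. F (z\<^sup>2 + S (fst (fst w))) (x j * (z * snd (fst w)) + T (fst (fst w)) (snd w)))
        \<in> borel_measurable ((?L I \<Otimes>\<^sub>M ?P) \<Otimes>\<^sub>M ?\<Phi> I)"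
    proof -
      have [measurable]: "(\<lambda>w. snd (fst w)) \<in> borel_measurable ((?L I \<Otimes>\<^sub>M ?P) \<Otimes>\<^sub>M ?\<Phi> I)"
        by (rule measurable_compose[OF measurable_fst measurable_compose[OF measurable_snd]])
          (rule measurable_Phi_measure1I, simp)
      have "(\<lambda>w. (fst (fst w), snd w)) \<in> (?L I \<Otimes>\<^sub>M ?P) \<Otimes>\<^sub>M ?\<Phi> I \<rightarrow>\<^sub>M ?L I \<Otimes>\<^sub>M ?\<Phi> I"
        by (intro measurable_Pair measurable_compose[OF measurable_fst measurable_fst] measurable_snd)
      from measurable_compose[OF this T]
      have [measurable]: "(\<lambda>w. T (fst (fst w)) (snd w)) \<in> borel_measurable ((?L I \<Otimes>\<^sub>M ?P) \<Otimes>\<^sub>M ?\<Phi> I)"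
        by simp
      have [measurable]: "(\<lambda>w. S (fst (fst w))) \<in> borel_measurable ((?L I \<Otimes>\<^sub>M ?P) \<Otimes>\<^sub>M ?\<Phi> I)"
        by (rule measurable_compose[OF measurable_compose[OF measurable_fst measurable_fst] S])
      show ?thesis by measurable
    qed
    then have H[measurable]: "(\<lambda>w. H (fst w) (snd w)) \<in> borel_measurable (?L I \<Otimes>\<^sub>M ?P)"
      unfolding H_def by (intro sigma_finite_measure.borel_measurable_nn_integral[OF \<Phi>I]) (simp add: case_prod_beta')
    have W0: "W y \<ge> 0" for y by (simp add: W_def prod_nonneg)
    have Hy: "H y \<in> borel_measurable (?P)" if "y \<in> space (?L I)" for y
      using measurable_compose[OF measurable_Pair1'[OF that] H] by simp
    have "(\<integral>\<^sup>+y. ennreal (\<bar>z\<bar> powr (2 * \<kappa> j) * W y) * (\<integral>\<^sup>+v. H y v \<partial>?P) \<partial>?L I) =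
        (\<integral>\<^sup>+y. ennreal (\<bar>z\<bar> powr (2 * \<kappa> j)) * (ennreal (W y) * (\<integral>\<^sup>+v. H y v \<partial>?P)) \<partial>?L I)"
      using W0 by (simp add: ennreal_mult mult.assoc)
    also have "\<dots> = ennreal (\<bar>z\<bar> powr (2 * \<kappa> j)) * (\<integral>\<^sup>+y. ennreal (W y) * (\<integral>\<^sup>+v. H y v \<partial>?P) \<partial>?L I)"
    proof (rule nn_integral_cmult)
      have [measurable]: "(\<lambda>y. \<integral>\<^sup>+v. H y v \<partial>?P) \<in> borel_measurable (?L I)"
        by (rule Phi1.borel_measurable_nn_integral) (simp add: case_prod_beta' H)
      show "(\<lambda>y. ennreal (W y) * (\<integral>\<^sup>+v. H y v \<partial>?P)) \<in> borel_measurable (?L I)"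
        by measurable
    qed
    also have "(\<integral>\<^sup>+y. ennreal (W y) * (\<integral>\<^sup>+v. H y v \<partial>?P) \<partial>?L I) =
        (\<integral>\<^sup>+y. \<integral>\<^sup>+v. ennreal (W y) * H y v \<partial>?P \<partial>?L I)"
      by (rule nn_integral_cong) (simp add: nn_integral_cmult Hy)
    also have "\<dots> = (\<integral>\<^sup>+v. \<integral>\<^sup>+y. ennreal (W y) * H y v \<partial>?L I \<partial>?P)"
    proof (rule pair_sigma_finite.Fubini'[symmetric])
      show "pair_sigma_finite (?L I) (?P)"
        by (intro pair_sigma_finite.intro LI.sigma_finite_measure_axioms Phi1.sigma_finite_measure_axioms)
      have [measurable]: "(\<lambda>w. W (fst w)) \<in> borel_measurable (?L I \<Otimes>\<^sub>M ?P)"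
        by (rule measurable_compose[OF measurable_fst W])
      show "(\<lambda>(y, v). ennreal (W y) * H y v) \<in> borel_measurable (?L I \<Otimes>\<^sub>M ?P)"
        unfolding case_prod_beta' by measurable
    qed
    finally show "(\<integral>\<^sup>+y. ennreal (\<bar>z\<bar> powr (2 * \<kappa> j) * W y) *
      (\<integral>\<^sup>+v. \<integral>\<^sup>+u. F (z\<^sup>2 + S y) (x j * (z * v) + T y u) \<partial>?\<Phi> I \<partial>?P) \<partial>?L I) =
      ennreal (\<bar>z\<bar> powr (2 * \<kappa> j)) *
      (\<integral>\<^sup>+v. \<integral>\<^sup>+y. ennreal (W y) * ?F z v y \<partial>?L I \<partial>?P)"
      unfolding H_def .
  qed
  finally show ?thesis unfolding ct .
qed

text \<open>
  Each pair \<open>(y\<^sub>i, u\<^sub>i)\<close> becomes a point \<open>X\<^sub>i\<close> of a line with Lebesgue measure and a value \<open>q\<^sub>i\<close> with a power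
  law. Rotating the \<open>X\<^sub>i\<close> brings \<open>\<Sum> x\<^sub>i X\<^sub>i\<close> to \<open>|x| X\<close>, and the squares of the remaining coordinates, together with
  the \<open>q\<^sub>i\<close>, convolve to a single power law. So the transform depends on \<open>x\<close> only through \<open>|x|\<close>.
\<close>

lemma cone_transform_line:
  fixes \<kappa> :: "'i \<Rightarrow> real"
  assumes \<kappa>: "\<And>i. \<kappa> i \<ge> 0" and "finite I" "I \<noteq> {}"
  shows "\<exists>C. \<forall>x F. case_prod F \<in> borel_measurable (borel \<Otimes>\<^sub>M borel) \<longrightarrow>
    cone_transform \<kappa> I x F =
      C * (\<integral>\<^sup>+X. \<integral>\<^sup>+q. F (X\<^sup>2 + q) (sqrt (\<Sum>i\<in>I. (x i)\<^sup>2) * X)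
        \<partial>pow_measure ((\<Sum>i\<in>I. \<kappa> i) + (real (card I) - 1) / 2) \<partial>lborel)"
  using assms(2,3)
proof (induction I rule: finite_ne_induct)
  case (singleton j)
  obtain C where C: "\<forall>F. case_prod F \<in> borel_measurable (borel \<Otimes>\<^sub>M borel) \<longrightarrow>
      (\<integral>\<^sup>+y. ennreal (\<bar>y\<bar> powr (2 * \<kappa> j)) * (\<integral>\<^sup>+u. F (y\<^sup>2) (y * u) \<partial>Phi_measure1 (\<kappa> j)) \<partial>lborel) =
      C * (\<integral>\<^sup>+X. \<integral>\<^sup>+q. F (X\<^sup>2 + q) X \<partial>pow_measure (\<kappa> j) \<partial>lborel)"
    using nn_integral_Phi_measure1_line[OF \<kappa>[of j]] by (rule exE)
  show ?case
  proof (intro exI[of _ C] allI impI)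
    fix x and F :: "real \<Rightarrow> real \<Rightarrow> ennreal"
    assume F[measurable]: "case_prod F \<in> borel_measurable (borel \<Otimes>\<^sub>M borel)"
    have "cone_transform \<kappa> {j} x F = C * (\<integral>\<^sup>+X. \<integral>\<^sup>+q. F (X\<^sup>2 + q) (x j * X) \<partial>pow_measure (\<kappa> j) \<partial>lborel)"
      unfolding cone_transform_singleton[OF \<kappa> F] by (rule C[rule_format]) measurable
    also have "(\<integral>\<^sup>+X. \<integral>\<^sup>+q. F (X\<^sup>2 + q) (x j * X) \<partial>pow_measure (\<kappa> j) \<partial>lborel) =
        (\<integral>\<^sup>+X. \<integral>\<^sup>+q. F (X\<^sup>2 + q) (\<bar>x j\<bar> * X) \<partial>pow_measure (\<kappa> j) \<partial>lborel)"
    proof (cases "x j \<ge> 0")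
      case False
      have "(\<integral>\<^sup>+X. \<integral>\<^sup>+q. F (X\<^sup>2 + q) (x j * X) \<partial>pow_measure (\<kappa> j) \<partial>lborel) =
          ennreal \<bar>-1\<bar> * (\<integral>\<^sup>+X. \<integral>\<^sup>+q. F ((0 + -1 * X)\<^sup>2 + q) (x j * (0 + -1 * X)) \<partial>pow_measure (\<kappa> j) \<partial>lborel)"
        by (rule nn_integral_real_affine) auto
      then show ?thesis using False by simp
    qed simp
    finally show "cone_transform \<kappa> {j} x F =
      C * (\<integral>\<^sup>+X. \<integral>\<^sup>+q. F (X\<^sup>2 + q) (sqrt (\<Sum>i\<in>{j}. (x i)\<^sup>2) * X)
        \<partial>pow_measure ((\<Sum>i\<in>{j}. \<kappa> i) + (real (card {j}) - 1) / 2) \<partial>lborel)"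
      by simp
  qed
next
  case (insert j I)
  \<comment> \<open>Each coordinate contributes its \<open>\<kappa> i\<close>, and each one except
    the first a further \<open>1 / 2\<close>, from the squared coordinate that a rotation splits
    off.\<close>
  define \<beta> where "\<beta> = (\<Sum>i\<in>I. \<kappa> i) + (real (card I) - 1) / 2"
  have "real (card I) \<ge> 1"
    using insert.hyps by (simp add: Suc_leI card_gt_0_iff)
  then have \<beta>: "\<beta> \<ge> 0"
    using \<kappa> by (auto simp: \<beta>_def intro!: add_nonneg_nonneg sum_nonneg)
  obtain C0 where C0: "\<forall>x F. case_prod F \<in> borel_measurable (borel \<Otimes>\<^sub>M borel) \<longrightarrow>
    cone_transform \<kappa> I x F =
      C0 * (\<integral>\<^sup>+X. \<integral>\<^sup>+q. F (X\<^sup>2 + q) (sqrt (\<Sum>i\<in>I. (x i)\<^sup>2) * X) \<partial>pow_measure \<beta> \<partial>lborel)"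
    using insert.IH unfolding \<beta>_def by (rule exE)
  obtain C1 where C1: "\<forall>F. case_prod F \<in> borel_measurable (borel \<Otimes>\<^sub>M borel) \<longrightarrow>
      (\<integral>\<^sup>+y. ennreal (\<bar>y\<bar> powr (2 * \<kappa> j)) * (\<integral>\<^sup>+u. F (y\<^sup>2) (y * u) \<partial>Phi_measure1 (\<kappa> j)) \<partial>lborel) =
      C1 * (\<integral>\<^sup>+X. \<integral>\<^sup>+q. F (X\<^sup>2 + q) X \<partial>pow_measure (\<kappa> j) \<partial>lborel)"
    using nn_integral_Phi_measure1_line[OF \<kappa>[of j]] by (rule exE)
  obtain C2 where C2: "\<forall>f. f \<in> borel_measurable borel \<longrightarrow>
      (\<integral>\<^sup>+p. (\<integral>\<^sup>+q. f (p + q) \<partial>pow_measure \<beta>) \<partial>pow_measure (\<kappa> j)) = C2 * (\<integral>\<^sup>+r. f r \<partial>pow_measure (\<kappa> j + \<beta>))"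
    using nn_integral_pow_measure_convolution[OF \<kappa>[of j] \<beta>] by (rule exE)
  obtain C3 where C3: "\<forall>f. f \<in> borel_measurable borel \<longrightarrow>
      (\<integral>\<^sup>+p. (\<integral>\<^sup>+q. f (p + q) \<partial>pow_measure (\<kappa> j + \<beta>)) \<partial>pow_measure (1 / 2)) =
        C3 * (\<integral>\<^sup>+r. f r \<partial>pow_measure (1 / 2 + (\<kappa> j + \<beta>)))"
    using nn_integral_pow_measure_convolution[OF _ add_nonneg_nonneg[OF \<kappa>[of j] \<beta>], of "1 / 2"] by (auto elim: exE)
  have e: "(\<Sum>i\<in>insert j I. \<kappa> i) + (real (card (insert j I)) - 1) / 2 = 1 / 2 + (\<kappa> j + \<beta>)"
    using insert.hyps by (simp add: \<beta>_def field_simps)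
  show ?case
  proof (intro exI[of _ "C1 * C0 * C2 * C3"] allI impI)
    fix x and F :: "real \<Rightarrow> real \<Rightarrow> ennreal"
    assume F[measurable]: "case_prod F \<in> borel_measurable (borel \<Otimes>\<^sub>M borel)"
    define n where "n = sqrt (\<Sum>i\<in>I. (x i)\<^sup>2)"
    have n: "sqrt (n\<^sup>2 + (x j)\<^sup>2) = sqrt (\<Sum>i\<in>insert j I. (x i)\<^sup>2)"
      using insert.hyps by (simp add: n_def sum_nonneg add.commute)
  let ?E = "\<lambda>X Z p q. F (Z\<^sup>2 + p + (X\<^sup>2 + q)) (x j * Z + n * X)"
  let ?H = "\<lambda>X Z. (\<integral>\<^sup>+r. F (X\<^sup>2 + Z\<^sup>2 + r) (n * X + x j * Z) \<partial>pow_measure (\<kappa> j + \<beta>))"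
  let ?m = "sqrt (n\<^sup>2 + (x j)\<^sup>2)"
    have IH: "cone_transform \<kappa> I x (\<lambda>a b. F (y\<^sup>2 + a) (x j * (y * v) + b)) =
       C0 * (\<integral>\<^sup>+X. \<integral>\<^sup>+q. F (y\<^sup>2 + (X\<^sup>2 + q)) (x j * (y * v) + n * X) \<partial>pow_measure \<beta> \<partial>lborel)" for y v
      unfolding n_def by (rule C0[rule_format]) measurable
    have "cone_transform \<kappa> (insert j I) x F =
      (\<integral>\<^sup>+y. ennreal (\<bar>y\<bar> powr (2 * \<kappa> j)) * (\<integral>\<^sup>+v. C0 *
        (\<integral>\<^sup>+X. \<integral>\<^sup>+q. F (y\<^sup>2 + (X\<^sup>2 + q)) (x j * (y * v) + n * X) \<partial>pow_measure \<beta> \<partial>lborel)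
        \<partial>Phi_measure1 (\<kappa> j)) \<partial>lborel)"
      unfolding cone_transform_insert[OF \<kappa> F insert.hyps(1,3)] IH ..
    also have "\<dots> = C1 * (\<integral>\<^sup>+Z. \<integral>\<^sup>+p. C0 *
        (\<integral>\<^sup>+X. \<integral>\<^sup>+q. ?E X Z p q \<partial>pow_measure \<beta> \<partial>lborel)
        \<partial>pow_measure (\<kappa> j) \<partial>lborel)"
      by (rule C1[rule_format]) measurable
    also have "\<dots> = C1 * C0 * (\<integral>\<^sup>+Z. \<integral>\<^sup>+p. \<integral>\<^sup>+X. \<integral>\<^sup>+q. ?E X Z p q
        \<partial>pow_measure \<beta> \<partial>lborel \<partial>pow_measure (\<kappa> j) \<partial>lborel)"
      by (simp add: nn_integral_cmult mult.assoc)
    \<comment> \<open>Exchanging \<open>p\<close> and \<open>X\<close> brings the two power laws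
      next to each other, so that they convolve.\<close>
    also have "(\<integral>\<^sup>+Z. \<integral>\<^sup>+p. \<integral>\<^sup>+X. \<integral>\<^sup>+q. ?E X Z p q
        \<partial>pow_measure \<beta> \<partial>lborel \<partial>pow_measure (\<kappa> j) \<partial>lborel) =
      (\<integral>\<^sup>+Z. \<integral>\<^sup>+X. \<integral>\<^sup>+p. \<integral>\<^sup>+q. ?E X Z p q
        \<partial>pow_measure \<beta> \<partial>pow_measure (\<kappa> j) \<partial>lborel \<partial>lborel)"
      by (intro nn_integral_cong pair_sigma_finite.Fubini')
        (simp_all add: pair_sigma_finite.intro sigma_finite_pow_measure sigma_finite_lborel)
    also have "\<dots> = (\<integral>\<^sup>+Z. \<integral>\<^sup>+X. C2 * ?H X Z \<partial>lborel \<partial>lborel)"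
    proof (intro nn_integral_cong)
      fix Z X :: real
      show "(\<integral>\<^sup>+p. \<integral>\<^sup>+q. ?E X Z p q \<partial>pow_measure \<beta> \<partial>pow_measure (\<kappa> j)) =
        C2 * ?H X Z"
        by (subst C2[rule_format, symmetric]) (simp_all add: add_ac)
    qed
    also have "\<dots> = C2 * (\<integral>\<^sup>+Z. \<integral>\<^sup>+X. \<integral>\<^sup>+r. F (X\<^sup>2 + Z\<^sup>2 + r) (n * X + x j * Z)
        \<partial>pow_measure (\<kappa> j + \<beta>) \<partial>lborel \<partial>lborel)"
      by (simp add: nn_integral_cmult)
    also have "(\<integral>\<^sup>+Z. \<integral>\<^sup>+X. \<integral>\<^sup>+r. F (X\<^sup>2 + Z\<^sup>2 + r) (n * X + x j * Z) \<partial>pow_measure (\<kappa> j + \<beta>) \<partial>lborel \<partial>lborel) =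
        (\<integral>\<^sup>+X. \<integral>\<^sup>+Z. \<integral>\<^sup>+r. F (X\<^sup>2 + Z\<^sup>2 + r) (n * X + x j * Z) \<partial>pow_measure (\<kappa> j + \<beta>) \<partial>lborel \<partial>lborel)"
      by (rule lborel_pair.Fubini') measurable
    \<comment> \<open>The norm \<open>n\<close> over \<open>I\<close> and the new \<open>x j\<close>
      merge into the norm over \<open>insert j I\<close>. The orthogonal \<open>V\<close> survives
      only through \<open>V\<^sup>2\<close>, hence as a power law of exponent
      \<open>1 / 2\<close>.\<close>
    also have "\<dots> = (\<integral>\<^sup>+U. \<integral>\<^sup>+V. \<integral>\<^sup>+r. F (U\<^sup>2 + V\<^sup>2 + r) (?m * U) \<partial>pow_measure (\<kappa> j + \<beta>) \<partial>lborel \<partial>lborel)"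
      by (rule nn_integral_plane_rotation) measurable
    also have "\<dots> = (\<integral>\<^sup>+U. C3 * (\<integral>\<^sup>+r. F (U\<^sup>2 + r) (?m * U) \<partial>pow_measure (1 / 2 + (\<kappa> j + \<beta>))) \<partial>lborel)"
    proof (rule nn_integral_cong)
      fix U :: real
      have "(\<integral>\<^sup>+V. \<integral>\<^sup>+r. F (U\<^sup>2 + V\<^sup>2 + r) (?m * U) \<partial>pow_measure (\<kappa> j + \<beta>) \<partial>lborel) =
          (\<integral>\<^sup>+p. \<integral>\<^sup>+r. F (U\<^sup>2 + p + r) (?m * U) \<partial>pow_measure (\<kappa> j + \<beta>) \<partial>pow_measure (1 / 2))"
        by (rule nn_integral_square_pow_measure) measurable
      also have "\<dots> = C3 * (\<integral>\<^sup>+r. F (U\<^sup>2 + r) (?m * U) \<partial>pow_measure (1 / 2 + (\<kappa> j + \<beta>)))"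
        by (subst C3[rule_format, symmetric]) (simp_all add: add_ac)
      finally show "(\<integral>\<^sup>+V. \<integral>\<^sup>+r. F (U\<^sup>2 + V\<^sup>2 + r) (?m * U) \<partial>pow_measure (\<kappa> j + \<beta>) \<partial>lborel) = \<dots>" .
    qed
    also have "\<dots> = C3 * (\<integral>\<^sup>+U. \<integral>\<^sup>+r. F (U\<^sup>2 + r) (?m * U) \<partial>pow_measure (1 / 2 + (\<kappa> j + \<beta>)) \<partial>lborel)"
      by (rule nn_integral_cmult) measurable
    finally show "cone_transform \<kappa> (insert j I) x F = C1 * C0 * C2 * C3 *
        (\<integral>\<^sup>+X. \<integral>\<^sup>+q. F (X\<^sup>2 + q) (sqrt (\<Sum>i\<in>insert j I. (x i)\<^sup>2) * X)
        \<partial>pow_measure ((\<Sum>i\<in>insert j I. \<kappa> i) + (real (card (insert j I)) - 1) / 2) \<partial>lborel)"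
      unfolding e n by (simp add: mult.assoc)
  qed
qed

section \<open>The angular integral of the kernel and its independence of the radius
  \<open>t\<close>\<close>

text \<open>The \<open>\<theta>\<close>-integral of the translation after
  \<open>v = cos \<theta>\<close>, with the exponentials moved into \<open>G\<close> and the Bessel
  factor replaced by a constant; \<open>b\<close> stands for the sum of the
  \<open>x $ i * y $ i * u i\<close>.\<close>

definition laguerre_kernel :: "real \<Rightarrow> (real \<Rightarrow> ennreal) \<Rightarrow> real \<Rightarrow> real \<Rightarrow> real \<Rightarrow> ennreal" where
  "laguerre_kernel \<alpha> G t s b =
    (\<integral>\<^sup>+v\<in>{-1..1}. ennreal ((1 - v\<^sup>2) powr (\<alpha> - 1)) * G (t + s + 2 * sqrt ((t * s + b) / 2) * v) \<partial>lborel)"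

lemma measurable_laguerre_kernel [measurable (raw)]:
  assumes [measurable]: "G \<in> borel_measurable borel" "t \<in> borel_measurable M" "s \<in> borel_measurable M" "b \<in> borel_measurable M"
  shows "(\<lambda>x. laguerre_kernel \<alpha> G (t x) (s x) (b x)) \<in> borel_measurable M"
  unfolding laguerre_kernel_def by measurable

text \<open>
  With \<open>s\<^sup>2 = X\<^sup>2 + q\<close>, \<open>A = (s + X) / 2\<close> and \<open>B = (s - X) / 2\<close> the argument of \<open>G\<close> is
  \<open>t + A + B + 2 \<surd>(t A) v\<close>. Writing \<open>P = \<surd>A v\<close> it becomes \<open>(P + \<surd>t)\<^sup>2 + (A - P\<^sup>2) + B\<close>, where \<open>P\<close> carries
  Lebesgue measure, so \<open>t\<close> is removed by a translation.
\<close>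

lemma nn_integral_laguerre_kernel_line:
  assumes G[measurable]: "G \<in> borel_measurable borel" and \<alpha>: "\<alpha> > 0" and t: "t \<ge> 0"
  shows "(\<integral>\<^sup>+X. \<integral>\<^sup>+q. ennreal (1 / sqrt (X\<^sup>2 + q)) * laguerre_kernel \<alpha> G t (sqrt (X\<^sup>2 + q)) (t * X)
      \<partial>pow_measure (\<alpha> + 1 / 2) \<partial>lborel) =
    2 * (\<integral>\<^sup>+B\<in>{0<..}. ennreal (2 * (4 * B) powr (\<alpha> - 1 / 2)) *
      (\<integral>\<^sup>+P. \<integral>\<^sup>+q. G (P\<^sup>2 + q + B) \<partial>pow_measure \<alpha> \<partial>lborel) \<partial>lborel)"
proof -
  let ?G = "\<lambda>B. (\<integral>\<^sup>+P. \<integral>\<^sup>+q. G (P\<^sup>2 + q + B) \<partial>pow_measure \<alpha> \<partial>lborel)"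
  define K where "K s X = laguerre_kernel \<alpha> G t s (t * X)" for s X
  have K[measurable]: "case_prod K \<in> borel_measurable (borel \<Otimes>\<^sub>M borel)"
    unfolding K_def by measurable
  \<comment> \<open>The integrand in the variables \<open>s\<close> and \<open>X\<close>, with
    \<open>q = s\<^sup>2 - X\<^sup>2\<close>: the Jacobian \<open>2 * s\<close> cancels the weight
    \<open>1 / s\<close> and leaves the factor 2.\<close>
  define \<psi> where "\<psi> s X = ennreal (2 * (s\<^sup>2 - X\<^sup>2) powr (\<alpha> - 1 / 2)) * K s X *
      indicator {0<..} (s\<^sup>2 - X\<^sup>2) * indicator {0<..} s" for s X
  have \<psi>[measurable]: "case_prod \<psi> \<in> borel_measurable (borel \<Otimes>\<^sub>M borel)"
    unfolding \<psi>_def by measurable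
  have 1: "(\<integral>\<^sup>+q. ennreal (1 / sqrt (X\<^sup>2 + q)) * K (sqrt (X\<^sup>2 + q)) X \<partial>pow_measure (\<alpha> + 1 / 2)) =
      (\<integral>\<^sup>+s. \<psi> s X \<partial>lborel)" for X
  proof -
    define f where "f a = ennreal ((a - X\<^sup>2) powr (\<alpha> - 1 / 2)) * (ennreal (1 / sqrt a) * K (sqrt a) X) *
        indicator {0<..} (a - X\<^sup>2)" for a
    have [measurable]: "f \<in> borel_measurable borel" unfolding f_def by measurable
    have "(\<integral>\<^sup>+q. ennreal (1 / sqrt (X\<^sup>2 + q)) * K (sqrt (X\<^sup>2 + q)) X \<partial>pow_measure (\<alpha> + 1 / 2)) =
        (\<integral>\<^sup>+q. f (X\<^sup>2 + q) \<partial>lborel)"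
      using \<alpha> by (subst nn_integral_pow_measure) (simp_all add: f_def)
    also have "\<dots> = (\<integral>\<^sup>+a. f a \<partial>lborel)"
      by (rule nn_integral_lborel_translate) measurable
    also have "\<dots> = (\<integral>\<^sup>+a\<in>{0<..}. f a \<partial>lborel)"
    proof (rule nn_integral_cong)
      fix a :: real
      have "a > 0" if "a - X\<^sup>2 > 0" using that zero_le_power2[of X] by linarith
      then show "f a = f a * indicator {0<..} a"
        by (auto simp: f_def split: split_indicator)
    qed
    also have "\<dots> = (\<integral>\<^sup>+s\<in>{0<..}. ennreal (2 * s) * f (s\<^sup>2) \<partial>lborel)"
      by (rule nn_integral_pos_square) measurable
    also have "\<dots> = (\<integral>\<^sup>+s. \<psi> s X \<partial>lborel)"
    proof (rule nn_integral_cong)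
      fix s :: real
      show "ennreal (2 * s) * f (s\<^sup>2) * indicator {0<..} s = \<psi> s X"
      proof (cases "s > 0")
        case True
        have "ennreal (2 * s) * (ennreal ((s\<^sup>2 - X\<^sup>2) powr (\<alpha> - 1 / 2)) * ennreal (1 / s)) =
            ennreal (2 * (s\<^sup>2 - X\<^sup>2) powr (\<alpha> - 1 / 2))"
          using True by (simp add: ennreal_mult[symmetric])
        then have "ennreal (2 * s) * (ennreal ((s\<^sup>2 - X\<^sup>2) powr (\<alpha> - 1 / 2)) * ennreal (1 / s)) *
            (K s X * indicator {0<..} (s\<^sup>2 - X\<^sup>2)) =
            ennreal (2 * (s\<^sup>2 - X\<^sup>2) powr (\<alpha> - 1 / 2)) * (K s X * indicator {0<..} (s\<^sup>2 - X\<^sup>2))"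
          by (rule arg_cong)
        then show ?thesis using True by (simp add: f_def \<psi>_def mult.assoc)
      qed (simp add: \<psi>_def)
    qed
    finally show ?thesis .
  qed
  have "(\<integral>\<^sup>+X. \<integral>\<^sup>+q. ennreal (1 / sqrt (X\<^sup>2 + q)) * K (sqrt (X\<^sup>2 + q)) X
      \<partial>pow_measure (\<alpha> + 1 / 2) \<partial>lborel) = (\<integral>\<^sup>+X. \<integral>\<^sup>+s. \<psi> s X \<partial>lborel \<partial>lborel)"
    unfolding 1 ..
  also have "\<dots> = (\<integral>\<^sup>+X. ennreal \<bar>2\<bar> * (\<integral>\<^sup>+B. \<psi> (X + 2 * B) X \<partial>lborel) \<partial>lborel)"
    by (intro nn_integral_cong nn_integral_real_affine) measurable
  also have "\<dots> = 2 * (\<integral>\<^sup>+X. \<integral>\<^sup>+B. \<psi> (X + 2 * B) X \<partial>lborel \<partial>lborel)"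
    by (subst nn_integral_cmult) auto
  also have "(\<integral>\<^sup>+X. \<integral>\<^sup>+B. \<psi> (X + 2 * B) X \<partial>lborel \<partial>lborel) = (\<integral>\<^sup>+B. \<integral>\<^sup>+X. \<psi> (X + 2 * B) X \<partial>lborel \<partial>lborel)"
    by (rule lborel_pair.Fubini') measurable
  also have "\<dots> = (\<integral>\<^sup>+B. ennreal (2 * (4 * B) powr (\<alpha> - 1 / 2)) *
      ?G B * indicator {0<..} B \<partial>lborel)"
  proof (rule nn_integral_cong)
    fix B :: real
    have "(\<integral>\<^sup>+X. \<psi> (X + 2 * B) X \<partial>lborel) = (\<integral>\<^sup>+A. \<psi> (- B + A + 2 * B) (- B + A) \<partial>lborel)"
      by (rule nn_integral_lborel_translate[symmetric]) measurable
    also have "\<dots> = (\<integral>\<^sup>+A. ennreal (2 * (4 * A * B) powr (\<alpha> - 1 / 2)) * K (A + B) (A - B) * indicator {0<..} B * indicator {0<..} A \<partial>lborel)"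
    proof (rule nn_integral_cong)
      fix A :: real
      \<comment> \<open>Since \<open>s = A + B\<close> and \<open>X = A - B\<close>, the power of
        \<open>s\<^sup>2 - X\<^sup>2\<close> factors into powers of \<open>A\<close> and
        \<open>B\<close>, and the domain becomes a quadrant.\<close>
      have "(A + B)\<^sup>2 - (A - B)\<^sup>2 = 4 * A * B"
        by (simp add: power2_eq_square algebra_simps)
      moreover have "0 < 4 * A * B \<and> 0 < A + B \<longleftrightarrow> 0 < A \<and> 0 < B"
        by (auto simp: zero_less_mult_iff)
      then have "indicator {0<..} (4 * A * B) * indicator {0<..} (A + B) = (indicator {0<..} B * indicator {0<..} A :: ennreal)"
        by (auto split: split_indicator)
      moreover have "- B + A + 2 * B = A + B" "- B + A = A - B" by auto
      ultimately show "\<psi> (- B + A + 2 * B) (- B + A) =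
        ennreal (2 * (4 * A * B) powr (\<alpha> - 1 / 2)) * K (A + B) (A - B) * indicator {0<..} B * indicator {0<..} A"
        by (simp only: \<psi>_def mult.assoc)
    qed
    also have "\<dots> = ennreal (2 * (4 * B) powr (\<alpha> - 1 / 2)) *
      ?G B * indicator {0<..} B"
    proof (cases "B > 0")
      case B: True
      define c where "c = 2 * (4 * B) powr (\<alpha> - 1 / 2)"
      define F where "F a b = G (t + a + B + 2 * sqrt t * b)" for a b
      have F[measurable]: "case_prod F \<in> borel_measurable (borel \<Otimes>\<^sub>M borel)"
        unfolding F_def by measurable
      have "(\<integral>\<^sup>+A. ennreal (2 * (4 * A * B) powr (\<alpha> - 1 / 2)) * K (A + B) (A - B) * indicator {0<..} B * indicator {0<..} A \<partial>lborel) =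
          (\<integral>\<^sup>+y\<in>{0<..}. ennreal (2 * y) * (ennreal (2 * (4 * y\<^sup>2 * B) powr (\<alpha> - 1 / 2)) * K (y\<^sup>2 + B) (y\<^sup>2 - B) * indicator {0<..} B) \<partial>lborel)"
        by (rule nn_integral_pos_square) measurable
      \<comment> \<open>With \<open>A = y\<^sup>2\<close>, the power \<open>\<alpha> - 1 / 2\<close>
        of \<open>A\<close> and the Jacobian combine to \<open>2 * y powr (2 * \<alpha>)\<close>.
        Together with \<open>(1 - v\<^sup>2) powr (\<alpha> - 1)\<close> this is the weight of
        \<open>nn_integral_half_disc\<close> for \<open>k = \<alpha>\<close>.\<close>
      also have "\<dots> = (\<integral>\<^sup>+y. ennreal c * (ennreal (2 * y powr (2 * \<alpha>)) *
          (\<integral>\<^sup>+v\<in>{-1..1}. ennreal ((1 - v\<^sup>2) powr (\<alpha> - 1)) * F (y\<^sup>2) (y * v) \<partial>lborel) * indicator {0<..} y) \<partial>lborel)"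
      proof (rule nn_integral_cong)
        fix y :: real
        show "ennreal (2 * y) * (ennreal (2 * (4 * y\<^sup>2 * B) powr (\<alpha> - 1 / 2)) * K (y\<^sup>2 + B) (y\<^sup>2 - B) * indicator {0<..} B) * indicator {0<..} y =
          ennreal c * (ennreal (2 * y powr (2 * \<alpha>)) *
          (\<integral>\<^sup>+v\<in>{-1..1}. ennreal ((1 - v\<^sup>2) powr (\<alpha> - 1)) * F (y\<^sup>2) (y * v) \<partial>lborel) * indicator {0<..} y)"
        proof (cases "y > 0")
          case True
          \<comment> \<open>The radicand \<open>(t * s + t * X) / 2\<close> equals
            \<open>t * A\<close>, so \<open>B\<close> drops out of \<open>\<rho>\<close>.\<close>
          have "(t * (y\<^sup>2 + B) + t * (y\<^sup>2 - B)) / 2 = t * y\<^sup>2" by (simp add: algebra_simps)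
          then have "sqrt ((t * (y\<^sup>2 + B) + t * (y\<^sup>2 - B)) / 2) = sqrt t * y"
            using True t by (simp add: real_sqrt_mult)
          then have KF: "K (y\<^sup>2 + B) (y\<^sup>2 - B) = (\<integral>\<^sup>+v\<in>{-1..1}. ennreal ((1 - v\<^sup>2) powr (\<alpha> - 1)) * F (y\<^sup>2) (y * v) \<partial>lborel)"
            unfolding K_def laguerre_kernel_def F_def by (simp add: mult_ac add_ac)
          have "(4 * y\<^sup>2 * B) powr (\<alpha> - 1 / 2) = ((4 * B) * y powr 2) powr (\<alpha> - 1 / 2)"
            using True by (simp add: mult_ac)
          also have "\<dots> = (4 * B) powr (\<alpha> - 1 / 2) * y powr (2 * (\<alpha> - 1 / 2))"
            using True B by (simp only: powr_mult powr_powr)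
          finally have "2 * y * (2 * (4 * y\<^sup>2 * B) powr (\<alpha> - 1 / 2)) = c * (2 * (y powr (2 * (\<alpha> - 1 / 2)) * y powr 1))"
            using True by (simp add: c_def)
          also have "y powr (2 * (\<alpha> - 1 / 2)) * y powr 1 = y powr (2 * \<alpha>)"
            by (simp only: powr_add[symmetric]) (simp add: algebra_simps)
          finally have "ennreal (2 * y) * ennreal (2 * (4 * y\<^sup>2 * B) powr (\<alpha> - 1 / 2)) = ennreal c * ennreal (2 * y powr (2 * \<alpha>))"
            using True B by (simp add: ennreal_mult[symmetric] c_def)
          then show ?thesis
            using True B unfolding KF by (simp add: mult.assoc[symmetric])
        qed simp
      qed
      also have "\<dots> = ennreal c * (\<integral>\<^sup>+y. ennreal (2 * y powr (2 * \<alpha>)) *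
          (\<integral>\<^sup>+v\<in>{-1..1}. ennreal ((1 - v\<^sup>2) powr (\<alpha> - 1)) * F (y\<^sup>2) (y * v) \<partial>lborel) * indicator {0<..} y \<partial>lborel)"
        by (rule nn_integral_cmult) measurable
      also have "\<dots> = ennreal c * (\<integral>\<^sup>+X. \<integral>\<^sup>+q. F (X\<^sup>2 + q) X \<partial>pow_measure \<alpha> \<partial>lborel)"
        by (simp only: nn_integral_half_disc[OF F \<alpha>])
      also have "(\<integral>\<^sup>+X. \<integral>\<^sup>+q. F (X\<^sup>2 + q) X \<partial>pow_measure \<alpha> \<partial>lborel) =
          (\<integral>\<^sup>+X. \<integral>\<^sup>+q. G ((sqrt t + X)\<^sup>2 + q + B) \<partial>pow_measure \<alpha> \<partial>lborel)"
      proof (intro nn_integral_cong)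
        fix X q :: real
        have "t + (X\<^sup>2 + q) + B + 2 * sqrt t * X = (sqrt t + X)\<^sup>2 + q + B"
          using t by (simp add: power2_sum)
        then show "F (X\<^sup>2 + q) X = G ((sqrt t + X)\<^sup>2 + q + B)" by (simp only: F_def)
      qed
      also have "\<dots> = ?G B"
        by (rule nn_integral_lborel_translate) measurable
      finally show ?thesis using B by (simp add: c_def)
    qed simp
    finally show "(\<integral>\<^sup>+X. \<psi> (X + 2 * B) X \<partial>lborel) = ennreal (2 * (4 * B) powr (\<alpha> - 1 / 2)) *
      ?G B * indicator {0<..} B" .
  qed
  finally show ?thesis unfolding K_def .
qed

section \<open>Polar coordinates and the conic measure\<close>

lemma nn_integral_sphere_measure:
  fixes f :: "real ^ 'n::finite \<Rightarrow> ennreal"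
  assumes [measurable]: "f \<in> borel_measurable borel"
  shows "(\<integral>\<^sup>+\<xi>. f \<xi> \<partial>sphere_measure) =
    of_nat CARD('n) * (\<integral>\<^sup>+y\<in>ball 0 1 - {0}. f (y /\<^sub>R norm y) \<partial>lborel)"
proof -
  have f: "f \<in> borel_measurable (restrict_space borel (sphere 0 1))"
    by (rule measurable_restrict_space1) measurable
  have g: "(\<lambda>y. f (y /\<^sub>R norm y)) \<in> borel_measurable (restrict_space lborel (ball 0 1 - {0}))"
    by (rule measurable_restrict_space1) measurable
  show ?thesis
    unfolding sphere_measure_def using f g
    by (subst nn_integral_scale_measure)
      (simp_all add: nn_integral_distr measurable_sphere_projection nn_integral_restrict_space)
qed

lemma nn_integral_lborel_scale:
  fixes f :: "real ^ 'n::finite \<Rightarrow> ennreal"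
  assumes [measurable]: "f \<in> borel_measurable borel" and r: "r > 0"
  shows "(\<integral>\<^sup>+y. f y \<partial>lborel) = ennreal (r ^ CARD('n)) * (\<integral>\<^sup>+y. f (r *\<^sub>R y) \<partial>lborel)"
  using r by (subst lborel_affine[of r 0])
    (simp_all add: nn_integral_density nn_integral_distr nn_integral_cmult)

text \<open>The radial integral remaining in \<open>nn_integral_polar\<close>; its factor
  \<open>1 / d\<close> cancels the factor \<open>d\<close> in \<open>sphere_measure\<close>.\<close>

lemma nn_integral_inverse_power_tail:
  assumes "a > 0" "d > 0"
  shows "(\<integral>\<^sup>+r\<in>{a<..}. ennreal (1 / r ^ Suc d) \<partial>lborel) = ennreal (1 / (real d * a ^ d))"
proof -
  have "(\<integral>\<^sup>+r\<in>{a<..}. ennreal (1 / r ^ Suc d) \<partial>lborel) = (\<integral>\<^sup>+r\<in>{a..}. ennreal (1 / r ^ Suc d) \<partial>lborel)"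
    by (rule nn_integral_cong_AE, use AE_lborel_singleton[of a] in eventually_elim)
      (auto split: split_indicator)
  also have "\<dots> = ennreal (0 - - 1 / (real d * a ^ d))"
  proof (rule nn_integral_FTC_atLeast)
    show "(\<lambda>r::real. 1 / r ^ Suc d) \<in> borel_measurable borel" by measurable
    fix r assume r: "a \<le> r"
    then have "r > 0" using assms by simp
    then show "((\<lambda>r. - 1 / (real d * r ^ d)) has_real_derivative 1 / r ^ Suc d) (at r)"
    proof -
      obtain n where n: "d = Suc n" using assms by (cases d) auto
      have "((\<lambda>r. r ^ d) has_real_derivative real d * r ^ n) (at r)"
        using DERIV_pow[of d r] by (simp add: n)
      then have "((\<lambda>r. inverse (r ^ d)) has_real_derivative - (inverse (r ^ d) * (real d * r ^ n) * inverse (r ^ d))) (at r)"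
        by (rule DERIV_inverse') (use \<open>r > 0\<close> in simp)
      from DERIV_cmult[OF this, of "- 1 / real d"]
      show ?thesis
        by (rule back_subst[of "\<lambda>F. DERIV F r :> _", OF back_subst[of "\<lambda>D. DERIV _ r :> D"]])
          (use \<open>r > 0\<close> assms in \<open>simp_all add: n divide_inverse fun_eq_iff del: of_nat_Suc\<close>)
    qed
    show "0 \<le> 1 / r ^ Suc d" using \<open>r > 0\<close> by simp
  next
    have "((\<lambda>r. - 1 / real d * inverse (r ^ d)) \<longlongrightarrow> - 1 / real d * 0) at_top"
      using assms by (intro tendsto_intros tendsto_inverse_0_at_top filterlim_pow_at_top filterlim_ident) auto
    then show "((\<lambda>r. - 1 / (real d * r ^ d)) \<longlongrightarrow> 0) at_top"
      by (simp add: divide_inverse)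
  qed
  finally show ?thesis by simp
qed

text \<open>The surface measure is defined by volumes of cones in the unit ball, so the spherical
  integral is an integral over \<open>y\<close> in that ball. Putting \<open>t = norm y * r\<close>
  and then \<open>v = r *\<^sub>R y\<close> turns the condition \<open>norm y < 1\<close> into
  \<open>norm v < r\<close>. The tail integral in \<open>r\<close> then yields
  \<open>1 / (d * norm v ^ d)\<close>, which cancels all other factors.\<close>

lemma nn_integral_polar:
  fixes f :: "real ^ 'n::finite \<Rightarrow> ennreal"
  assumes [measurable]: "f \<in> borel_measurable borel"
  shows "(\<integral>\<^sup>+t\<in>{0..}. (ennreal (t ^ (CARD('n) - 1)) * (\<integral>\<^sup>+\<xi>. f (t *\<^sub>R \<xi>) \<partial>sphere_measure)) \<partial>lborel) =
    (\<integral>\<^sup>+y. f y \<partial>lborel)"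
proof -
  let ?d = "CARD('n)"
  have d: "?d > 0" by simp
  have dS: "Suc (?d - 1) = ?d" using d by simp
  define B where "B y = (indicator (ball 0 1 - {0}) y :: ennreal)" for y :: "real ^ 'n"
  have [measurable]: "B \<in> borel_measurable borel"
    unfolding B_def[abs_def] by (rule borel_measurable_indicator) auto
  \<comment> \<open>The integrand in its three coordinate systems: \<open>?a\<close> in
    \<open>t, y\<close>, \<open>?b\<close> after \<open>t = norm y * r\<close>, and
    \<open>?c\<close> after \<open>v = r *\<^sub>R y\<close>, without the Jacobian
    \<open>r ^ d\<close>.\<close>
  let ?a = "\<lambda>t y. ennreal (t ^ (?d - 1)) * f (t *\<^sub>R (y /\<^sub>R norm y)) * B y * indicator {0<..} t"
  let ?b = "\<lambda>r y. ennreal (norm y ^ ?d * r ^ (?d - 1)) * f (r *\<^sub>R y) * B y * indicator {0<..} r"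
  let ?c = "\<lambda>r v. (ennreal (1 / r ^ Suc ?d) * indicator {norm v<..} r) * (ennreal (norm v ^ ?d) * f v) * indicator (- {0}) v"
  have "(\<integral>\<^sup>+t\<in>{0..}. (ennreal (t ^ (?d - 1)) * (\<integral>\<^sup>+\<xi>. f (t *\<^sub>R \<xi>) \<partial>sphere_measure)) \<partial>lborel) =
      (\<integral>\<^sup>+t. of_nat ?d * (\<integral>\<^sup>+y. ?a t y \<partial>lborel) \<partial>lborel)"
  proof (rule nn_integral_cong_AE, use AE_lborel_singleton[of 0] in eventually_elim)
    fix t :: real assume t: "t \<noteq> 0"
    have "(\<integral>\<^sup>+y. ?a t y \<partial>lborel) =
        (\<integral>\<^sup>+y. (ennreal (t ^ (?d - 1)) * indicator {0<..} t) * (f (t *\<^sub>R (y /\<^sub>R norm y)) * B y) \<partial>lborel)"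
      by (simp add: mult_ac)
    also have "\<dots> = (ennreal (t ^ (?d - 1)) * indicator {0<..} t) * (\<integral>\<^sup>+y. f (t *\<^sub>R (y /\<^sub>R norm y)) * B y \<partial>lborel)"
      by (rule nn_integral_cmult) measurable
    moreover have "(\<integral>\<^sup>+\<xi>. f (t *\<^sub>R \<xi>) \<partial>sphere_measure) = of_nat ?d * (\<integral>\<^sup>+y. f (t *\<^sub>R (y /\<^sub>R norm y)) * B y \<partial>lborel)"
      unfolding B_def by (rule nn_integral_sphere_measure) measurable
    moreover have "indicator {0..} t = (indicator {0<..} t :: ennreal)"
      using t by (auto split: split_indicator)
    ultimately show "ennreal (t ^ (?d - 1)) * (\<integral>\<^sup>+\<xi>. f (t *\<^sub>R \<xi>) \<partial>sphere_measure) * indicator {0..} t =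
        of_nat ?d * (\<integral>\<^sup>+y. ?a t y \<partial>lborel)"
      by (simp add: mult_ac)
  qed
  also have "\<dots> = of_nat ?d * (\<integral>\<^sup>+t. \<integral>\<^sup>+y. ?a t y \<partial>lborel \<partial>lborel)"
    by (rule nn_integral_cmult) measurable
  also have "(\<integral>\<^sup>+t. \<integral>\<^sup>+y. ?a t y \<partial>lborel \<partial>lborel) =
      (\<integral>\<^sup>+y. \<integral>\<^sup>+t. ?a t y \<partial>lborel \<partial>lborel)"
    by (rule lborel_pair.Fubini') measurable
  also have "\<dots> = (\<integral>\<^sup>+y. \<integral>\<^sup>+r. ?b r y \<partial>lborel \<partial>lborel)"
  proof (rule nn_integral_cong)
    fix y :: "real ^ 'n"
    show "(\<integral>\<^sup>+t. ?a t y \<partial>lborel) =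
        (\<integral>\<^sup>+r. ?b r y \<partial>lborel)"
    proof (cases "y = 0")
      case False
      have "(\<integral>\<^sup>+t. ?a t y \<partial>lborel) =
         ennreal \<bar>norm y\<bar> * (\<integral>\<^sup>+r. ?a (0 + norm y * r) y \<partial>lborel)"
        by (rule nn_integral_real_affine) (use False in auto)
      also have "\<dots> = (\<integral>\<^sup>+r. ennreal \<bar>norm y\<bar> * (?a (0 + norm y * r) y) \<partial>lborel)"
        by (rule nn_integral_cmult[symmetric]) measurable
      also have "\<dots> = (\<integral>\<^sup>+r. ?b r y \<partial>lborel)"
      proof (rule nn_integral_cong)
        fix r :: real
        show "ennreal \<bar>norm y\<bar> * (?a (0 + norm y * r) y) =
          ?b r y"
        proof (cases "r > 0")
          case True
          have "norm y * (norm y * r) ^ (?d - 1) = norm y ^ Suc (?d - 1) * r ^ (?d - 1)"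
            by (simp only: power_mult_distrib power_Suc mult.assoc)
          then have "ennreal (norm y) * ennreal ((norm y * r) ^ (?d - 1)) = ennreal (norm y ^ ?d * r ^ (?d - 1))"
            using True unfolding dS by (simp add: ennreal_mult[symmetric])
          moreover have "(norm y * r) *\<^sub>R (y /\<^sub>R norm y) = r *\<^sub>R y" using False by (simp add: field_simps)
          ultimately show ?thesis unfolding add_0 using True False by (simp only: mult.assoc[symmetric]) simp
        next
          case r: False
          then have "\<not> 0 < norm y * r" using False by (simp add: zero_less_mult_iff)
          then show ?thesis using r by simp
        qed
      qed
      finally show ?thesis .
    qed (simp add: B_def)
  qed
  also have "\<dots> = (\<integral>\<^sup>+r. \<integral>\<^sup>+y. ?b r y \<partial>lborel \<partial>lborel)"
    by (rule lborel_pair.Fubini') measurable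
  also have "\<dots> = (\<integral>\<^sup>+r. \<integral>\<^sup>+v. ?c r v \<partial>lborel \<partial>lborel)"
  proof (rule nn_integral_cong)
    fix r :: real
    show "(\<integral>\<^sup>+y. ?b r y \<partial>lborel) =
      (\<integral>\<^sup>+v. ?c r v \<partial>lborel)"
    proof (cases "r > 0")
      case True
      have "(\<integral>\<^sup>+v. ?c r v \<partial>lborel) =
         ennreal (r ^ ?d) * (\<integral>\<^sup>+y. ?c r (r *\<^sub>R y) \<partial>lborel)"
        by (rule nn_integral_lborel_scale) (use True in \<open>auto simp: indicator_def\<close>)
      also have "\<dots> = (\<integral>\<^sup>+y. ennreal (r ^ ?d) * (?c r (r *\<^sub>R y)) \<partial>lborel)"
        by (rule nn_integral_cmult[symmetric]) (auto simp: indicator_def)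
      also have "\<dots> = (\<integral>\<^sup>+y. ?b r y \<partial>lborel)"
      proof (rule nn_integral_cong)
        fix y :: "real ^ 'n"
        have rd: "r ^ ?d = r * r ^ (?d - 1)" using power_Suc[of r "?d - 1"] unfolding dS .
        have "r ^ ?d * (1 / r ^ Suc ?d * norm (r *\<^sub>R y) ^ ?d) = norm y ^ ?d * r ^ (?d - 1)"
          using True by (simp add: power_mult_distrib rd)
        then have "ennreal (r ^ ?d) * (ennreal (1 / r ^ Suc ?d) * ennreal (norm (r *\<^sub>R y) ^ ?d)) = ennreal (norm y ^ ?d * r ^ (?d - 1))"
          using True by (simp add: ennreal_mult[symmetric] del: norm_scaleR power_Suc)
        moreover have "indicator {norm (r *\<^sub>R y)<..} r * indicator (- {0}) (r *\<^sub>R y) = B y"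
          using True by (auto split: split_indicator simp: B_def mult_less_cancel_left1)
        moreover have assoc: "a * ((b * i) * (n * g) * j) = (a * (b * n)) * g * (i * j)" for a b i n g j :: ennreal
          by (simp add: mult_ac)
        ultimately show "ennreal (r ^ ?d) * (?c r (r *\<^sub>R y)) =
          ?b r y"
          using True by (simp only: assoc) simp
      qed
      finally show ?thesis by (rule sym)
    next
      case False
      then have "indicator {norm v<..} r = (0 :: ennreal)" for v :: "real ^ 'n"
        using norm_ge_zero[of v] by (auto split: split_indicator simp del: norm_ge_zero)
      then show ?thesis using False by simp
    qed
  qed
  also have "\<dots> = (\<integral>\<^sup>+v. \<integral>\<^sup>+r. ?c r v \<partial>lborel \<partial>lborel)"
    by (rule lborel_pair.Fubini') (auto simp: indicator_def case_prod_beta')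
  also have "of_nat ?d * \<dots> = (\<integral>\<^sup>+v. of_nat ?d * (\<integral>\<^sup>+r. ?c r v \<partial>lborel) \<partial>lborel)"
    by (rule nn_integral_cmult[symmetric]) (auto simp: indicator_def)
  also have "\<dots> = (\<integral>\<^sup>+v. f v \<partial>lborel)"
  proof (rule nn_integral_cong_AE, use AE_lborel_singleton[of 0] in eventually_elim)
    fix v :: "real ^ 'n" assume v: "v \<noteq> 0"
    have "(\<integral>\<^sup>+r. ?c r v \<partial>lborel) =
        (\<integral>\<^sup>+r. (ennreal (norm v ^ ?d) * f v) * (ennreal (1 / r ^ Suc ?d) * indicator {norm v<..} r) \<partial>lborel)"
      using v by (simp add: mult_ac del: power_Suc)
    also have "\<dots> = (ennreal (norm v ^ ?d) * f v) * (\<integral>\<^sup>+r\<in>{norm v<..}. ennreal (1 / r ^ Suc ?d) \<partial>lborel)"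
      by (rule nn_integral_cmult) measurable
    also have "\<dots> = (ennreal (norm v ^ ?d) * f v) * ennreal (1 / (real ?d * norm v ^ ?d))"
      using v by (subst nn_integral_inverse_power_tail) auto
    finally have "of_nat ?d * (\<integral>\<^sup>+r. ?c r v \<partial>lborel) =
       ennreal (real ?d) * ennreal (norm v ^ ?d) * ennreal (1 / (real ?d * norm v ^ ?d)) * f v"
      by (simp add: ennreal_of_nat_eq_real_of_nat mult_ac)
    also have "ennreal (real ?d) * ennreal (norm v ^ ?d) * ennreal (1 / (real ?d * norm v ^ ?d)) = 1"
      using v by (simp add: ennreal_mult[symmetric])
    finally show "of_nat ?d * (\<integral>\<^sup>+r. ?c r v \<partial>lborel) = f v"
      by simp
  qed
  finally show ?thesis .
qed

section \<open>The conic measure as Lebesgue measure on the graph of the norm\<close>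

lemma measurable_conic_graph:
  "(\<lambda>y. (y, norm y)) \<in> lborel \<rightarrow>\<^sub>M restrict_space borel (conic_surface :: ((real ^ 'n::finite) \<times> real) set)"
  by (rule measurable_restrict_space2) (auto simp: conic_surface_def)

lemma conic_surface_borel [measurable]: "conic_surface \<in> sets borel"
proof -
  have "conic_surface = {z :: (real ^ 'n) \<times> real. 0 \<le> snd z \<and> norm (fst z) = snd z}"
    by (auto simp: conic_surface_def)
  also have "\<dots> \<in> sets borel"
    by (intro borel_closed closed_Collect_conj closed_Collect_le closed_Collect_eq continuous_intros)
  finally show ?thesis .
qed

text \<open>On the cone the last coordinate is the norm of the others, and the density
  \<open>t ^ (d - 1)\<close> is that of Lebesgue measure in polar coordinates. In this normalization
  there is no factor \<open>sqrt 2\<close> as in Euclidean surface area.\<close>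

lemma conic_measure_eq_distr:
  "conic_measure = distr lborel (restrict_space borel (conic_surface :: ((real ^ 'n::finite) \<times> real) set)) (\<lambda>y. (y, norm y))"
proof (rule measure_eqI)
  fix A :: "((real ^ 'n) \<times> real) set" assume A: "A \<in> sets conic_measure"
  then have A': "A \<in> sets borel"
    by (auto simp: sets_conic_measure sets_restrict_space)
  then have [measurable]: "A \<in> sets (borel \<Otimes>\<^sub>M borel)" by (subst borel_prod)
  have "emeasure conic_measure A = (\<integral>\<^sup>+z. indicator A z \<partial>conic_measure)"
    using A by simp
  also have "\<dots> = (\<integral>\<^sup>+t\<in>{0..}. (ennreal (t ^ (CARD('n) - 1)) *
        (\<integral>\<^sup>+\<xi>. indicator A (t *\<^sub>R \<xi>, t) \<partial>sphere_measure)) \<partial>lborel)"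
    by (rule nn_integral_conic_measure) (use A in measurable)
  also have "\<dots> = (\<integral>\<^sup>+t\<in>{0..}. (ennreal (t ^ (CARD('n) - 1)) *
        (\<integral>\<^sup>+\<xi>. indicator A (t *\<^sub>R \<xi>, norm (t *\<^sub>R \<xi>)) \<partial>sphere_measure)) \<partial>lborel)"
  proof (rule nn_integral_cong)
    fix t :: real
    have "(\<integral>\<^sup>+\<xi>. indicator A (t *\<^sub>R \<xi>, t) \<partial>sphere_measure) =
        (\<integral>\<^sup>+\<xi>. indicator A (t *\<^sub>R \<xi>, norm (t *\<^sub>R \<xi>)) \<partial>sphere_measure)" if "t \<ge> 0"
      by (rule nn_integral_cong) (use that in simp)
    then show "ennreal (t ^ (CARD('n) - 1)) * (\<integral>\<^sup>+\<xi>. indicator A (t *\<^sub>R \<xi>, t) \<partial>sphere_measure) * indicator {0..} t =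
       ennreal (t ^ (CARD('n) - 1)) * (\<integral>\<^sup>+\<xi>. indicator A (t *\<^sub>R \<xi>, norm (t *\<^sub>R \<xi>)) \<partial>sphere_measure) * indicator {0..} t"
      by (cases "t \<ge> 0") simp_all
  qed
  also have "\<dots> = (\<integral>\<^sup>+y. indicator A (y, norm y) \<partial>lborel)"
    by (rule nn_integral_polar) measurable
  also have "\<dots> = emeasure (distr lborel (restrict_space borel (conic_surface :: ((real ^ 'n) \<times> real) set)) (\<lambda>y. (y, norm y))) A"
  proof -
    have A2: "A \<in> sets (restrict_space borel conic_surface)"
      using A by (simp add: sets_conic_measure)
    let ?V = "(\<lambda>y. (y, norm y)) -` A \<inter> space (lborel :: (real ^ 'n) measure)"
    have "(\<integral>\<^sup>+y. indicator A (y, norm y) \<partial>lborel) = (\<integral>\<^sup>+y. indicator ?V y \<partial>lborel)"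
      by (rule nn_integral_cong) (auto split: split_indicator)
    also have "\<dots> = emeasure lborel ?V"
      by (rule nn_integral_indicator) (rule measurable_sets[OF measurable_conic_graph A2])
    finally show ?thesis
      using A2 by (simp only: emeasure_distr[OF measurable_conic_graph])
  qed
  finally show "emeasure conic_measure A = \<dots>" .
qed (simp add: sets_conic_measure)

lemma nn_integral_conic_measure_lborel:
  assumes "f \<in> borel_measurable conic_measure"
  shows "(\<integral>\<^sup>+z. f z \<partial>conic_measure) = (\<integral>\<^sup>+y. f (y, norm y) \<partial>lborel)"
  using assms unfolding conic_measure_eq_distr
  by (subst nn_integral_distr[OF measurable_conic_graph]) auto

lemma AE_conic_measure_nonzero:
  "AE z in (conic_measure :: ((real ^ 'n::finite) \<times> real) measure). \<forall>i. fst z $ i \<noteq> 0"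
proof -
  have "AE y in lborel. \<forall>i\<in>UNIV. (y :: real ^ 'n) $ i \<noteq> 0"
  proof (rule AE_finite_allI)
    fix i :: 'n
    show "AE y in lborel. (y :: real ^ 'n) $ i \<noteq> 0"
      using AE_lborel_inner_neq[of "axis i (1::real)" 0] by (simp add: inner_axis axis_in_Basis_iff)
  qed simp
  moreover have "{z \<in> space (restrict_space borel conic_surface). \<forall>i. fst z $ i \<noteq> 0} \<in> sets (restrict_space borel (conic_surface :: ((real ^ 'n) \<times> real) set))"
  proof -
    have "{z :: (real ^ 'n) \<times> real. \<forall>i. fst z $ i \<noteq> 0} = (\<Inter>i. {z. fst z $ i \<noteq> 0})" by auto
    also have "open \<dots>"
      by (intro open_INT ballI open_Collect_neq continuous_intros) auto
    finally have "{z :: (real ^ 'n) \<times> real. \<forall>i. fst z $ i \<noteq> 0} \<in> sets borel" by (rule borel_open)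
    moreover have "{z \<in> space (restrict_space borel conic_surface). \<forall>i. fst z $ i \<noteq> 0} = conic_surface \<inter> {z :: (real ^ 'n) \<times> real. \<forall>i. fst z $ i \<noteq> 0}"
      by (auto simp: space_restrict_space)
    ultimately show ?thesis unfolding sets_restrict_space by (intro image_eqI)
  qed
  ultimately show ?thesis
    unfolding conic_measure_eq_distr by (subst AE_distr_iff[OF measurable_conic_graph]) auto
qed

lemma measurable_vec_lambda:
  "(\<lambda>f. \<chi> i. f i) \<in> PiM UNIV (\<lambda>_. lborel) \<rightarrow>\<^sub>M (borel :: (real ^ 'n::finite) measure)"
  by (subst borel_measurable_euclidean_space)
    (auto simp: Basis_vec_def inner_axis intro!: measurable_component_lborel)

text \<open>Agreement on boxes identifies the two measures. This leads from integrals over vectors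
  to the product over an index set on which \<open>cone_transform\<close> is built.\<close>

lemma lborel_vec_eq_distr:
  "(lborel :: (real ^ 'n::finite) measure) = distr (PiM UNIV (\<lambda>_. lborel)) borel (\<lambda>f. \<chi> i. f i)"
proof (rule lborel_eqI)
  interpret product_sigma_finite "\<lambda>_::'n. lborel :: real measure" by unfold_locales
  note measurable_vec_lambda[measurable]
  fix l u :: "real ^ 'n" assume le: "\<And>b. b \<in> Basis \<Longrightarrow> l \<bullet> b \<le> u \<bullet> b"
  have le': "l $ i \<le> u $ i" for i
    using le[of "axis i 1"] by (simp add: inner_axis axis_in_Basis_iff)
  have "emeasure (distr (PiM UNIV (\<lambda>_. lborel)) borel (\<lambda>f. \<chi> i. f i)) (box l u) =
      emeasure (PiM UNIV (\<lambda>_. lborel)) (PiE UNIV (\<lambda>i. {l $ i<..<u $ i}))"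
    by (subst emeasure_distr) (auto simp: mem_box_cart space_PiM PiE_UNIV_domain Pi_iff intro!: arg_cong2[where f = emeasure])
  also have "\<dots> = (\<Prod>i\<in>UNIV. emeasure lborel {l $ i<..<u $ i})"
    by (rule emeasure_PiM) auto
  also have "\<dots> = (\<Prod>b\<in>Basis. (u - l) \<bullet> b)"
  proof -
    have "(\<Prod>b\<in>Basis. (u - l) \<bullet> b) = (\<Prod>b\<in>(\<lambda>i. axis i (1::real)) ` UNIV. (u - l) \<bullet> b)"
      by (rule prod.cong) (auto simp: Basis_vec_def)
    also have "\<dots> = (\<Prod>i\<in>UNIV. u $ i - l $ i)"
      by (subst prod.reindex) (auto simp: inj_on_def axis_eq_axis inner_axis)
    finally show ?thesis using le' by (simp add: prod_ennreal)
  qed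
  finally show "emeasure (distr (PiM UNIV (\<lambda>_. lborel)) borel (\<lambda>f. \<chi> i. f i)) (box l u) = (\<Prod>b\<in>Basis. (u - l) \<bullet> b)" .
qed simp

section \<open>A Schur test\<close>

lemma enn_powr_ennreal: "r \<ge> 0 \<Longrightarrow> enn_powr (ennreal r) a = ennreal (r powr a)"
  by (simp add: enn_powr_def)

lemma enn_powr_top [simp]: "enn_powr top a = top"
  by (simp add: enn_powr_def)

lemma enn_powr_1 [simp]: "enn_powr x 1 = x"
  by (cases x) (simp_all add: enn_powr_def)

lemma enn_powr_eq_top_iff [simp]: "enn_powr x a = top \<longleftrightarrow> x = top"
  by (simp add: enn_powr_def)

lemma enn_powr_mono:
  assumes "x \<le> y" "a \<ge> 0"
  shows "enn_powr x a \<le> enn_powr y a"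
proof (cases "y = top")
  case False
  then obtain r s where "x = ennreal r" "y = ennreal s" "0 \<le> r" "r \<le> s"
    using assms(1) by (cases x; cases y) (auto simp: top_unique)
  then show ?thesis
    using assms(2) by (simp add: enn_powr_ennreal powr_mono2)
qed simp

lemma enn_powr_mult:
  assumes "c \<ge> 0" "a > 0"
  shows "enn_powr (ennreal (c powr (1 / a)) * y) a = ennreal c * enn_powr y a"
proof (cases y)
  case (real r)
  then show ?thesis
    using assms by (simp add: enn_powr_ennreal ennreal_mult[symmetric] powr_mult powr_powr)
next
  case top
  then show ?thesis
    using assms by (cases "c = 0") (simp_all add: enn_powr_def ennreal_mult_top)
qed

lemma measurable_enn_powr [measurable]: "(\<lambda>x. enn_powr x a) \<in> borel_measurable borel"
  unfolding enn_powr_def by measurable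

text \<open>The graph of the convex function \<open>x powr p\<close> lies above its tangent at
  \<open>l\<close>; this inequality is solved for \<open>x\<close>. With \<open>l\<close> left free
  it takes the place of Hoelder's inequality and includes \<open>p = 1\<close>.\<close>

lemma le_powr_tangent:
  fixes x l p :: real
  assumes x: "x \<ge> 0" and l: "l > 0" and p: "p \<ge> 1"
  shows "x \<le> x powr p / (p * l powr (p - 1)) + l * (1 - 1 / p)"
proof (cases "p = 1")
  case True
  then show ?thesis using x l by simp
next
  case False
  with p have p: "p > 1" by simp
  define q where "q = p / (p - 1)"
  have q: "q > 1" "1 / p + 1 / q = 1" "(p - 1) * q = p" "1 / q = 1 - 1 / p"
    using p by (simp_all add: q_def field_simps)
  have "x * l powr (p - 1) \<le> x powr p / p + (l powr (p - 1)) powr q / q"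
    by (rule Youngs_inequality) (use x p q in auto)
  also have "(l powr (p - 1)) powr q / q = l powr p * (1 - 1 / p)"
    using q by (simp only: powr_powr) (simp add: divide_inverse)
  also have "l powr p = l powr (p - 1) * l"
    using l by (simp add: powr_diff)
  finally have "x * l powr (p - 1) \<le> x powr p / p + l powr (p - 1) * l * (1 - 1 / p)" .
  then have "x * l powr (p - 1) / l powr (p - 1) \<le> (x powr p / p + l powr (p - 1) * l * (1 - 1 / p)) / l powr (p - 1)"
    by (rule divide_right_mono) simp
  then show ?thesis using l p by (simp add: add_divide_distrib)
qed

text \<open>Jensen's inequality for the measure with density \<open>K\<close>, of mass at most
  \<open>B\<close>. The tangent inequality is integrated and \<open>l\<close> is chosen afterwards.
  If \<open>B\<close> or the right-hand integral is 0, no positive \<open>l\<close> results, but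
  then the integrand on the left vanishes almost everywhere.\<close>

lemma nn_integral_powr_jensen:
  fixes F :: "'a \<Rightarrow> real"
  assumes K[measurable]: "K \<in> borel_measurable M" and F[measurable]: "F \<in> borel_measurable M"
    and F0: "\<And>x. F x \<ge> 0" and B: "B \<ge> 0" and KB: "(\<integral>\<^sup>+x. K x \<partial>M) \<le> ennreal B" and p: "p \<ge> 1"
  shows "enn_powr (\<integral>\<^sup>+x. K x * ennreal (F x) \<partial>M) p \<le> ennreal (B powr (p - 1)) * (\<integral>\<^sup>+x. K x * ennreal (F x powr p) \<partial>M)"
proof -
  let ?c = "\<lambda>l. ennreal (1 / (p * l powr (p - 1)))"
  let ?Kp = "\<lambda>x. (K x * ennreal (F x powr p))"
  have zero: ?thesis if "AE x in M. K x * ennreal (F x) = 0"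
  proof -
    have "(\<integral>\<^sup>+x. K x * ennreal (F x) \<partial>M) = 0"
      using that by (subst nn_integral_0_iff_AE) auto
    then show ?thesis using enn_powr_ennreal[of 0 p] by simp
  qed
  show ?thesis
  proof (cases "B = 0")
    case True
    then have "AE x in M. K x = 0"
      using KB by (simp add: nn_integral_0_iff_AE)
    then show ?thesis by (intro zero) (auto elim: eventually_mono)
  next
    case False
    with B have B: "B > 0" by simp
    show ?thesis
    proof (cases "(\<integral>\<^sup>+x. K x * ennreal (F x powr p) \<partial>M)")
      case top
      then show ?thesis using B by (simp add: ennreal_mult_top)
    next
      case (real n)
      show ?thesis
      proof (cases "n = 0")
        case True
        then have "AE x in M. K x * ennreal (F x powr p) = 0"
          using real by (simp add: nn_integral_0_iff_AE)
        then show ?thesis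
          by (intro zero, elim eventually_mono) (use F0 in \<open>auto simp: ennreal_eq_0_iff order.antisym\<close>)
      next
        case False
        with real have n: "n > 0" by simp
        \<comment> \<open>The optimal point of tangency: with \<open>l powr p = n / B\<close> the
          terms of weight \<open>1 / p\<close> and \<open>1 - 1 / p\<close> add up to
          \<open>l * B\<close>.\<close>
        define l where "l = (n / B) powr (1 / p)"
        have l: "l > 0" using n B by (simp add: l_def)
        have lp: "l powr p = n / B" using n B p by (simp add: l_def powr_powr)
        have lp1: "l powr (p - 1) = n / (B * l)"
          using l lp by (simp add: powr_diff)
        have "(\<integral>\<^sup>+x. K x * ennreal (F x) \<partial>M) \<le>
            (\<integral>\<^sup>+x. ?c l * ?Kp x + ennreal (l * (1 - 1 / p)) * K x \<partial>M)"
        proof (rule nn_integral_mono)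
          fix x
          have "ennreal (F x) \<le> ennreal (1 / (p * l powr (p - 1)) * F x powr p + l * (1 - 1 / p))"
            using le_powr_tangent[OF F0[of x] l p] by (intro ennreal_leI) simp
          also have "\<dots> = ?c l * ennreal (F x powr p) + ennreal (l * (1 - 1 / p))"
            using p l by (subst ennreal_plus) (simp_all add: ennreal_mult[symmetric])
          finally have "K x * ennreal (F x) \<le> K x * \<dots>" by (rule mult_left_mono) simp
          then show "K x * ennreal (F x) \<le> ?c l * ?Kp x + ennreal (l * (1 - 1 / p)) * K x"
            by (simp add: distrib_left mult_ac)
        qed
        also have "\<dots> = ?c l * ennreal n + ennreal (l * (1 - 1 / p)) * (\<integral>\<^sup>+x. K x \<partial>M)"
          using real by (simp add: nn_integral_add nn_integral_cmult)
        also have "\<dots> \<le> ?c l * ennreal n + ennreal (l * (1 - 1 / p)) * ennreal B"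
          by (intro add_left_mono mult_left_mono KB) simp
        also have "\<dots> = ennreal (1 / (p * l powr (p - 1)) * n + l * (1 - 1 / p) * B)"
          using p l n B by (subst ennreal_plus) (simp_all add: ennreal_mult[symmetric])
        also have "1 / (p * l powr (p - 1)) * n + l * (1 - 1 / p) * B = l * B"
          unfolding lp1 using n B l p by (simp add: field_simps)
        finally have "enn_powr (\<integral>\<^sup>+x. K x * ennreal (F x) \<partial>M) p \<le> enn_powr (ennreal (l * B)) p"
          using p by (intro enn_powr_mono) auto
        also have "\<dots> = ennreal (n / B * B powr p)"
          using l B by (simp add: enn_powr_ennreal powr_mult lp)
        also have "n / B * B powr p = B powr (p - 1) * n"
          using B by (simp add: powr_diff)
        also have "ennreal (B powr (p - 1) * n) = ennreal (B powr (p - 1)) * (\<integral>\<^sup>+x. K x * ennreal (F x powr p) \<partial>M)"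
          using real by (simp add: ennreal_mult)
        finally show ?thesis .
      qed
    qed
  qed
qed

text \<open>The row bound enters through Jensen's inequality with the power \<open>p - 1\<close>,
  the column bound once, after interchanging the integrations. Together they give
  \<open>B powr p\<close>, that is, operator norm at most \<open>B\<close>.\<close>

lemma (in sigma_finite_measure) nn_integral_schur_test:
  fixes P :: "'a \<Rightarrow> 'a \<Rightarrow> ennreal" and F :: "'a \<Rightarrow> real"
  assumes P[measurable]: "case_prod P \<in> borel_measurable (M \<Otimes>\<^sub>M M)"
    and F[measurable]: "F \<in> borel_measurable M" and F0: "\<And>x. F x \<ge> 0" and B: "B \<ge> 0"
    and rows: "\<And>z. z \<in> space M \<Longrightarrow> (\<integral>\<^sup>+w. P z w \<partial>M) \<le> ennreal B"
    and cols: "\<And>w. w \<in> space M \<Longrightarrow> (\<integral>\<^sup>+z. P z w \<partial>M) \<le> ennreal B"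
    and p: "p \<ge> 1"
  shows "(\<integral>\<^sup>+z. enn_powr (\<integral>\<^sup>+w. P z w * ennreal (F w) \<partial>M) p \<partial>M) \<le>
    ennreal (B powr p) * (\<integral>\<^sup>+w. ennreal (F w powr p) \<partial>M)"
proof -
  interpret MM: pair_sigma_finite M M by unfold_locales
  have "(\<integral>\<^sup>+z. enn_powr (\<integral>\<^sup>+w. P z w * ennreal (F w) \<partial>M) p \<partial>M) \<le>
      (\<integral>\<^sup>+z. ennreal (B powr (p - 1)) * (\<integral>\<^sup>+w. P z w * ennreal (F w powr p) \<partial>M) \<partial>M)"
    by (intro nn_integral_mono nn_integral_powr_jensen rows p B F F0) measurable
  also have "\<dots> = ennreal (B powr (p - 1)) * (\<integral>\<^sup>+z. \<integral>\<^sup>+w. P z w * ennreal (F w powr p) \<partial>M \<partial>M)"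
    by (rule nn_integral_cmult) measurable
  also have "(\<integral>\<^sup>+z. \<integral>\<^sup>+w. P z w * ennreal (F w powr p) \<partial>M \<partial>M) = (\<integral>\<^sup>+w. \<integral>\<^sup>+z. P z w * ennreal (F w powr p) \<partial>M \<partial>M)"
    by (rule MM.Fubini'[symmetric]) measurable
  also have "\<dots> \<le> (\<integral>\<^sup>+w. ennreal B * ennreal (F w powr p) \<partial>M)"
    by (intro nn_integral_mono, subst nn_integral_multc) (auto intro!: mult_right_mono cols)
  also have "\<dots> = ennreal B * (\<integral>\<^sup>+w. ennreal (F w powr p) \<partial>M)"
    by (rule nn_integral_cmult) measurable
  finally have "(\<integral>\<^sup>+z. enn_powr (\<integral>\<^sup>+w. P z w * ennreal (F w) \<partial>M) p \<partial>M) \<le>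
     ennreal (B powr (p - 1)) * ennreal B * (\<integral>\<^sup>+w. ennreal (F w powr p) \<partial>M)"
    by (simp add: mult_left_mono mult.assoc)
  also have "ennreal (B powr (p - 1)) * ennreal B = ennreal (B powr p)"
    using B by (simp add: ennreal_mult[symmetric] powr_diff)
  finally show ?thesis .
qed

text \<open>If \<open>f\<close> is not integrable, the left side is 0 by convention. The estimates
  can therefore precede the proof of convergence.\<close>

lemma ennreal_norm_integral_le:
  fixes f :: "'a \<Rightarrow> real"
  shows "ennreal \<bar>LINT x|M. f x\<bar> \<le> (\<integral>\<^sup>+x. ennreal \<bar>f x\<bar> \<partial>M)"
proof (cases "integrable M f")
  case True
  then show ?thesis using integral_norm_bound_ennreal[OF True] by simp
next
  case False
  then show ?thesis by (simp add: not_integrable_integral_eq)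
qed

section \<open>The positive kernel\<close>

lemma sigma_finite_conic_measure:
  "sigma_finite_measure (conic_measure :: ((real ^ 'n::finite) \<times> real) measure)"
proof
  let ?A = "\<lambda>k::nat. {z \<in> (conic_surface :: ((real ^ 'n) \<times> real) set). snd z \<le> real k}"
  have A: "?A k \<in> sets (restrict_space borel conic_surface)" for k
  proof -
    have "{z :: (real ^ 'n) \<times> real. snd z \<le> real k} \<in> sets borel"
      by (intro borel_closed closed_Collect_le continuous_intros)
    then show ?thesis
      unfolding sets_restrict_space by (rule image_eqI[rotated]) auto
  qed
  have fin: "emeasure conic_measure (?A k) \<noteq> \<infinity>" for k
  proof -
    have "emeasure conic_measure (?A k) = emeasure lborel (cball (0 :: real ^ 'n) (real k))"
      unfolding conic_measure_eq_distr
      by (subst emeasure_distr[OF measurable_conic_graph A])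
        (auto simp: conic_surface_def intro!: arg_cong2[where f = emeasure])
    also have "\<dots> < \<infinity>" by (rule emeasure_lborel_cball_finite)
    finally show ?thesis by simp
  qed
  show "\<exists>A. countable A \<and> A \<subseteq> sets (conic_measure :: ((real ^ 'n) \<times> real) measure) \<and> \<Union> A = space conic_measure \<and>
      (\<forall>a\<in>A. emeasure conic_measure a \<noteq> \<infinity>)"
  proof (intro exI[of _ "range ?A"] conjI ballI)
    show "range ?A \<subseteq> sets conic_measure" using A by (auto simp: sets_conic_measure)
    show "\<Union> (range ?A) = space conic_measure"
      using real_arch_simple by auto
    show "emeasure conic_measure a \<noteq> \<infinity>" if "a \<in> range ?A" for a using that fin by auto
  qed simp
qed

interpretation conic: sigma_finite_measure conic_measure
  by (rule sigma_finite_conic_measure)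

lemma measurable_conic_measureI: "f \<in> borel \<rightarrow>\<^sub>M N \<Longrightarrow> f \<in> conic_measure \<rightarrow>\<^sub>M N"
  by (simp add: measurable_cong_sets[OF sets_conic_measure refl] measurable_restrict_space1)

lemma measurable_conic_fst_nth: "(\<lambda>z. fst z $ i) \<in> borel_measurable conic_measure"
  by (intro measurable_conic_measureI borel_measurable_continuous_onI continuous_intros)

lemma measurable_conic_snd: "snd \<in> borel_measurable conic_measure"
  by (intro measurable_conic_measureI borel_measurable_continuous_onI continuous_intros)

lemma measurable_h_weight [measurable]: "h_weight \<kappa> \<in> borel_measurable borel"
proof -
  have [measurable]: "(\<lambda>x::real ^ 'n. x $ i) \<in> borel_measurable borel" for i
    by (intro borel_measurable_continuous_onI continuous_intros)
  show ?thesis unfolding h_weight_def by measurable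
qed

lemma measurable_conic_fst: "fst \<in> borel_measurable conic_measure"
  by (intro measurable_conic_measureI borel_measurable_continuous_onI continuous_intros)

lemma measurable_u_weight: "u_weight \<kappa> \<in> borel_measurable conic_measure"
  unfolding u_weight_def case_prod_beta'
  using measurable_compose[OF measurable_conic_fst measurable_h_weight] measurable_conic_snd
  by (intro borel_measurable_times borel_measurable_power borel_measurable_divide borel_measurable_const)

lemma u_weight_nonneg: "z \<in> conic_surface \<Longrightarrow> u_weight \<kappa> z \<ge> 0"
  by (auto simp: u_weight_def conic_surface_def)

lemma w_weight_eq: "w_weight \<kappa> z = u_weight \<kappa> z * exp (- snd z)"
  by (auto simp: u_weight_def w_weight_def split: prod.split)

lemma measurable_w_weight: "w_weight \<kappa> \<in> borel_measurable conic_measure"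
proof -
  note measurable_conic_snd[measurable] measurable_u_weight[of \<kappa>, measurable]
  show ?thesis unfolding w_weight_eq[abs_def] by measurable
qed

lemma AE_u_weight_pos:
  fixes \<kappa> :: "real ^ 'n::finite"
  shows "AE z in conic_measure. u_weight \<kappa> z > 0"
  using AE_conic_measure_nonzero
proof (rule AE_mp, intro AE_I2 impI)
  fix z :: "(real ^ 'n) \<times> real" assume z: "z \<in> space conic_measure" "\<forall>i. fst z $ i \<noteq> 0"
  then have "fst z \<noteq> 0" by auto
  then have "snd z > 0" using z(1) by (auto simp: conic_surface_def)
  moreover have "h_weight \<kappa> (fst z) > 0"
    using z(2) by (auto simp: h_weight_def intro!: prod_pos)
  ultimately show "u_weight \<kappa> z > 0" by (simp add: u_weight_def case_prod_beta')
qed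

section \<open>Radial integrals and the normalizing constant\<close>

definition sphere_weight :: "real ^ 'n::finite \<Rightarrow> real" where
  "sphere_weight \<kappa> = enn2real (\<integral>\<^sup>+\<xi>. ennreal ((h_weight \<kappa> \<xi>)\<^sup>2) \<partial>sphere_measure)"

text \<open>As \<open>enn2real\<close> sends infinity to 0, this asserts finiteness: on the unit
  sphere, of finite measure, nonnegative exponents keep \<open>h_weight\<close> below 1.\<close>

lemma sphere_weight_eq:
  fixes \<kappa> :: "real ^ 'n::finite"
  assumes \<kappa>: "\<And>i. \<kappa> $ i \<ge> 0"
  shows "(\<integral>\<^sup>+\<xi>. ennreal ((h_weight \<kappa> \<xi>)\<^sup>2) \<partial>sphere_measure) = ennreal (sphere_weight \<kappa>)"
proof -
  interpret S: finite_measure "sphere_measure :: (real ^ 'n) measure"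
    by (rule finite_measure_sphere_measure)
  have "(\<integral>\<^sup>+\<xi>. ennreal ((h_weight \<kappa> \<xi>)\<^sup>2) \<partial>sphere_measure) \<le> (\<integral>\<^sup>+\<xi>. 1 \<partial>(sphere_measure :: (real ^ 'n) measure))"
  proof (rule nn_integral_mono)
    fix \<xi> :: "real ^ 'n" assume "\<xi> \<in> space sphere_measure"
    then have "\<bar>\<xi> $ i\<bar> \<le> 1" for i
      using component_le_norm_cart[of \<xi> i] by simp
    then have "h_weight \<kappa> \<xi> \<le> 1"
      unfolding h_weight_def using \<kappa> by (intro prod_le_1) (auto intro: powr_le1)
    moreover have "h_weight \<kappa> \<xi> \<ge> 0" by (simp add: h_weight_def prod_nonneg)
    ultimately show "ennreal ((h_weight \<kappa> \<xi>)\<^sup>2) \<le> 1"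
      by (simp add: power_le_one)
  qed
  also have "\<dots> < top" using S.emeasure_finite[of "sphere 0 1"] by (simp add: less_top[symmetric])
  finally show ?thesis unfolding sphere_weight_def by simp
qed

lemma h_weight_scale:
  assumes "t > 0"
  shows "h_weight \<kappa> (t *\<^sub>R x) = t powr (\<Sum>i\<in>UNIV. \<kappa> $ i) * h_weight \<kappa> x"
  using assms by (simp add: h_weight_def abs_mult powr_mult prod.distrib powr_sum)

text \<open>Homogeneity of \<open>h_weight\<close>: its square, the factor \<open>1 / t\<close> and
  the density of the conic measure give the power \<open>2 * |\<kappa>| - 1 + (d - 1)\<close>, which
  is \<open>2 * alpha \<kappa>\<close>.\<close>

lemma nn_integral_conic_radial:
  fixes \<kappa> :: "real ^ 'n::finite"
  assumes \<kappa>: "\<And>i. \<kappa> $ i \<ge> 0" and [measurable]: "\<phi> \<in> borel_measurable borel"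
  shows "(\<integral>\<^sup>+z. \<phi> (snd z) * ennreal (u_weight \<kappa> z) \<partial>conic_measure) =
    ennreal (sphere_weight \<kappa>) * (\<integral>\<^sup>+t\<in>{0..}. \<phi> t * ennreal (t powr (2 * alpha \<kappa>)) \<partial>lborel)"
proof -
  let ?u = "\<lambda>t. (\<integral>\<^sup>+\<xi>. \<phi> t * ennreal (u_weight \<kappa> (t *\<^sub>R \<xi>, t)) \<partial>sphere_measure)"
  have [measurable]: "u_weight \<kappa> \<in> borel_measurable conic_measure" by (rule measurable_u_weight)
  have [measurable]: "(\<lambda>z. \<phi> (snd z)) \<in> borel_measurable conic_measure"
    by (rule measurable_compose[OF measurable_conic_snd]) measurable
  have hm: "(\<lambda>\<xi>. ennreal ((h_weight \<kappa> \<xi>)\<^sup>2)) \<in> borel_measurable sphere_measure"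
    by (simp add: measurable_cong_sets[OF sets_sphere_measure refl] measurable_restrict_space1)
  have "(\<integral>\<^sup>+z. \<phi> (snd z) * ennreal (u_weight \<kappa> z) \<partial>conic_measure) =
    (\<integral>\<^sup>+t\<in>{0..}. (ennreal (t ^ (CARD('n) - 1)) *
        ?u t) \<partial>lborel)"
    by (subst nn_integral_conic_measure) simp_all
  also have "\<dots> = (\<integral>\<^sup>+t. ennreal (sphere_weight \<kappa>) * (\<phi> t * ennreal (t powr (2 * alpha \<kappa>)) * indicator {0..} t) \<partial>lborel)"
  proof (rule nn_integral_cong_AE, use AE_lborel_singleton[of 0] in eventually_elim)
    fix t :: real assume t0: "t \<noteq> 0"
    show "(ennreal (t ^ (CARD('n) - 1)) * ?u t) * indicator {0..} t =
        ennreal (sphere_weight \<kappa>) * (\<phi> t * ennreal (t powr (2 * alpha \<kappa>)) * indicator {0..} t)"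
    proof (cases "t > 0")
      case True
      let ?k = "(\<Sum>i\<in>UNIV. \<kappa> $ i)"
      have "?u t =
          (\<integral>\<^sup>+\<xi>. (\<phi> t * ennreal (t powr (2 * ?k) / t)) * ennreal ((h_weight \<kappa> \<xi>)\<^sup>2) \<partial>sphere_measure)"
      proof (rule nn_integral_cong)
        fix \<xi> :: "real ^ 'n"
        have "(t powr ?k)\<^sup>2 = t powr (2 * ?k)"
          using True by (simp add: power2_eq_square powr_add[symmetric])
        then have "u_weight \<kappa> (t *\<^sub>R \<xi>, t) = t powr (2 * ?k) / t * (h_weight \<kappa> \<xi>)\<^sup>2"
          using True by (simp add: u_weight_def h_weight_scale power_mult_distrib)
        then have "ennreal (u_weight \<kappa> (t *\<^sub>R \<xi>, t)) = ennreal (t powr (2 * ?k) / t) * ennreal ((h_weight \<kappa> \<xi>)\<^sup>2)"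
          using True by (simp only:) (rule ennreal_mult, simp_all)
        then show "\<phi> t * ennreal (u_weight \<kappa> (t *\<^sub>R \<xi>, t)) = (\<phi> t * ennreal (t powr (2 * ?k) / t)) * ennreal ((h_weight \<kappa> \<xi>)\<^sup>2)"
          by (simp only: mult.assoc)
      qed
      also have "\<dots> = (\<phi> t * ennreal (t powr (2 * ?k) / t)) * ennreal (sphere_weight \<kappa>)"
        unfolding sphere_weight_eq[OF \<kappa>, symmetric] by (rule nn_integral_cmult) (rule hm)
      finally have "(ennreal (t ^ (CARD('n) - 1)) * ?u t) =
          ennreal (sphere_weight \<kappa>) * \<phi> t * (ennreal (t ^ (CARD('n) - 1)) * ennreal (t powr (2 * ?k) / t))"
        by (simp only: mult_ac)
      also have "ennreal (t ^ (CARD('n) - 1)) * ennreal (t powr (2 * ?k) / t) = ennreal (t powr (2 * alpha \<kappa>))"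
      proof -
        have "t ^ (CARD('n) - 1) = t powr (real CARD('n) - 1)"
          using True by (simp add: powr_realpow[symmetric] of_nat_diff Suc_leI)
        then have "t ^ (CARD('n) - 1) * (t powr (2 * ?k) / t) = t powr (real CARD('n) - 1) * t powr (2 * ?k) * t powr (- 1)"
          using True by (simp add: powr_minus divide_inverse)
        also have "\<dots> = t powr (2 * alpha \<kappa>)"
        proof -
          have "real CARD('n) - 1 + 2 * ?k + - 1 = 2 * alpha \<kappa>" by (simp add: alpha_def field_simps)
          then show ?thesis by (simp only: powr_add[symmetric])
        qed
        finally show ?thesis using True by (simp add: ennreal_mult[symmetric])
      qed
      finally show ?thesis using True by (simp add: mult.assoc)
    next
      case False
      then show ?thesis using t0 by simp
    qed
  qed
  also have "\<dots> = ennreal (sphere_weight \<kappa>) * (\<integral>\<^sup>+t\<in>{0..}. \<phi> t * ennreal (t powr (2 * alpha \<kappa>)) \<partial>lborel)"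
    by (rule nn_integral_cmult) measurable
  finally show ?thesis .
qed

text \<open>The radial formula for \<open>exp (- t)\<close> is a Gamma integral. Positivity of the
  sphere mass excludes the default value \<open>1 / 0 = 0\<close> of \<open>b_const\<close>.\<close>

lemma b_const_eq:
  fixes \<kappa> :: "real ^ 'n::finite"
  assumes \<kappa>: "\<And>i. \<kappa> $ i \<ge> 0" and \<alpha>: "alpha \<kappa> > 0"
  shows "sphere_weight \<kappa> > 0" and "b_const \<kappa> = 1 / (sphere_weight \<kappa> * Gamma (2 * alpha \<kappa> + 1))"
proof -
  have um[measurable]: "u_weight \<kappa> \<in> borel_measurable conic_measure" by (rule measurable_u_weight)
  have [measurable]: "snd \<in> borel_measurable (conic_measure :: ((real ^ 'n) \<times> real) measure)" by (rule measurable_conic_snd)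
  have G: "Gamma (2 * alpha \<kappa> + 1) > 0" using \<alpha> by (intro Gamma_real_pos) simp
  have s0: "sphere_weight \<kappa> \<ge> 0" by (simp add: sphere_weight_def)
  have "(\<integral>\<^sup>+z. ennreal (w_weight \<kappa> z) \<partial>conic_measure) = (\<integral>\<^sup>+z. ennreal (exp (- snd z)) * ennreal (u_weight \<kappa> z) \<partial>conic_measure)"
    by (intro nn_integral_cong) (simp add: w_weight_eq ennreal_mult u_weight_nonneg mult.commute)
  also have "\<dots> = ennreal (sphere_weight \<kappa>) * (\<integral>\<^sup>+t\<in>{0..}. ennreal (exp (- t)) * ennreal (t powr (2 * alpha \<kappa>)) \<partial>lborel)"
    by (rule nn_integral_conic_radial[OF \<kappa>]) measurable
  also have "(\<integral>\<^sup>+t\<in>{0..}. ennreal (exp (- t)) * ennreal (t powr (2 * alpha \<kappa>)) \<partial>lborel) = ennreal (Gamma (2 * alpha \<kappa> + 1))"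
  proof -
    have "ennreal (Gamma (2 * alpha \<kappa> + 1)) = (\<integral>\<^sup>+t. ennreal (indicator {0..} t * t powr (2 * alpha \<kappa> + 1 - 1) / exp t) \<partial>lborel)"
      using \<alpha> by (intro Gamma_conv_nn_integral_real) simp
    also have "\<dots> = (\<integral>\<^sup>+t\<in>{0..}. ennreal (exp (- t)) * ennreal (t powr (2 * alpha \<kappa>)) \<partial>lborel)"
      by (rule nn_integral_cong)
        (auto split: split_indicator simp: ennreal_mult[symmetric] exp_minus divide_inverse mult.commute)
    finally show ?thesis ..
  qed
  finally have w: "(\<integral>\<^sup>+z. ennreal (w_weight \<kappa> z) \<partial>conic_measure) = ennreal (sphere_weight \<kappa> * Gamma (2 * alpha \<kappa> + 1))"
    using s0 G by (simp add: ennreal_mult)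
  note wm = measurable_w_weight[of \<kappa>]
  have w0: "AE z in conic_measure. 0 \<le> w_weight \<kappa> z"
    by (intro AE_I2) (simp add: w_weight_eq u_weight_nonneg)
  show pos: "sphere_weight \<kappa> > 0"
  \<comment> \<open>Mass 0 would make the weight vanish almost everywhere, although it is positive
    almost everywhere; then Lebesgue measure itself would be zero.\<close>
  proof (rule ccontr)
    assume "\<not> sphere_weight \<kappa> > 0"
    with s0 have "sphere_weight \<kappa> = 0" by simp
    then have "AE z in conic_measure. ennreal (w_weight \<kappa> z) = 0"
      using w wm by (subst nn_integral_0_iff_AE[symmetric]) auto
    then have "AE z in (conic_measure :: ((real ^ 'n) \<times> real) measure). False"
      using AE_u_weight_pos[of \<kappa>] by eventually_elim (simp add: w_weight_eq ennreal_eq_0_iff mult_le_0_iff)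
    then have "AE y in (lborel :: (real ^ 'n) measure). False"
      unfolding conic_measure_eq_distr by (subst (asm) AE_distr_iff[OF measurable_conic_graph]) auto
    then show False
      using ae_filter_eq_bot_iff[of "lborel :: (real ^ 'n) measure"]
      by (simp add: eventually_False)
  qed
  have "(LINT z|conic_measure. w_weight \<kappa> z) = sphere_weight \<kappa> * Gamma (2 * alpha \<kappa> + 1)"
    using w wm w0 s0 G by (subst integral_eq_nn_integral) auto
  then show "b_const \<kappa> = 1 / (sphere_weight \<kappa> * Gamma (2 * alpha \<kappa> + 1))"
    by (simp add: b_const_def)
qed

lemma b_const_pos: "(\<And>i. \<kappa> $ i \<ge> 0) \<Longrightarrow> alpha \<kappa> > 0 \<Longrightarrow> b_const \<kappa> > 0"
  by (simp add: b_const_eq Gamma_real_pos)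

text \<open>
  The translation with the Bessel factor replaced by its value at \<open>0\<close>, and with \<open>v = cos \<theta>\<close>.
\<close>

definition translation_kernel ::
    "real ^ 'n::finite \<Rightarrow> (real \<Rightarrow> ennreal) \<Rightarrow> (real ^ 'n) \<times> real \<Rightarrow> (real ^ 'n) \<times> real \<Rightarrow> ennreal" where
  "translation_kernel \<kappa> G z w = ennreal (c_const (alpha \<kappa> - 1 / 2)) *
    (\<integral>\<^sup>+u. laguerre_kernel (alpha \<kappa>) G (snd z) (snd w) (\<Sum>i\<in>UNIV. fst z $ i * fst w $ i * u i) \<partial>Phi_measure \<kappa>)"

lemma translation_kernel_sym: "translation_kernel \<kappa> G z w = translation_kernel \<kappa> G w z"
proof -
  have "(\<Sum>i\<in>UNIV. fst z $ i * fst w $ i * u i) = (\<Sum>i\<in>UNIV. fst w $ i * fst z $ i * u i)" for u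
    by (rule sum.cong) simp_all
  then show ?thesis
    by (simp add: translation_kernel_def laguerre_kernel_def mult.commute[of "snd z"] add.commute[of "snd z"])
qed

lemma prob_space_Phi_measure: "(\<And>i. \<kappa> $ i \<ge> 0) \<Longrightarrow> prob_space (Phi_measure \<kappa>)"
  unfolding Phi_measure_def by (intro prob_space_PiM prob_space_Phi_measure1)

lemma measurable_nth_Phi_measure: "(\<lambda>u. u i) \<in> borel_measurable (Phi_measure \<kappa>)"
  unfolding Phi_measure_def by (rule measurable_component_Phi_measure) simp

lemma measurable_conic_Phi_inner:
  "(\<lambda>q. \<Sum>i\<in>UNIV. fst (fst (fst q)) $ i * fst (snd (fst q)) $ i * snd q i) \<in>
    borel_measurable ((conic_measure \<Otimes>\<^sub>M conic_measure) \<Otimes>\<^sub>M Phi_measure \<kappa>)"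
  by (intro borel_measurable_sum borel_measurable_times
      measurable_compose[OF measurable_compose[OF measurable_fst measurable_fst] measurable_conic_fst_nth]
      measurable_compose[OF measurable_compose[OF measurable_fst measurable_snd] measurable_conic_fst_nth]
      measurable_compose[OF measurable_snd measurable_nth_Phi_measure])

lemma measurable_Phi_integral_laguerre_kernel:
  fixes \<kappa> :: "real ^ 'n::finite"
  assumes \<kappa>: "\<And>i. \<kappa> $ i \<ge> 0" and [measurable]: "G \<in> borel_measurable borel"
  shows "(\<lambda>q. \<integral>\<^sup>+u. laguerre_kernel a G (snd (fst q)) (snd (snd q))
      (\<Sum>i\<in>UNIV. fst (fst q) $ i * fst (snd q) $ i * u i) \<partial>Phi_measure \<kappa>) \<in> borel_measurable (conic_measure \<Otimes>\<^sub>M conic_measure)"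
proof -
  let ?C = "conic_measure :: ((real ^ 'n) \<times> real) measure"
  interpret Phi: prob_space "Phi_measure \<kappa>" using \<kappa> by (rule prob_space_Phi_measure)
  have [measurable]: "(\<lambda>q. snd (fst (fst q))) \<in> borel_measurable ((?C \<Otimes>\<^sub>M ?C) \<Otimes>\<^sub>M Phi_measure \<kappa>)"
    "(\<lambda>q. snd (snd (fst q))) \<in> borel_measurable ((?C \<Otimes>\<^sub>M ?C) \<Otimes>\<^sub>M Phi_measure \<kappa>)"
    by (rule measurable_compose[OF measurable_compose[OF measurable_fst measurable_fst] measurable_conic_snd],
        rule measurable_compose[OF measurable_compose[OF measurable_fst measurable_snd] measurable_conic_snd])
  note measurable_conic_Phi_inner[of \<kappa>, measurable]
  have "(\<lambda>q. laguerre_kernel a G (snd (fst (fst q))) (snd (snd (fst q)))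
      (\<Sum>i\<in>UNIV. fst (fst (fst q)) $ i * fst (snd (fst q)) $ i * snd q i)) \<in> borel_measurable ((?C \<Otimes>\<^sub>M ?C) \<Otimes>\<^sub>M Phi_measure \<kappa>)"
    by measurable
  then show ?thesis
    by (intro Phi.borel_measurable_nn_integral) (simp add: case_prod_beta')
qed

lemma measurable_translation_kernel:
  fixes \<kappa> :: "real ^ 'n::finite"
  assumes "\<And>i. \<kappa> $ i \<ge> 0" and "G \<in> borel_measurable borel"
  shows "(\<lambda>q. translation_kernel \<kappa> G (fst q) (snd q)) \<in> borel_measurable (conic_measure \<Otimes>\<^sub>M conic_measure)"
proof -
  note measurable_Phi_integral_laguerre_kernel[OF assms, measurable]
  show ?thesis unfolding translation_kernel_def by measurable
qed

lemma measurable_conic_slice: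
  assumes "(\<lambda>q. f (fst q) (snd q)) \<in> conic_measure \<Otimes>\<^sub>M conic_measure \<rightarrow>\<^sub>M N" and "z \<in> conic_surface"
  shows "f z \<in> conic_measure \<rightarrow>\<^sub>M N"
  using measurable_compose[OF measurable_Pair1'[of z conic_measure conic_measure] assms(1)] assms(2) by simp

text \<open>In the coordinates of the graph, \<open>u_weight\<close> splits into the powers of the
  coordinates, which belong to \<open>cone_transform\<close>, and \<open>1 / norm y\<close>, which
  depends on the squared radius \<open>r\<close> only and goes into the transformed
  function.\<close>

lemma nn_integral_Phi_integral_conic:
  fixes \<kappa> :: "real ^ 'n::finite"
  assumes \<kappa>: "\<And>i. \<kappa> $ i \<ge> 0" and G[measurable]: "G \<in> borel_measurable borel" and z: "z \<in> conic_surface"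
  shows "(\<integral>\<^sup>+w. (\<integral>\<^sup>+u. laguerre_kernel a G (snd z) (snd w) (\<Sum>i\<in>UNIV. fst z $ i * fst w $ i * u i) \<partial>Phi_measure \<kappa>) *
      ennreal (u_weight \<kappa> w) \<partial>conic_measure) =
    cone_transform (($) \<kappa>) UNIV (($) (fst z)) (\<lambda>r b. ennreal (1 / sqrt r) * laguerre_kernel a G (snd z) (sqrt r) b)"
proof -
  interpret Phi: prob_space "Phi_measure \<kappa>" using \<kappa> by (rule prob_space_Phi_measure)
  let ?I = "\<lambda>w. \<integral>\<^sup>+u. laguerre_kernel a G (snd z) (snd w) (\<Sum>i\<in>UNIV. fst z $ i * fst w $ i * u i) \<partial>Phi_measure \<kappa>"
  define g where "g w = ?I w * ennreal (u_weight \<kappa> w)" for w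
  have "?I \<in> borel_measurable conic_measure"
    by (rule measurable_conic_slice[OF measurable_Phi_integral_laguerre_kernel[OF \<kappa> G] z])
  then have gm: "g \<in> borel_measurable conic_measure"
    unfolding g_def using measurable_u_weight[of \<kappa>] by measurable
  then have gm': "(\<lambda>y. g (y, norm y)) \<in> borel_measurable borel"
    using measurable_compose[OF measurable_conic_graph, of g] 
    by (simp add: measurable_cong_sets[OF sets_conic_measure refl])
  have "(\<integral>\<^sup>+w. g w \<partial>conic_measure) = (\<integral>\<^sup>+y. g (y, norm y) \<partial>lborel)"
    by (rule nn_integral_conic_measure_lborel[OF gm])
  also have "\<dots> = (\<integral>\<^sup>+f. g ((\<chi> i. f i), norm (\<chi> i. f i)) \<partial>PiM UNIV (\<lambda>_. lborel))"
    by (subst lborel_vec_eq_distr, subst nn_integral_distr[OF measurable_vec_lambda]) (simp_all add: gm')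
  also have "\<dots> = cone_transform (($) \<kappa>) UNIV (($) (fst z)) (\<lambda>r b. ennreal (1 / sqrt r) * laguerre_kernel a G (snd z) (sqrt r) b)"
    unfolding cone_transform_def
  proof (rule nn_integral_cong)
    fix f :: "'n \<Rightarrow> real"
    define n where "n = sqrt (\<Sum>i\<in>UNIV. (f i)\<^sup>2)"
    have n: "norm (\<chi> i. f i) = n" by (simp add: norm_vec_def L2_set_def n_def)
    have n0: "n \<ge> 0" by (simp add: n_def sum_nonneg)
    have sq: "(\<bar>f i\<bar> powr \<kappa> $ i)\<^sup>2 = \<bar>f i\<bar> powr (2 * \<kappa> $ i)" for i
      by (simp add: power2_eq_square powr_add[symmetric])
    have "u_weight \<kappa> ((\<chi> i. f i), n) = (\<Prod>i\<in>UNIV. \<bar>f i\<bar> powr (2 * \<kappa> $ i)) * (1 / n)"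
      by (simp add: u_weight_def h_weight_def prod_power_distrib sq)
    then have u: "ennreal (u_weight \<kappa> ((\<chi> i. f i), n)) = ennreal (\<Prod>i\<in>UNIV. \<bar>f i\<bar> powr (2 * \<kappa> $ i)) * ennreal (1 / n)"
      using n0 by (simp only:) (rule ennreal_mult, simp_all add: prod_nonneg)
    have Im: "(\<lambda>u. laguerre_kernel a G (snd z) n (\<Sum>i\<in>UNIV. fst z $ i * f i * u i)) \<in> borel_measurable (Phi_measure \<kappa>)"
    proof -
      have [measurable]: "(\<lambda>u. \<Sum>i\<in>UNIV. fst z $ i * f i * u i) \<in> borel_measurable (Phi_measure \<kappa>)"
        by (intro borel_measurable_sum borel_measurable_times borel_measurable_const measurable_nth_Phi_measure)
      show ?thesis by measurable
    qed
    have "(\<integral>\<^sup>+u. ennreal (1 / n) * laguerre_kernel a G (snd z) n (\<Sum>i\<in>UNIV. fst z $ i * f i * u i) \<partial>Phi_measure \<kappa>) =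
        ennreal (1 / n) * ?I ((\<chi> i. f i), n)"
      by (subst nn_integral_cmult[OF Im]) simp
    then show "g ((\<chi> i. f i), norm (\<chi> i. f i)) = ennreal (\<Prod>i\<in>UNIV. \<bar>f i\<bar> powr (2 * \<kappa> $ i)) *
        (\<integral>\<^sup>+u. ennreal (1 / sqrt (\<Sum>i\<in>UNIV. (f i)\<^sup>2)) * laguerre_kernel a G (snd z) (sqrt (\<Sum>i\<in>UNIV. (f i)\<^sup>2))
          (\<Sum>i\<in>UNIV. fst z $ i * f i * u i) \<partial>PiM UNIV (\<lambda>i. Phi_measure1 (\<kappa> $ i)))"
      unfolding n g_def u n_def[symmetric] Phi_measure_def[symmetric] by (simp only: mult_ac)
  qed
  finally show ?thesis unfolding g_def .
qed

text \<open>At the apex the radius \<open>\<rho>\<close> is 0, so \<open>G\<close> is evaluated at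
  \<open>snd w\<close> throughout, and the normalized weights in \<open>u\<close> and
  \<open>v\<close> integrate to 1.\<close>

lemma translation_kernel_apex:
  fixes \<kappa> :: "real ^ 'n::finite"
  assumes \<kappa>: "\<And>i. \<kappa> $ i \<ge> 0" and \<alpha>: "alpha \<kappa> > 0"
  shows "translation_kernel \<kappa> G (0, 0) w = G (snd w)"
proof -
  interpret Phi: prob_space "Phi_measure \<kappa>" using \<kappa> by (rule prob_space_Phi_measure)
  let ?c = "c_const (alpha \<kappa> - 1 / 2)"
  have c: "?c \<ge> 0" using \<alpha> by (simp add: c_const_def Gamma_real_nonneg)
  have "translation_kernel \<kappa> G (0, 0) w = ennreal ?c * laguerre_kernel (alpha \<kappa>) G 0 (snd w) 0"
    by (simp add: translation_kernel_def Phi.emeasure_space_1)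
  also have "laguerre_kernel (alpha \<kappa>) G 0 (snd w) 0 =
      (\<integral>\<^sup>+v. G (snd w) * (ennreal ((1 - v\<^sup>2) powr (alpha \<kappa> - 1)) * indicator {-1..1} v) \<partial>lborel)"
    by (simp add: laguerre_kernel_def mult_ac)
  also have "\<dots> = G (snd w) * (\<integral>\<^sup>+v\<in>{-1..1}. ennreal ((1 - v\<^sup>2) powr (alpha \<kappa> - 1)) \<partial>lborel)"
    by (rule nn_integral_cmult) measurable
  also have "ennreal ?c * \<dots> = G (snd w) * (ennreal ?c * (\<integral>\<^sup>+v\<in>{-1..1}. ennreal ((1 - v\<^sup>2) powr (alpha \<kappa> - 1)) \<partial>lborel))"
    by (simp only: mult_ac)
  also have "ennreal ?c * (\<integral>\<^sup>+v\<in>{-1..1}. ennreal ((1 - v\<^sup>2) powr (alpha \<kappa> - 1)) \<partial>lborel) =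
      (\<integral>\<^sup>+v. ennreal ?c * (ennreal ((1 - v\<^sup>2) powr (alpha \<kappa> - 1)) * indicator {-1..1} v) \<partial>lborel)"
    by (rule nn_integral_cmult[symmetric]) measurable
  also have "\<dots> = (\<integral>\<^sup>+v\<in>{-1..1}. ennreal (?c * (1 - v\<^sup>2) powr (alpha \<kappa> - 1)) \<partial>lborel)"
    using c by (simp add: ennreal_mult mult.assoc)
  also have "\<dots> = 1" by (rule nn_integral_symmetric_beta[OF \<alpha>])
  finally show ?thesis by simp
qed

text \<open>The right side of the fact \<open>L\<close> does not contain \<open>z\<close>, and its
  \<open>C\<close> serves all points of the cone at once. Hence \<open>z\<close> may be replaced by
  the apex, where the kernel is known explicitly.\<close>

lemma nn_integral_translation_kernel:
  fixes \<kappa> :: "real ^ 'n::finite"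
  assumes \<kappa>: "\<And>i. \<kappa> $ i \<ge> 0" and \<alpha>: "alpha \<kappa> > 0" and G[measurable]: "G \<in> borel_measurable borel"
    and z: "z \<in> conic_surface"
  shows "(\<integral>\<^sup>+w. translation_kernel \<kappa> G z w * ennreal (u_weight \<kappa> w) \<partial>conic_measure) =
    (\<integral>\<^sup>+w. G (snd w) * ennreal (u_weight \<kappa> w) \<partial>conic_measure)"
proof -
  let ?\<alpha> = "alpha \<kappa>"
  define I where "I z w = (\<integral>\<^sup>+u. laguerre_kernel ?\<alpha> G (snd z) (snd w) (\<Sum>i\<in>UNIV. fst z $ i * fst w $ i * u i) \<partial>Phi_measure \<kappa>)" for z w
  have T: "(\<integral>\<^sup>+w. translation_kernel \<kappa> G z w * ennreal (u_weight \<kappa> w) \<partial>conic_measure) =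
      ennreal (c_const (?\<alpha> - 1 / 2)) * (\<integral>\<^sup>+w. I z w * ennreal (u_weight \<kappa> w) \<partial>conic_measure)"
    if z: "z \<in> conic_surface" for z
  proof -
    have [measurable]: "I z \<in> borel_measurable conic_measure"
      unfolding I_def by (rule measurable_conic_slice[OF measurable_Phi_integral_laguerre_kernel[OF \<kappa> G] z])
    note measurable_u_weight[of \<kappa>, measurable]
    have "translation_kernel \<kappa> G z w * ennreal (u_weight \<kappa> w) =
        ennreal (c_const (?\<alpha> - 1 / 2)) * (I z w * ennreal (u_weight \<kappa> w))" for w
      by (simp only: translation_kernel_def I_def mult.assoc)
    then show ?thesis
      by (simp only:) (rule nn_integral_cmult, measurable)
  qed
  \<comment> \<open>The exponent left by \<open>cone_transform_line\<close> is the one that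
    \<open>nn_integral_laguerre_kernel_line\<close> requires; here \<open>d\<close> and
    \<open>\<kappa>\<close> combine to \<open>alpha \<kappa>\<close>.\<close>
  have e: "(\<Sum>i\<in>UNIV. \<kappa> $ i) + (real CARD('n) - 1) / 2 = ?\<alpha> + 1 / 2"
    by (simp add: alpha_def field_simps)
  obtain C where C: "\<forall>x F. case_prod F \<in> borel_measurable (borel \<Otimes>\<^sub>M borel) \<longrightarrow>
    cone_transform (($) \<kappa>) UNIV x F =
      C * (\<integral>\<^sup>+X. \<integral>\<^sup>+q. F (X\<^sup>2 + q) (sqrt (\<Sum>i\<in>UNIV. (x i)\<^sup>2) * X) \<partial>pow_measure (?\<alpha> + 1 / 2) \<partial>lborel)"
    using cone_transform_line[of "($) \<kappa>" UNIV, OF \<kappa>] unfolding e by auto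
  have L: "(\<integral>\<^sup>+w. I z w * ennreal (u_weight \<kappa> w) \<partial>conic_measure) =
      C * (2 * (\<integral>\<^sup>+B\<in>{0<..}. ennreal (2 * (4 * B) powr (?\<alpha> - 1 / 2)) *
      (\<integral>\<^sup>+P. \<integral>\<^sup>+q. G (P\<^sup>2 + q + B) \<partial>pow_measure ?\<alpha> \<partial>lborel) \<partial>lborel))"
    if z: "z \<in> conic_surface" for z
  proof -
    from z have t: "sqrt (\<Sum>i\<in>UNIV. (fst z $ i)\<^sup>2) = snd z" "snd z \<ge> 0"
      by (auto simp: conic_surface_def norm_vec_def L2_set_def)
    have "(\<integral>\<^sup>+w. I z w * ennreal (u_weight \<kappa> w) \<partial>conic_measure) =
      cone_transform (($) \<kappa>) UNIV (($) (fst z)) (\<lambda>r b. ennreal (1 / sqrt r) * laguerre_kernel ?\<alpha> G (snd z) (sqrt r) b)"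
      unfolding I_def by (rule nn_integral_Phi_integral_conic[OF \<kappa> G z])
    also have "\<dots> = C * (\<integral>\<^sup>+X. \<integral>\<^sup>+q. ennreal (1 / sqrt (X\<^sup>2 + q)) * laguerre_kernel ?\<alpha> G (snd z) (sqrt (X\<^sup>2 + q)) (snd z * X)
      \<partial>pow_measure (?\<alpha> + 1 / 2) \<partial>lborel)"
      by (subst C[rule_format]) (measurable, simp only: t(1))
    finally show ?thesis
      unfolding nn_integral_laguerre_kernel_line[OF G \<alpha> t(2)] .
  qed
  have z0: "(0, 0) \<in> (conic_surface :: ((real ^ 'n) \<times> real) set)" by (simp add: conic_surface_def)
  show ?thesis
    using T[OF z] T[OF z0] L[OF z] L[OF z0] by (simp add: translation_kernel_apex[OF \<kappa> \<alpha>])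
qed

section \<open>Domination of the translation by the positive kernel\<close>

lemma rho_eq: "rho z w u = sqrt ((snd z * snd w + (\<Sum>i\<in>UNIV. fst z $ i * fst w $ i * u i)) / 2)"
  by (simp add: rho_def case_prod_beta')

lemma space_Phi_measure: "space (Phi_measure \<kappa>) = (\<Pi>\<^sub>E i\<in>UNIV. {-1..1})"
  by (simp add: Phi_measure_def space_PiM)

text \<open>By Cauchy-Schwarz the sum under the root is at most \<open>t * s\<close> in absolute
  value, so the radicand is nonnegative and \<open>\<rho>\<close> is at most
  \<open>sqrt (t * s)\<close>; the second bound is then that between geometric and arithmetic mean.
  It keeps the argument \<open>t + s + 2 * \<rho> * cos \<theta>\<close> nonnegative.\<close>

lemma rho_bounds:
  fixes z w :: "(real ^ 'n::finite) \<times> real"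
  assumes z: "z \<in> conic_surface" and w: "w \<in> conic_surface" and u: "u \<in> space (Phi_measure \<kappa>)"
  shows "0 \<le> rho z w u" and "2 * rho z w u \<le> snd z + snd w"
proof -
  have zn: "norm (fst z) = snd z" "snd z \<ge> 0" and wn: "norm (fst w) = snd w" "snd w \<ge> 0"
    using z w by (auto simp: conic_surface_def)
  have u1: "\<bar>u i\<bar> \<le> 1" for i using u by (auto simp: space_Phi_measure abs_le_iff PiE_iff minus_le_iff)
  let ?S = "\<Sum>i\<in>UNIV. fst z $ i * fst w $ i * u i"
  have "\<bar>?S\<bar> \<le> (\<Sum>i\<in>UNIV. \<bar>fst z $ i * fst w $ i * u i\<bar>)" by (rule sum_abs)
  also have "\<dots> \<le> (\<Sum>i\<in>UNIV. \<bar>fst z $ i\<bar> * \<bar>fst w $ i\<bar>)"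
    by (intro sum_mono) (simp add: abs_mult mult_left_le u1)
  also have "\<dots> \<le> L2_set (\<lambda>i. fst z $ i) UNIV * L2_set (\<lambda>i. fst w $ i) UNIV"
    by (rule L2_set_mult_ineq)
  also have "\<dots> = snd z * snd w"
    using zn(1) wn(1) by (simp add: norm_vec_def L2_set_def)
  finally have S: "\<bar>?S\<bar> \<le> snd z * snd w" .
  then show "0 \<le> rho z w u" by (simp add: rho_eq)
  have "rho z w u \<le> sqrt (snd z * snd w)"
  proof -
    have "(a + b) / 2 \<le> a" if "\<bar>b\<bar> \<le> a" for a b :: real using that by (simp add: abs_le_iff)
    then show ?thesis unfolding rho_eq using S by (intro real_sqrt_le_mono)
  qed
  also have "\<dots> \<le> (snd z + snd w) / 2"
    using zn(2) wn(2) by (rule arith_geo_mean_sqrt)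
  finally show "2 * rho z w u \<le> snd z + snd w" by simp
qed

text \<open>The constant of the translation times the bound for the Bessel factor is the normalizing
  constant of the angular weight; this is why the final inequality has constant 1.\<close>

lemma bessel_bound_const:
  assumes "a \<ge> 1 / 2"
  shows "2 powr (a - 1) * Gamma (a + 1 / 2) / sqrt pi * (2 powr (- (a - 1)) * \<bar>rGamma (a - 1 + 1)\<bar>) = c_const (a - 1 / 2)"
proof -
  have "Gamma a > 0" using assms by (intro Gamma_real_pos) simp
  then have "\<bar>rGamma (a - 1 + 1)\<bar> = 1 / Gamma a"
    by (simp add: rGamma_inverse_Gamma divide_inverse)
  moreover have "2 powr (a - 1) * 2 powr (- (a - 1)) = (1 :: real)"
    by (simp only: powr_add[symmetric]) simp
  then have "2 powr (a - 1) * Gamma (a + 1 / 2) / sqrt pi * (2 powr (- (a - 1)) * (1 / Gamma a)) = Gamma (a + 1 / 2) / (sqrt pi * Gamma a)"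
    by (simp add: mult_ac)
  ultimately show ?thesis by (simp add: c_const_def Gamma_one_half_real add.commute)
qed

text \<open>The absolute value stands inside the iterated integral, so that the same estimate bounds
  the translation and proves that its integral converges absolutely.\<close>

lemma translation_le_kernel:
  fixes \<kappa> :: "real ^ 'n::finite"
  assumes \<kappa>: "\<And>i. \<kappa> $ i \<ge> 0" and \<alpha>: "alpha \<kappa> \<ge> 1 / 2" and g[measurable]: "g \<in> borel_measurable borel"
    and z: "z \<in> conic_surface" and w: "w \<in> conic_surface"
  shows "ennreal (2 powr (alpha \<kappa> - 1) * Gamma (alpha \<kappa> + 1 / 2) / sqrt pi * exp (- (snd z + snd w) / 2)) *
      (\<integral>\<^sup>+u. (\<integral>\<^sup>+\<theta>\<in>{0..pi}. ennreal \<bar>translation_integrand \<kappa> g z w u \<theta>\<bar> \<partial>lborel) \<partial>Phi_measure \<kappa>) \<le>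
    translation_kernel \<kappa> (\<lambda>r. ennreal \<bar>g r * exp (- r / 2)\<bar>) z w"
proof -
  let ?a = "alpha \<kappa>" and ?t = "snd z" and ?s = "snd w"
  define D where "D = 2 powr (?a - 1) * Gamma (?a + 1 / 2) / sqrt pi"
  define e where "e = exp (- (?t + ?s) / 2)"
  define J where "J = 2 powr (- (?a - 1)) * \<bar>rGamma (?a - 1 + 1)\<bar>"
  define G where "G r = ennreal \<bar>g r * exp (- r / 2)\<bar>" for r
  let ?S = "\<lambda>u. \<Sum>i\<in>UNIV. fst z $ i * fst w $ i * u i"
  have D0: "D > 0" using \<alpha> by (simp add: D_def Gamma_real_pos)
  have e0: "e > 0" by (simp add: e_def)
  have J0: "J \<ge> 0" by (simp add: J_def)
  have DJ: "D * J = c_const (?a - 1 / 2)"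
    unfolding D_def J_def by (rule bessel_bound_const[OF \<alpha>])
  have [measurable]: "G \<in> borel_measurable borel" unfolding G_def by measurable
  have point: "ennreal \<bar>translation_integrand \<kappa> g z w u \<theta>\<bar> * indicator {0..pi} \<theta> \<le>
      ennreal (J / e) * (G (?t + ?s + 2 * rho z w u * cos \<theta>) * ennreal (sin \<theta> powr (2 * ?a - 1)) * indicator {0..pi} \<theta>)"
    if u: "u \<in> space (Phi_measure \<kappa>)" for u \<theta>
  proof (cases "\<theta> \<in> {0..pi}")
    case True
    define r where "r = rho z w u"
    define R where "R = ?t + ?s + 2 * r * cos \<theta>"
    define S where "S = sin \<theta> powr (2 * ?a - 1)"
    have r0: "r \<ge> 0" using rho_bounds(1)[OF z w u] by (simp add: r_def)
    have s0: "sin \<theta> \<ge> 0" using True by (simp add: sin_ge_zero)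
    have j: "\<bar>bessel_j (?a - 1) (r * sin \<theta>)\<bar> \<le> J"
      unfolding J_def using \<alpha> r0 s0 by (intro abs_bessel_j_le) auto
    \<comment> \<open>As \<open>R\<close> is the argument of \<open>g\<close>,
      \<open>- r * cos \<theta> = - R / 2 + (t + s) / 2\<close>. The first part goes into
      \<open>G\<close>, the second does not involve \<open>\<theta>\<close> or
      \<open>u\<close>.\<close>
    have ex: "exp (- r * cos \<theta>) = exp (- R / 2) / e"
      by (simp add: e_def R_def exp_diff[symmetric]) (simp add: field_simps)
    have "\<bar>translation_integrand \<kappa> g z w u \<theta>\<bar> = \<bar>g R\<bar> * exp (- r * cos \<theta>) * \<bar>bessel_j (?a - 1) (r * sin \<theta>)\<bar> * S"
      by (simp add: translation_integrand_def Let_def r_def[symmetric] R_def S_def abs_mult)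
    also have "\<dots> \<le> \<bar>g R\<bar> * (exp (- R / 2) / e) * J * S"
      unfolding ex using j e0 by (intro mult_right_mono mult_left_mono) (auto simp: S_def)
    also have "\<dots> = J / e * (\<bar>g R * exp (- R / 2)\<bar> * S)"
      by (simp add: abs_mult)
    finally have "ennreal \<bar>translation_integrand \<kappa> g z w u \<theta>\<bar> \<le> ennreal (J / e * (\<bar>g R * exp (- R / 2)\<bar> * S))"
      by (rule ennreal_leI)
    also have "\<dots> = ennreal (J / e) * (G R * ennreal S)"
      using J0 e0 by (simp add: G_def ennreal_mult[symmetric] S_def)
    finally show ?thesis using True by (simp add: R_def S_def r_def)
  qed simp
  have inner: "(\<integral>\<^sup>+\<theta>\<in>{0..pi}. ennreal \<bar>translation_integrand \<kappa> g z w u \<theta>\<bar> \<partial>lborel) \<le>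
      ennreal (J / e) * laguerre_kernel ?a G ?t ?s (?S u)" if u: "u \<in> space (Phi_measure \<kappa>)" for u
  proof -
    have "(\<integral>\<^sup>+\<theta>\<in>{0..pi}. ennreal \<bar>translation_integrand \<kappa> g z w u \<theta>\<bar> \<partial>lborel) \<le>
       (\<integral>\<^sup>+\<theta>. ennreal (J / e) * (G (?t + ?s + 2 * rho z w u * cos \<theta>) * ennreal (sin \<theta> powr (2 * ?a - 1)) * indicator {0..pi} \<theta>) \<partial>lborel)"
      by (intro nn_integral_mono point u)
    also have "\<dots> = ennreal (J / e) * (\<integral>\<^sup>+\<theta>\<in>{0..pi}. G (?t + ?s + 2 * rho z w u * cos \<theta>) * ennreal (sin \<theta> powr (2 * ?a - 1)) \<partial>lborel)"
      by (rule nn_integral_cmult) measurable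
    also have "(\<integral>\<^sup>+\<theta>\<in>{0..pi}. G (?t + ?s + 2 * rho z w u * cos \<theta>) * ennreal (sin \<theta> powr (2 * ?a - 1)) \<partial>lborel) =
        (\<integral>\<^sup>+v\<in>{-1..1}. G (?t + ?s + 2 * rho z w u * v) * ennreal ((1 - v\<^sup>2) powr (?a - 1)) \<partial>lborel)"
      by (rule nn_integral_angle) measurable
    also have "\<dots> = laguerre_kernel ?a G ?t ?s (?S u)"
      by (simp add: laguerre_kernel_def rho_eq mult_ac)
    finally show ?thesis .
  qed
  have lm: "(\<lambda>u. laguerre_kernel ?a G ?t ?s (?S u)) \<in> borel_measurable (Phi_measure \<kappa>)"
  proof -
    have [measurable]: "?S \<in> borel_measurable (Phi_measure \<kappa>)"
      by (intro borel_measurable_sum borel_measurable_times borel_measurable_const measurable_nth_Phi_measure)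
    show ?thesis by measurable
  qed
  have "ennreal (D * e) * (\<integral>\<^sup>+u. (\<integral>\<^sup>+\<theta>\<in>{0..pi}. ennreal \<bar>translation_integrand \<kappa> g z w u \<theta>\<bar> \<partial>lborel) \<partial>Phi_measure \<kappa>) \<le>
      ennreal (D * e) * (\<integral>\<^sup>+u. ennreal (J / e) * laguerre_kernel ?a G ?t ?s (?S u) \<partial>Phi_measure \<kappa>)"
    by (intro mult_left_mono nn_integral_mono inner) auto
  also have "\<dots> = ennreal (D * e) * (ennreal (J / e) * (\<integral>\<^sup>+u. laguerre_kernel ?a G ?t ?s (?S u) \<partial>Phi_measure \<kappa>))"
    by (subst nn_integral_cmult[OF lm]) (rule refl)
  also have "\<dots> = ennreal (D * e * (J / e)) * (\<integral>\<^sup>+u. laguerre_kernel ?a G ?t ?s (?S u) \<partial>Phi_measure \<kappa>)"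
    using D0 e0 J0 by (subst ennreal_mult) (simp_all add: mult.assoc)
  also have "D * e * (J / e) = c_const (?a - 1 / 2)"
    using e0 DJ by simp
  finally show ?thesis
    by (simp add: translation_kernel_def G_def[abs_def] D_def e_def)
qed

lemma abs_translation_le_kernel:
  fixes \<kappa> :: "real ^ 'n::finite"
  assumes \<kappa>: "\<And>i. \<kappa> $ i \<ge> 0" and \<alpha>: "alpha \<kappa> \<ge> 1 / 2" and g: "g \<in> borel_measurable borel"
    and z: "z \<in> conic_surface" and w: "w \<in> conic_surface"
  shows "ennreal (\<bar>translation \<kappa> g z w\<bar> * exp (- (snd z + snd w) / 2)) \<le>
    translation_kernel \<kappa> (\<lambda>r. ennreal \<bar>g r * exp (- r / 2)\<bar>) z w"
proof -
  define D where "D = 2 powr (alpha \<kappa> - 1) * Gamma (alpha \<kappa> + 1 / 2) / sqrt pi"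
  define e where "e = exp (- (snd z + snd w) / 2)"
  have D0: "D > 0" using \<alpha> by (simp add: D_def Gamma_real_pos)
  have e0: "e > 0" by (simp add: e_def)
  let ?L = "LINT u|Phi_measure \<kappa>. (LINT \<theta>:{0..pi}|lborel. translation_integrand \<kappa> g z w u \<theta>)"
  have "ennreal (\<bar>translation \<kappa> g z w\<bar> * e) = ennreal (D * e) * ennreal \<bar>?L\<bar>"
    using D0 e0 by (simp add: translation_def D_def[symmetric] abs_mult ennreal_mult[symmetric] mult_ac)
  also have "ennreal \<bar>?L\<bar> \<le> (\<integral>\<^sup>+u. ennreal \<bar>LINT \<theta>:{0..pi}|lborel. translation_integrand \<kappa> g z w u \<theta>\<bar> \<partial>Phi_measure \<kappa>)"
    by (rule ennreal_norm_integral_le)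
  also have "\<dots> \<le> (\<integral>\<^sup>+u. (\<integral>\<^sup>+\<theta>\<in>{0..pi}. ennreal \<bar>translation_integrand \<kappa> g z w u \<theta>\<bar> \<partial>lborel) \<partial>Phi_measure \<kappa>)"
  proof (rule nn_integral_mono)
    fix u
    have "ennreal \<bar>LINT \<theta>:{0..pi}|lborel. translation_integrand \<kappa> g z w u \<theta>\<bar> \<le>
        (\<integral>\<^sup>+\<theta>. ennreal \<bar>indicator {0..pi} \<theta> *\<^sub>R translation_integrand \<kappa> g z w u \<theta>\<bar> \<partial>lborel)"
      unfolding set_lebesgue_integral_def by (rule ennreal_norm_integral_le)
    also have "\<dots> = (\<integral>\<^sup>+\<theta>\<in>{0..pi}. ennreal \<bar>translation_integrand \<kappa> g z w u \<theta>\<bar> \<partial>lborel)"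
      by (rule nn_integral_cong) (auto split: split_indicator)
    finally show "ennreal \<bar>LINT \<theta>:{0..pi}|lborel. translation_integrand \<kappa> g z w u \<theta>\<bar> \<le> \<dots>" .
  qed
  finally have "ennreal (\<bar>translation \<kappa> g z w\<bar> * e) \<le> ennreal (D * e) *
      (\<integral>\<^sup>+u. (\<integral>\<^sup>+\<theta>\<in>{0..pi}. ennreal \<bar>translation_integrand \<kappa> g z w u \<theta>\<bar> \<partial>lborel) \<partial>Phi_measure \<kappa>)"
    by (simp add: mult_left_mono)
  also have "\<dots> \<le> translation_kernel \<kappa> (\<lambda>r. ennreal \<bar>g r * exp (- r / 2)\<bar>) z w"
    unfolding D_def e_def by (rule translation_le_kernel[OF \<kappa> \<alpha> g z w])
  finally show ?thesis unfolding e_def .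
qed

section \<open>Measurability and absolute convergence of the translation\<close>

lemma measurable_translation_integrand:
  fixes \<kappa> :: "real ^ 'n::finite"
  assumes g[measurable]: "g \<in> borel_measurable borel"
  shows "(\<lambda>q. translation_integrand \<kappa> g (fst (fst (fst q))) (snd (fst (fst q))) (snd (fst q)) (snd q)) \<in>
    borel_measurable (((conic_measure \<Otimes>\<^sub>M conic_measure) \<Otimes>\<^sub>M Phi_measure \<kappa>) \<Otimes>\<^sub>M lborel)"
proof -
  let ?C = "conic_measure :: ((real ^ 'n) \<times> real) measure"
  let ?M = "(?C \<Otimes>\<^sub>M ?C) \<Otimes>\<^sub>M Phi_measure \<kappa>"
  have t: "(\<lambda>q. snd (fst (fst q))) \<in> borel_measurable ?M" "(\<lambda>q. snd (snd (fst q))) \<in> borel_measurable ?M"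
    by (rule measurable_compose[OF measurable_compose[OF measurable_fst measurable_fst] measurable_conic_snd],
        rule measurable_compose[OF measurable_compose[OF measurable_fst measurable_snd] measurable_conic_snd])
  note t[measurable]
  have r: "(\<lambda>q. rho (fst (fst q)) (snd (fst q)) (snd q)) \<in> borel_measurable ?M"
    unfolding rho_eq using measurable_conic_Phi_inner[of \<kappa>] by measurable
  have [measurable]: "(\<lambda>q. rho (fst (fst (fst q))) (snd (fst (fst q))) (snd (fst q))) \<in> borel_measurable (?M \<Otimes>\<^sub>M lborel)"
    using measurable_compose[OF measurable_fst r] .
  have [measurable]: "(\<lambda>q. snd (fst (fst (fst q)))) \<in> borel_measurable (?M \<Otimes>\<^sub>M lborel)"
    "(\<lambda>q. snd (snd (fst (fst q)))) \<in> borel_measurable (?M \<Otimes>\<^sub>M lborel)"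
    using measurable_compose[OF measurable_fst t(1)] measurable_compose[OF measurable_fst t(2)] .
  have [measurable]: "(\<lambda>q. snd q) \<in> borel_measurable (?M \<Otimes>\<^sub>M lborel)"
    using measurable_snd[of ?M lborel] by simp
  show ?thesis
    unfolding translation_integrand_def Let_def by measurable
qed

lemma measurable_translation:
  fixes \<kappa> :: "real ^ 'n::finite"
  assumes \<kappa>: "\<And>i. \<kappa> $ i \<ge> 0" and g: "g \<in> borel_measurable borel"
  shows "(\<lambda>q. translation \<kappa> g (fst q) (snd q)) \<in> borel_measurable (conic_measure \<Otimes>\<^sub>M conic_measure)"
proof -
  interpret Phi: prob_space "Phi_measure \<kappa>" using \<kappa> by (rule prob_space_Phi_measure)
  let ?C = "conic_measure :: ((real ^ 'n) \<times> real) measure"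
  let ?M = "(?C \<Otimes>\<^sub>M ?C) \<Otimes>\<^sub>M Phi_measure \<kappa>"
  note measurable_translation_integrand[OF g, of \<kappa>, measurable]
  have [measurable]: "(\<lambda>q. snd q) \<in> borel_measurable (?M \<Otimes>\<^sub>M lborel)"
    using measurable_snd[of ?M lborel] by simp
  have "(\<lambda>q. indicator {0..pi} (snd q) *\<^sub>R translation_integrand \<kappa> g (fst (fst (fst q))) (snd (fst (fst q))) (snd (fst q)) (snd q))
      \<in> borel_measurable (?M \<Otimes>\<^sub>M lborel)"
    by measurable
  then have "(\<lambda>q. LINT \<theta>:{0..pi}|lborel. translation_integrand \<kappa> g (fst (fst q)) (snd (fst q)) (snd q) \<theta>) \<in> borel_measurable ?M"
    unfolding set_lebesgue_integral_def
    by (intro lborel.borel_measurable_lebesgue_integral) (simp add: case_prod_beta')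
  then have "(\<lambda>q. LINT u|Phi_measure \<kappa>. (LINT \<theta>:{0..pi}|lborel. translation_integrand \<kappa> g (fst q) (snd q) u \<theta>))
      \<in> borel_measurable (?C \<Otimes>\<^sub>M ?C)"
    by (intro Phi.borel_measurable_lebesgue_integral) (simp add: case_prod_beta')
  then show ?thesis
    unfolding translation_def by (intro borel_measurable_times borel_measurable_const)
qed

lemma integrable_translation_integrand:
  fixes \<kappa> :: "real ^ 'n::finite"
  assumes \<kappa>: "\<And>i. \<kappa> $ i \<ge> 0" and \<alpha>: "alpha \<kappa> \<ge> 1 / 2" and g: "g \<in> borel_measurable borel"
    and z: "z \<in> conic_surface" and w: "w \<in> conic_surface"
    and fin: "translation_kernel \<kappa> (\<lambda>r. ennreal \<bar>g r * exp (- r / 2)\<bar>) z w \<noteq> top"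
  shows "integrable (Phi_measure \<kappa> \<Otimes>\<^sub>M restrict_space lborel {0..pi})
          (\<lambda>(u, \<theta>). translation_integrand \<kappa> g z w u \<theta>)"
proof (rule integrableI_bounded)
  let ?R = "restrict_space lborel {0..pi}"
  have "sigma_finite_measure ?R"
    by (rule sigma_finite_measure_restrict_space[OF sigma_finite_lborel]) simp
  then interpret R: sigma_finite_measure ?R .
  have "(\<lambda>q. (((z, w), fst q), snd q)) \<in> Phi_measure \<kappa> \<Otimes>\<^sub>M ?R \<rightarrow>\<^sub>M
      ((conic_measure \<Otimes>\<^sub>M conic_measure) \<Otimes>\<^sub>M Phi_measure \<kappa>) \<Otimes>\<^sub>M lborel"
  proof (rule measurable_Pair[OF measurable_Pair[OF measurable_const measurable_fst]])
    show "(z, w) \<in> space (conic_measure \<Otimes>\<^sub>M conic_measure)"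
      using z w by (simp add: space_pair_measure)
    show "(\<lambda>q. snd q) \<in> Phi_measure \<kappa> \<Otimes>\<^sub>M ?R \<rightarrow>\<^sub>M lborel"
      by (rule measurable_compose[OF measurable_snd]) (simp add: measurable_restrict_space1)
  qed
  from measurable_compose[OF this measurable_translation_integrand[OF g]]
  show m: "(\<lambda>(u, \<theta>). translation_integrand \<kappa> g z w u \<theta>) \<in> borel_measurable (Phi_measure \<kappa> \<Otimes>\<^sub>M ?R)"
    by (simp add: case_prod_beta')
  let ?I = "\<integral>\<^sup>+u. (\<integral>\<^sup>+\<theta>\<in>{0..pi}. ennreal \<bar>translation_integrand \<kappa> g z w u \<theta>\<bar> \<partial>lborel) \<partial>Phi_measure \<kappa>"
  have "(\<integral>\<^sup>+q. ennreal (norm (case q of (u, \<theta>) \<Rightarrow> translation_integrand \<kappa> g z w u \<theta>)) \<partial>(Phi_measure \<kappa> \<Otimes>\<^sub>M ?R)) =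
     (\<integral>\<^sup>+u. \<integral>\<^sup>+\<theta>. ennreal \<bar>translation_integrand \<kappa> g z w u \<theta>\<bar> \<partial>?R \<partial>Phi_measure \<kappa>)"
    using m by (subst R.nn_integral_fst[symmetric]) auto
  also have "\<dots> = ?I"
    by (simp add: nn_integral_restrict_space)
  also have "\<dots> < \<infinity>"
  proof (rule ccontr)
    assume "\<not> ?I < \<infinity>"
    then have I: "?I = top" by (simp add: less_top[symmetric])
    define D where "D = 2 powr (alpha \<kappa> - 1) * Gamma (alpha \<kappa> + 1 / 2) / sqrt pi * exp (- (snd z + snd w) / 2)"
    have "D > 0" using \<alpha> by (simp add: D_def Gamma_real_pos)
    then have "ennreal D * top = top" by (simp add: ennreal_mult_top)
    then show False
      using translation_le_kernel[OF \<kappa> \<alpha> g z w] fin unfolding I D_def[symmetric]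
      by (simp add: top_unique)
  qed
  finally show "(\<integral>\<^sup>+q. ennreal (norm (case q of (u, \<theta>) \<Rightarrow> translation_integrand \<kappa> g z w u \<theta>)) \<partial>(Phi_measure \<kappa> \<Otimes>\<^sub>M ?R)) < \<infinity>" .
qed

section \<open>The pseudo convolution\<close>

text \<open>The underlying measure for the Schur test: with it the norm for finite \<open>p\<close>
  is an ordinary \<open>p\<close>-norm of \<open>\<bar>f\<bar> * exp (- t / 2)\<close>, and the
  kernel is symmetric without further weights.\<close>

definition u_measure :: "real ^ 'n::finite \<Rightarrow> ((real ^ 'n) \<times> real) measure" where
  "u_measure \<kappa> = density conic_measure (\<lambda>z. ennreal (b_const \<kappa> * u_weight \<kappa> z))"

lemma space_u_measure [simp]: "space (u_measure \<kappa>) = conic_surface"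
  by (simp add: u_measure_def)

lemma sets_u_measure [measurable_cong, simp]: "sets (u_measure \<kappa>) = sets conic_measure"
  by (simp add: u_measure_def)

lemma nn_integral_u_measure:
  assumes [measurable]: "f \<in> borel_measurable conic_measure" and b: "b_const \<kappa> \<ge> 0"
  shows "(\<integral>\<^sup>+z. f z \<partial>u_measure \<kappa>) =
    ennreal (b_const \<kappa>) * (\<integral>\<^sup>+z. f z * ennreal (u_weight \<kappa> z) \<partial>conic_measure)"
proof -
  note measurable_u_weight[of \<kappa>, measurable]
  have "(\<integral>\<^sup>+z. f z \<partial>u_measure \<kappa>) = (\<integral>\<^sup>+z. ennreal (b_const \<kappa> * u_weight \<kappa> z) * f z \<partial>conic_measure)"
    unfolding u_measure_def by (rule nn_integral_density) measurable
  also have "\<dots> = (\<integral>\<^sup>+z. ennreal (b_const \<kappa>) * (f z * ennreal (u_weight \<kappa> z)) \<partial>conic_measure)"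
    using b by (intro nn_integral_cong) (simp add: ennreal_mult u_weight_nonneg mult_ac)
  also have "\<dots> = ennreal (b_const \<kappa>) * (\<integral>\<^sup>+z. f z * ennreal (u_weight \<kappa> z) \<partial>conic_measure)"
    by (rule nn_integral_cmult) measurable
  finally show ?thesis .
qed

lemma sigma_finite_u_measure: "sigma_finite_measure (u_measure \<kappa>)"
  unfolding u_measure_def using measurable_u_weight[of \<kappa>]
  by (subst sigma_finite_measure.sigma_finite_iff_density_finite[OF sigma_finite_conic_measure]) auto

text \<open>The density of \<open>u_measure\<close> is positive almost everywhere, so its null sets
  are null sets of the unweighted conic measure, with respect to which existence is claimed.\<close>

lemma AE_u_measure:
  assumes "b_const \<kappa> > 0" "AE z in u_measure \<kappa>. P z"
  shows "AE z in conic_measure. P z"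
proof -
  have "AE z in conic_measure. 0 < ennreal (b_const \<kappa> * u_weight \<kappa> z) \<longrightarrow> P z"
    using assms(2) measurable_u_weight[of \<kappa>] unfolding u_measure_def
    by (subst (asm) AE_density) auto
  with AE_u_weight_pos[of \<kappa>] show ?thesis
    by eventually_elim (use assms(1) in simp)
qed

lemma conic_norm_finite:
  assumes f: "f \<in> borel_measurable conic_measure" and p: "p \<noteq> \<infinity>" and b: "b_const \<kappa> \<ge> 0"
  shows "conic_norm \<kappa> p f =
    enn_powr (\<integral>\<^sup>+z. ennreal ((\<bar>f z\<bar> * exp (- snd z / 2)) powr enn2real p) \<partial>u_measure \<kappa>) (1 / enn2real p)"
proof -
  note f[measurable] measurable_conic_snd[measurable]
  have "(\<integral>\<^sup>+(x, t). ennreal (\<bar>f (x, t) * exp (- t / 2)\<bar> powr enn2real p * u_weight \<kappa> (x, t)) \<partial>conic_measure) =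
      (\<integral>\<^sup>+z. ennreal ((\<bar>f z\<bar> * exp (- snd z / 2)) powr enn2real p) * ennreal (u_weight \<kappa> z) \<partial>conic_measure)"
    by (rule nn_integral_cong) (auto simp: abs_mult ennreal_mult u_weight_nonneg split: prod.split)
  moreover have "(\<lambda>z. ennreal ((\<bar>f z\<bar> * exp (- snd z / 2)) powr enn2real p)) \<in> borel_measurable conic_measure"
    by measurable
  ultimately show ?thesis
    using p b by (simp add: conic_norm_def nn_integral_u_measure)
qed

lemma conic_norm_infinity:
  "conic_norm \<kappa> \<infinity> f = esssup conic_measure (\<lambda>z. ennreal (\<bar>f z\<bar> * exp (- snd z / 2)))"
  by (simp add: conic_norm_def case_prod_beta')

lemma halfline_norm_1:
  assumes "a > 0"
  shows "halfline_norm a 1 g =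
    ennreal (1 / Gamma (a + 1)) * (\<integral>\<^sup>+t\<in>{0..}. ennreal \<bar>g t * exp (- t / 2)\<bar> * ennreal (t powr a) \<partial>lborel)"
  by (simp add: halfline_norm_def ennreal_mult)

text \<open>The row sums for the Schur test. After the comparison with the apex a radial integral
  remains; its sphere mass cancels against \<open>b_const\<close> and leaves
  \<open>1 / Gamma (2 * alpha \<kappa> + 1)\<close>, the normalization of the half-line
  norm.\<close>

lemma nn_integral_kernel_u_measure:
  fixes \<kappa> :: "real ^ 'n::finite"
  assumes \<kappa>: "\<And>i. \<kappa> $ i \<ge> 0" and \<alpha>: "alpha \<kappa> \<ge> 1 / 2" and g[measurable]: "g \<in> borel_measurable borel"
    and z: "z \<in> conic_surface"
  shows "(\<integral>\<^sup>+w. translation_kernel \<kappa> (\<lambda>r. ennreal \<bar>g r * exp (- r / 2)\<bar>) z w \<partial>u_measure \<kappa>) =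
    halfline_norm (2 * alpha \<kappa>) 1 g"
proof -
  define G where "G r = ennreal \<bar>g r * exp (- r / 2)\<bar>" for r
  have G[measurable]: "G \<in> borel_measurable borel" unfolding G_def by measurable
  have \<alpha>0: "alpha \<kappa> > 0" using \<alpha> by simp
  note b = b_const_eq[OF \<kappa> \<alpha>0]
  have Gp: "Gamma (2 * alpha \<kappa> + 1) > 0" using \<alpha>0 by (intro Gamma_real_pos) simp
  have b0: "b_const \<kappa> \<ge> 0" using b Gp by simp
  have Tm: "translation_kernel \<kappa> G z \<in> borel_measurable conic_measure"
    by (rule measurable_conic_slice[OF measurable_translation_kernel[OF \<kappa> G] z])
  have "(\<integral>\<^sup>+w. translation_kernel \<kappa> G z w \<partial>u_measure \<kappa>) =
      ennreal (b_const \<kappa>) * (\<integral>\<^sup>+w. G (snd w) * ennreal (u_weight \<kappa> w) \<partial>conic_measure)"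
    by (simp only: nn_integral_u_measure[OF Tm b0] nn_integral_translation_kernel[OF \<kappa> \<alpha>0 G z])
  also have "\<dots> = ennreal (b_const \<kappa>) * (ennreal (sphere_weight \<kappa>) * (\<integral>\<^sup>+t\<in>{0..}. G t * ennreal (t powr (2 * alpha \<kappa>)) \<partial>lborel))"
    by (simp only: nn_integral_conic_radial[OF \<kappa> G])
  also have "\<dots> = ennreal (b_const \<kappa> * sphere_weight \<kappa>) * (\<integral>\<^sup>+t\<in>{0..}. G t * ennreal (t powr (2 * alpha \<kappa>)) \<partial>lborel)"
    using b0 b(1) by (simp add: ennreal_mult mult.assoc)
  also have "b_const \<kappa> * sphere_weight \<kappa> = 1 / Gamma (2 * alpha \<kappa> + 1)"
    using b by simp
  finally show ?thesis
    using \<alpha>0 by (simp add: halfline_norm_1 G_def[abs_def])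
qed

text \<open>The factor \<open>exp (- t / 2)\<close> of the norm and \<open>exp (- s)\<close> of
  \<open>w_weight\<close> multiply to \<open>exp (- (t + s) / 2) * exp (- s / 2)\<close>: the first
  part is absorbed by the kernel bound, the second by \<open>f\<close>. Of the two estimates, the
  one with the absolute value inside the integral is for convergence, the other for the
  norm.\<close>

lemma pseudo_conv_le:
  fixes \<kappa> :: "real ^ 'n::finite"
  assumes \<kappa>: "\<And>i. \<kappa> $ i \<ge> 0" and \<alpha>: "alpha \<kappa> \<ge> 1 / 2" and g: "g \<in> borel_measurable borel"
    and f: "f \<in> borel_measurable conic_measure" and z: "z \<in> conic_surface"
  defines "Q \<equiv> \<integral>\<^sup>+w. translation_kernel \<kappa> (\<lambda>r. ennreal \<bar>g r * exp (- r / 2)\<bar>) z w * ennreal (\<bar>f w\<bar> * exp (- snd w / 2)) \<partial>u_measure \<kappa>"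
  shows "ennreal (b_const \<kappa> * exp (- snd z / 2)) * (\<integral>\<^sup>+w. ennreal \<bar>f w * translation \<kappa> g z w * w_weight \<kappa> w\<bar> \<partial>conic_measure) \<le> Q"
    and "ennreal (\<bar>pseudo_conv \<kappa> f g z\<bar> * exp (- snd z / 2)) \<le> Q"
proof -
  let ?f = "\<lambda>w. ennreal \<bar>f w * translation \<kappa> g z w * w_weight \<kappa> w\<bar>"
  define T where "T = translation_kernel \<kappa> (\<lambda>r. ennreal \<bar>g r * exp (- r / 2)\<bar>) z"
  define F where "F w = ennreal (\<bar>f w\<bar> * exp (- snd w / 2))" for w
  define e where "e = exp (- snd z / 2)"
  have e0: "e > 0" by (simp add: e_def)
  have \<alpha>0: "alpha \<kappa> > 0" using \<alpha> by simp
  have b0: "b_const \<kappa> \<ge> 0"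
    by (rule less_imp_le[OF b_const_pos[OF \<kappa> \<alpha>0]])
  note f[measurable] measurable_conic_snd[measurable] measurable_u_weight[of \<kappa>, measurable]
  have G: "(\<lambda>r. ennreal \<bar>g r * exp (- r / 2)\<bar>) \<in> borel_measurable borel" using g by measurable
  have Tm[measurable]: "T \<in> borel_measurable conic_measure"
    unfolding T_def by (rule measurable_conic_slice[OF measurable_translation_kernel[OF \<kappa> G] z])
  have Fm[measurable]: "F \<in> borel_measurable conic_measure" unfolding F_def by measurable
  have trm[measurable]: "translation \<kappa> g z \<in> borel_measurable conic_measure"
    by (rule measurable_conic_slice[OF measurable_translation[OF \<kappa> g] z])
  note measurable_w_weight[of \<kappa>, measurable]
  have Q: "Q = ennreal (b_const \<kappa>) * (\<integral>\<^sup>+w. T w * F w * ennreal (u_weight \<kappa> w) \<partial>conic_measure)"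
    unfolding Q_def T_def[symmetric] F_def[symmetric]
    by (rule nn_integral_u_measure[OF _ b0]) measurable
  have "ennreal e * (\<integral>\<^sup>+w. ?f w \<partial>conic_measure) =
      (\<integral>\<^sup>+w. ennreal e * ?f w \<partial>conic_measure)"
    by (rule nn_integral_cmult[symmetric]) measurable
  also have "\<dots> \<le> (\<integral>\<^sup>+w. T w * F w * ennreal (u_weight \<kappa> w) \<partial>conic_measure)"
  proof (rule nn_integral_mono)
    fix w :: "(real ^ 'n) \<times> real" assume "w \<in> space conic_measure"
    then have w: "w \<in> conic_surface" by simp
    have u0: "u_weight \<kappa> w \<ge> 0" by (rule u_weight_nonneg[OF w])
    have ex: "e * exp (- snd w) = exp (- (snd z + snd w) / 2) * exp (- snd w / 2)"
      by (simp add: e_def exp_add[symmetric]) (simp add: field_simps)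
    have "e * \<bar>f w * translation \<kappa> g z w * w_weight \<kappa> w\<bar> = \<bar>f w\<bar> * \<bar>translation \<kappa> g z w\<bar> * u_weight \<kappa> w * (e * exp (- snd w))"
      using u0 by (simp add: w_weight_eq abs_mult)
    also have "\<dots> = (\<bar>translation \<kappa> g z w\<bar> * exp (- (snd z + snd w) / 2)) * (\<bar>f w\<bar> * exp (- snd w / 2)) * u_weight \<kappa> w"
      unfolding ex by (simp only: mult_ac)
    finally have "ennreal e * ?f w =
        ennreal (\<bar>translation \<kappa> g z w\<bar> * exp (- (snd z + snd w) / 2)) * F w * ennreal (u_weight \<kappa> w)"
      using e0 u0 by (simp add: F_def ennreal_mult[symmetric])
    also have "\<dots> \<le> T w * F w * ennreal (u_weight \<kappa> w)"
      unfolding T_def by (intro mult_right_mono abs_translation_le_kernel \<kappa> \<alpha> g z w) auto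
    finally show "ennreal e * ?f w \<le> T w * F w * ennreal (u_weight \<kappa> w)" .
  qed
  finally have "ennreal (b_const \<kappa>) * (ennreal e * (\<integral>\<^sup>+w. ?f w \<partial>conic_measure)) \<le> Q"
    unfolding Q by (rule mult_left_mono) simp
  then show 1: "ennreal (b_const \<kappa> * exp (- snd z / 2)) * (\<integral>\<^sup>+w. ?f w \<partial>conic_measure) \<le> Q"
    unfolding e_def[symmetric] using b0 e0 by (simp add: ennreal_mult mult.assoc)
  have "ennreal (\<bar>pseudo_conv \<kappa> f g z\<bar> * e) = ennreal (b_const \<kappa> * e) * ennreal \<bar>LINT w|conic_measure. f w * translation \<kappa> g z w * w_weight \<kappa> w\<bar>"
    using b0 e0 by (simp add: pseudo_conv_def abs_mult ennreal_mult[symmetric] mult_ac)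
  also have "\<dots> \<le> ennreal (b_const \<kappa> * e) * (\<integral>\<^sup>+w. ?f w \<partial>conic_measure)"
    by (intro mult_left_mono ennreal_norm_integral_le) simp
  also have "\<dots> \<le> Q" using 1 by (simp add: e_def)
  finally show "ennreal (\<bar>pseudo_conv \<kappa> f g z\<bar> * exp (- snd z / 2)) \<le> Q" by (simp add: e_def)
qed

text \<open>The finite row integral makes the kernel finite for almost every \<open>w\<close>, and
  there the translation converges absolutely. Finiteness of the majorant at \<open>z\<close> gives
  integrability of the outer integrand.\<close>

lemma pseudo_conv_existsI:
  fixes \<kappa> :: "real ^ 'n::finite"
  assumes \<kappa>: "\<And>i. \<kappa> $ i \<ge> 0" and \<alpha>: "alpha \<kappa> \<ge> 1 / 2" and g: "g \<in> borel_measurable borel"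
    and f: "f \<in> borel_measurable conic_measure" and z: "z \<in> conic_surface"
    and N: "halfline_norm (2 * alpha \<kappa>) 1 g \<noteq> top"
    and Q: "(\<integral>\<^sup>+w. translation_kernel \<kappa> (\<lambda>r. ennreal \<bar>g r * exp (- r / 2)\<bar>) z w * ennreal (\<bar>f w\<bar> * exp (- snd w / 2)) \<partial>u_measure \<kappa>) \<noteq> top"
  shows "pseudo_conv_exists \<kappa> f g z"
  unfolding pseudo_conv_exists_def
proof
  let ?T = "translation_kernel \<kappa> (\<lambda>r. ennreal \<bar>g r * exp (- r / 2)\<bar>) z"
  have \<alpha>0: "alpha \<kappa> > 0" using \<alpha> by simp
  have b0: "b_const \<kappa> > 0"
    by (rule b_const_pos[OF \<kappa> \<alpha>0])
  have G: "(\<lambda>r. ennreal \<bar>g r * exp (- r / 2)\<bar>) \<in> borel_measurable borel" using g by measurable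
  have Tm: "?T \<in> borel_measurable conic_measure"
    by (rule measurable_conic_slice[OF measurable_translation_kernel[OF \<kappa> G] z])
  have "AE w in u_measure \<kappa>. ?T w \<noteq> \<infinity>"
    using nn_integral_kernel_u_measure[OF \<kappa> \<alpha> g z] N Tm
    by (intro nn_integral_PInf_AE) (auto simp: measurable_cong_sets[OF sets_u_measure refl])
  then have "AE w in conic_measure. ?T w \<noteq> \<infinity>"
    by (rule AE_u_measure[OF b0])
  then show "AE w in conic_measure. integrable (Phi_measure \<kappa> \<Otimes>\<^sub>M restrict_space lborel {0..pi})
      (\<lambda>(u, \<theta>). translation_integrand \<kappa> g z w u \<theta>)"
    by (rule AE_mp, intro AE_I2 impI integrable_translation_integrand \<kappa> \<alpha> g z) auto
  show "integrable conic_measure (\<lambda>w. f w * translation \<kappa> g z w * w_weight \<kappa> w)"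
  proof (rule integrableI_bounded)
    note f[measurable] measurable_conic_snd[measurable] measurable_u_weight[of \<kappa>, measurable]
    have trm[measurable]: "translation \<kappa> g z \<in> borel_measurable conic_measure"
      by (rule measurable_conic_slice[OF measurable_translation[OF \<kappa> g] z])
    note measurable_w_weight[of \<kappa>, measurable]
    show "(\<lambda>w. f w * translation \<kappa> g z w * w_weight \<kappa> w) \<in> borel_measurable conic_measure"
      by measurable
    let ?I = "\<integral>\<^sup>+w. ennreal \<bar>f w * translation \<kappa> g z w * w_weight \<kappa> w\<bar> \<partial>conic_measure"
    have "?I \<noteq> top"
    proof
      assume I: "?I = top"
      define D where "D = b_const \<kappa> * exp (- snd z / 2)"
      have "D > 0" using b0 by (simp add: D_def)
      then have "ennreal D * top = top" by (simp add: ennreal_mult_top)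
      then show False
        using pseudo_conv_le(1)[OF \<kappa> \<alpha> g f z] Q unfolding I D_def[symmetric] by (simp add: top_unique)
    qed
    then show "(\<integral>\<^sup>+w. ennreal (norm (f w * translation \<kappa> g z w * w_weight \<kappa> w)) \<partial>conic_measure) < \<infinity>"
      by (simp add: less_top)
  qed
qed

lemma measurable_pseudo_conv:
  fixes \<kappa> :: "real ^ 'n::finite"
  assumes \<kappa>: "\<And>i. \<kappa> $ i \<ge> 0" and g: "g \<in> borel_measurable borel"
    and f: "f \<in> borel_measurable conic_measure"
  shows "pseudo_conv \<kappa> f g \<in> borel_measurable conic_measure"
proof -
  let ?C = "conic_measure :: ((real ^ 'n) \<times> real) measure"
  note measurable_translation[OF \<kappa> g, measurable] f[measurable] measurable_conic_snd[measurable] measurable_u_weight[of \<kappa>, measurable]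
  note wm = measurable_w_weight[of \<kappa>]
  have [measurable]: "(\<lambda>q. w_weight \<kappa> (snd q)) \<in> borel_measurable (?C \<Otimes>\<^sub>M ?C)"
    "(\<lambda>q. f (snd q)) \<in> borel_measurable (?C \<Otimes>\<^sub>M ?C)"
    using measurable_compose[OF measurable_snd wm] measurable_compose[OF measurable_snd f] .
  have "(\<lambda>q. f (snd q) * translation \<kappa> g (fst q) (snd q) * w_weight \<kappa> (snd q)) \<in> borel_measurable (?C \<Otimes>\<^sub>M ?C)"
    by measurable
  then have "(\<lambda>z. LINT w|?C. f w * translation \<kappa> g z w * w_weight \<kappa> w) \<in> borel_measurable ?C"
    by (intro conic.borel_measurable_lebesgue_integral) (simp add: case_prod_beta')
  then show ?thesis
    unfolding pseudo_conv_def by (intro borel_measurable_times borel_measurable_const)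
qed

text \<open>For \<open>p = \<infinity>\<close> the row integrals suffice, and the majorant
  \<open>Q\<close> is finite at every point of the cone. For finite \<open>p\<close> the Schur test
  bounds the integral of \<open>Q\<close> to the power \<open>p\<close>; its finiteness makes
  \<open>Q\<close> finite almost everywhere, which gives existence there.\<close>

lemma pseudo_conv_norm_le:
  fixes \<kappa> :: "real ^ 'n::finite"
  assumes \<kappa>: "\<And>i. \<kappa> $ i \<ge> 0" and \<alpha>: "alpha \<kappa> \<ge> 1 / 2" and p: "1 \<le> p"
    and fL: "f \<in> conic_Lp \<kappa> p" and g: "g \<in> borel_measurable borel"
    and N: "halfline_norm (2 * alpha \<kappa>) 1 g < \<infinity>"
  shows "(AE z in conic_measure. pseudo_conv_exists \<kappa> f g z) \<and>
    conic_norm \<kappa> p (pseudo_conv \<kappa> f g) \<le> conic_norm \<kappa> p f * halfline_norm (2 * alpha \<kappa>) 1 g"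
proof -
  have f: "f \<in> borel_measurable conic_measure" and fn: "conic_norm \<kappa> p f < \<infinity>"
    using fL by (auto simp: conic_Lp_def)
  let ?\<mu> = "u_measure \<kappa>"
  define T where "T = translation_kernel \<kappa> (\<lambda>r. ennreal \<bar>g r * exp (- r / 2)\<bar>)"
  define F where "F w = \<bar>f w\<bar> * exp (- snd w / 2)" for w
  define Q where "Q z = (\<integral>\<^sup>+w. T z w * ennreal (F w) \<partial>?\<mu>)" for z
  interpret \<mu>: sigma_finite_measure ?\<mu> by (rule sigma_finite_u_measure)
  have \<alpha>0: "alpha \<kappa> > 0" using \<alpha> by simp
  have b0: "b_const \<kappa> > 0"
    by (rule b_const_pos[OF \<kappa> \<alpha>0])
  obtain B where B: "halfline_norm (2 * alpha \<kappa>) 1 g = ennreal B" "B \<ge> 0"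
    using N by (cases "halfline_norm (2 * alpha \<kappa>) 1 g") auto
  note f[measurable] measurable_conic_snd[measurable]
  have Fm: "F \<in> borel_measurable conic_measure" unfolding F_def by measurable
  then have Fm'[measurable]: "F \<in> borel_measurable ?\<mu>" by (simp add: measurable_cong_sets[OF sets_u_measure refl])
  have F0: "F w \<ge> 0" for w by (simp add: F_def)
  have G: "(\<lambda>r. ennreal \<bar>g r * exp (- r / 2)\<bar>) \<in> borel_measurable borel" using g by measurable
  have pair: "sets (?\<mu> \<Otimes>\<^sub>M ?\<mu>) = sets (conic_measure \<Otimes>\<^sub>M conic_measure)"
    by (intro sets_pair_measure_cong) simp_all
  have Tm[measurable]: "case_prod T \<in> borel_measurable (?\<mu> \<Otimes>\<^sub>M ?\<mu>)"
    unfolding T_def measurable_cong_sets[OF pair refl] case_prod_beta'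
    by (rule measurable_translation_kernel[OF \<kappa> G])
  have row: "(\<integral>\<^sup>+w. T z w \<partial>?\<mu>) = ennreal B" if "z \<in> conic_surface" for z
    unfolding T_def using nn_integral_kernel_u_measure[OF \<kappa> \<alpha> g that] B by simp
  have col: "(\<integral>\<^sup>+z. T z w \<partial>?\<mu>) = ennreal B" if "w \<in> conic_surface" for w
    using row[OF that] unfolding T_def by (simp only: translation_kernel_sym[of _ _ _ w])
  have le: "ennreal (\<bar>pseudo_conv \<kappa> f g z\<bar> * exp (- snd z / 2)) \<le> Q z" if "z \<in> conic_surface" for z
    unfolding Q_def T_def F_def by (rule pseudo_conv_le(2)[OF \<kappa> \<alpha> g f that])
  have ex: "pseudo_conv_exists \<kappa> f g z" if "z \<in> conic_surface" "Q z \<noteq> top" for z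
    using that N unfolding Q_def T_def F_def by (intro pseudo_conv_existsI \<kappa> \<alpha> g f) auto
  have cm: "pseudo_conv \<kappa> f g \<in> borel_measurable conic_measure"
    by (rule measurable_pseudo_conv[OF \<kappa> g f])
  note cm[measurable]
  show ?thesis
  proof (cases "p = \<infinity>")
    case True
    define S where "S = conic_norm \<kappa> p f"
    have "AE w in conic_measure. ennreal (F w) \<le> S"
      unfolding S_def True conic_norm_infinity F_def by (rule esssup_AE)
    then have FS: "AE w in ?\<mu>. ennreal (F w) \<le> S"
      unfolding u_measure_def using measurable_u_weight[of \<kappa>]
      by (subst AE_density) (auto elim: eventually_mono)
    have QS: "Q z \<le> S * ennreal B" if z: "z \<in> conic_surface" for z
    proof -
      have [measurable]: "T z \<in> borel_measurable ?\<mu>"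
        using measurable_compose[OF measurable_Pair1'[of z ?\<mu> ?\<mu>] Tm] z by simp
      have "Q z \<le> (\<integral>\<^sup>+w. S * T z w \<partial>?\<mu>)"
        unfolding Q_def by (rule nn_integral_mono_AE, use FS in eventually_elim)
          (simp add: mult.commute[of S] mult_left_mono)
      also have "\<dots> = S * ennreal B" using row[OF z] by (simp add: nn_integral_cmult)
      finally show ?thesis .
    qed
    have "S * ennreal B \<noteq> top" using fn by (simp add: S_def ennreal_mult_eq_top_iff)
    then have "Q z \<noteq> top" if "z \<in> conic_surface" for z
      using QS[OF that] by (auto simp: top_unique)
    then have "AE z in conic_measure. pseudo_conv_exists \<kappa> f g z"
      by (intro AE_I2 ex) auto
    moreover have "conic_norm \<kappa> p (pseudo_conv \<kappa> f g) \<le> S * ennreal B"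
      unfolding True conic_norm_infinity
    proof (rule esssup_I)
      show "(\<lambda>z. ennreal (\<bar>pseudo_conv \<kappa> f g z\<bar> * exp (- snd z / 2))) \<in> borel_measurable conic_measure"
        by measurable
      show "AE z in conic_measure. ennreal (\<bar>pseudo_conv \<kappa> f g z\<bar> * exp (- snd z / 2)) \<le> S * ennreal B"
        by (intro AE_I2 order_trans[OF le QS]) auto
    qed
    ultimately show ?thesis by (simp add: S_def B)
  next
    case False
    define P where "P = enn2real p"
    have P: "P \<ge> 1"
      using p False unfolding P_def by (cases p) auto
    have schur: "(\<integral>\<^sup>+z. enn_powr (Q z) P \<partial>?\<mu>) \<le> ennreal (B powr P) * (\<integral>\<^sup>+w. ennreal (F w powr P) \<partial>?\<mu>)"
      unfolding Q_def by (rule \<mu>.nn_integral_schur_test[OF Tm Fm' F0 B(2) _ _ P]) (auto simp: row col)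
    have Qm: "Q \<in> borel_measurable ?\<mu>" unfolding Q_def by measurable
    have nf: "conic_norm \<kappa> p f = enn_powr (\<integral>\<^sup>+w. ennreal (F w powr P) \<partial>?\<mu>) (1 / P)"
      unfolding F_def P_def using conic_norm_finite[OF f False] b0 by simp
    then have If: "(\<integral>\<^sup>+w. ennreal (F w powr P) \<partial>?\<mu>) \<noteq> top"
      using fn by auto
    have "(\<integral>\<^sup>+z. enn_powr (Q z) P \<partial>?\<mu>) \<noteq> \<infinity>"
      using schur If by (auto simp: top_unique ennreal_mult_eq_top_iff)
    then have "AE z in ?\<mu>. enn_powr (Q z) P \<noteq> \<infinity>"
      by (rule nn_integral_PInf_AE[OF measurable_compose[OF Qm measurable_enn_powr]])
    then have "AE z in conic_measure. enn_powr (Q z) P \<noteq> \<infinity>"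
      by (rule AE_u_measure[OF b0])
    then have "AE z in conic_measure. pseudo_conv_exists \<kappa> f g z"
      by (rule AE_mp, intro AE_I2 impI ex) auto
    moreover have "conic_norm \<kappa> p (pseudo_conv \<kappa> f g) \<le> conic_norm \<kappa> p f * ennreal B"
    proof -
      have "conic_norm \<kappa> p (pseudo_conv \<kappa> f g) =
          enn_powr (\<integral>\<^sup>+z. enn_powr (ennreal (\<bar>pseudo_conv \<kappa> f g z\<bar> * exp (- snd z / 2))) P \<partial>?\<mu>) (1 / P)"
        unfolding P_def using conic_norm_finite[OF cm False] b0 by (simp add: enn_powr_ennreal)
      also have "\<dots> \<le> enn_powr (\<integral>\<^sup>+z. enn_powr (Q z) P \<partial>?\<mu>) (1 / P)"
        using P by (intro enn_powr_mono nn_integral_mono le) auto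
      also have "\<dots> \<le> enn_powr (ennreal (B powr P) * (\<integral>\<^sup>+w. ennreal (F w powr P) \<partial>?\<mu>)) (1 / P)"
        using P by (intro enn_powr_mono schur) auto
      also have "\<dots> = ennreal B * conic_norm \<kappa> p f"
        unfolding nf using enn_powr_mult[of B "1 / P" "\<integral>\<^sup>+w. ennreal (F w powr P) \<partial>?\<mu>"] B(2) P by simp
      finally show ?thesis by (simp add: mult.commute)
    qed
    ultimately show ?thesis by (simp add: B)
  qed
qed

text \<open>The argument of \<open>g\<close> is at least \<open>t + s - 2 * \<rho>\<close>, which is
  nonnegative by \<open>rho_bounds\<close>, so the translation sees only values on the
  half-line.\<close>

lemma translation_integrand_cong:
  assumes "z \<in> conic_surface" "w \<in> conic_surface" "u \<in> space (Phi_measure \<kappa>)"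
    and g: "\<And>r. r \<ge> 0 \<Longrightarrow> g r = h r"
  shows "translation_integrand \<kappa> g z w u \<theta> = translation_integrand \<kappa> h z w u \<theta>"
proof -
  note r = rho_bounds[OF assms(1-3)]
  have "rho z w u * cos \<theta> \<ge> rho z w u * (- 1)"
    using r(1) by (intro mult_left_mono) auto
  then have "snd z + snd w + 2 * rho z w u * cos \<theta> \<ge> 0" using r(2) by simp
  then show ?thesis by (simp add: translation_integrand_def Let_def g)
qed

theorem theorem4p7:
  fixes \<kappa> :: "real ^ 'n::finite" and p :: ennreal
    and f :: "(real ^ 'n) \<times> real \<Rightarrow> real" and g :: "real \<Rightarrow> real"
  assumes "CARD('n) \<ge> 2"
    and "\<And>i. \<kappa> $ i \<ge> 0"
    and "alpha \<kappa> \<ge> 1 / 2"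
    and "1 \<le> p"
    and "f \<in> conic_Lp \<kappa> p"
    and "g \<in> halfline_Lp (2 * alpha \<kappa>) 1"
  shows "(AE z in conic_measure. pseudo_conv_exists \<kappa> f g z) \<and>
    pseudo_conv \<kappa> f g \<in> conic_Lp \<kappa> p \<and>
    conic_norm \<kappa> p (pseudo_conv \<kappa> f g) \<le> conic_norm \<kappa> p f * halfline_norm (2 * alpha \<kappa>) 1 g"
proof -
  note \<kappa> = assms(2) and \<alpha> = assms(3)
  \<comment> \<open>Measurability of \<open>g\<close> is given on the half-line only. Extension by 0
    makes it Borel on the whole line, as the lemmas above require, and changes neither its norm nor
    the translation at points of the cone.\<close>
  define h where "h r = indicator {0..} r * g r" for r
  have gh: "g r = h r" if "r \<ge> 0" for r using that by (simp add: h_def)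
  have h: "h \<in> borel_measurable borel"
    using assms(6) unfolding h_def by (simp add: halfline_Lp_def borel_measurable_restrict_space_iff)
  have hn: "halfline_norm (2 * alpha \<kappa>) 1 g = halfline_norm (2 * alpha \<kappa>) 1 h"
  proof -
    have "(\<integral>\<^sup>+t\<in>{0..}. ennreal (\<bar>g t * exp (- t / 2)\<bar> powr 1 * t powr (2 * alpha \<kappa>)) \<partial>lborel) =
        (\<integral>\<^sup>+t\<in>{0..}. ennreal (\<bar>h t * exp (- t / 2)\<bar> powr 1 * t powr (2 * alpha \<kappa>)) \<partial>lborel)"
    proof (rule nn_integral_cong)
      fix t :: real
      show "ennreal (\<bar>g t * exp (- t / 2)\<bar> powr 1 * t powr (2 * alpha \<kappa>)) * indicator {0..} t =
          ennreal (\<bar>h t * exp (- t / 2)\<bar> powr 1 * t powr (2 * alpha \<kappa>)) * indicator {0..} t"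
        by (cases "t \<ge> 0") (simp_all add: gh)
    qed
    then show ?thesis unfolding halfline_norm_def by (simp only:)
  qed
  have N: "halfline_norm (2 * alpha \<kappa>) 1 h < \<infinity>"
    using assms(6) hn by (simp add: halfline_Lp_def)
  have f: "f \<in> borel_measurable conic_measure" "conic_norm \<kappa> p f < \<infinity>"
    using assms(5) by (auto simp: conic_Lp_def)
  have tr: "translation \<kappa> g z w = translation \<kappa> h z w" if "z \<in> conic_surface" "w \<in> conic_surface" for z w
  proof -
    have "translation_integrand \<kappa> g z w u = translation_integrand \<kappa> h z w u" if u: "u \<in> space (Phi_measure \<kappa>)" for u
      by (rule ext) (rule translation_integrand_cong[OF \<open>z \<in> _\<close> \<open>w \<in> _\<close> u gh])
    then show ?thesis
      unfolding translation_def by (intro arg_cong2[where f = "(*)"] refl Bochner_Integration.integral_cong) simp_all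
  qed
  have pc: "pseudo_conv \<kappa> f g z = pseudo_conv \<kappa> f h z" if "z \<in> conic_surface" for z
    unfolding pseudo_conv_def using tr[OF that]
    by (intro arg_cong2[where f = "(*)"] refl Bochner_Integration.integral_cong) simp_all
  have ex: "pseudo_conv_exists \<kappa> f g z \<longleftrightarrow> pseudo_conv_exists \<kappa> f h z" if z: "z \<in> conic_surface" for z
  proof -
    have "integrable (Phi_measure \<kappa> \<Otimes>\<^sub>M restrict_space lborel {0..pi}) (\<lambda>(u, \<theta>). translation_integrand \<kappa> g z w u \<theta>) \<longleftrightarrow>
        integrable (Phi_measure \<kappa> \<Otimes>\<^sub>M restrict_space lborel {0..pi}) (\<lambda>(u, \<theta>). translation_integrand \<kappa> h z w u \<theta>)"
      if w: "w \<in> conic_surface" for w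
      by (rule Bochner_Integration.integrable_cong[OF refl])
        (auto simp: space_pair_measure intro!: translation_integrand_cong[OF z w _ gh])
    moreover have "integrable conic_measure (\<lambda>w. f w * translation \<kappa> g z w * w_weight \<kappa> w) \<longleftrightarrow>
        integrable conic_measure (\<lambda>w. f w * translation \<kappa> h z w * w_weight \<kappa> w)"
      by (rule Bochner_Integration.integrable_cong[OF refl]) (simp add: tr[OF z])
    ultimately show ?thesis
      unfolding pseudo_conv_exists_def by (intro arg_cong2[where f = "(\<and>)"] AE_cong) simp_all
  qed
  note main = pseudo_conv_norm_le[OF \<kappa> \<alpha> assms(4,5) h N]
  have hm: "pseudo_conv \<kappa> f h \<in> borel_measurable conic_measure"
    by (rule measurable_pseudo_conv[OF \<kappa> h f(1)])
  then have gm: "pseudo_conv \<kappa> f g \<in> borel_measurable conic_measure"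
    using pc by (subst measurable_cong[where g = "pseudo_conv \<kappa> f h"]) simp_all
  have cn: "conic_norm \<kappa> p (pseudo_conv \<kappa> f g) = conic_norm \<kappa> p (pseudo_conv \<kappa> f h)"
  proof (cases "p = \<infinity>")
    case True
    note gm[measurable] hm[measurable] measurable_conic_snd[measurable]
    show ?thesis
      unfolding True conic_norm_infinity by (rule esssup_AE_cong) (measurable, intro AE_I2, simp add: pc)
  next
    case False
    then show ?thesis
      unfolding conic_norm_def using pc
      by (auto intro!: arg_cong2[where f = enn_powr] arg_cong2[where f = "(*)"] nn_integral_cong split: prod.split)
  qed
  have "AE z in conic_measure. pseudo_conv_exists \<kappa> f g z"
    using main by (subst AE_cong[where Q = "pseudo_conv_exists \<kappa> f h"]) (auto simp: ex)
  moreover have le: "conic_norm \<kappa> p (pseudo_conv \<kappa> f g) \<le> conic_norm \<kappa> p f * halfline_norm (2 * alpha \<kappa>) 1 g"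
    using main by (simp add: cn hn)
  moreover have "conic_norm \<kappa> p (pseudo_conv \<kappa> f g) < \<infinity>"
    using le_less_trans[OF le] f(2) N hn by (simp add: ennreal_mult_less_top)
  ultimately show ?thesis using gm by (simp add: conic_Lp_def)
qed

end
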